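(* Let $d\ge 1$ be fixed, let $(r_n)$ be radii with $0<r_n<1/4$, let $\mu_n=n\phi_d r_n^d$, let $k_n\ge2$ be integers, and let $G_{k_n}(n,r_n)$ be the hard random geometric graph with planted clique $K_n$ of size $k_n$. Suppose either (i) $\lim_{n\to\infty}\mu_n/\log n=\alpha\in(0,\infty)$ and $k_n\le(1-\varepsilon)(T(n)-\mu_n)$ for some fixed $0<\varepsilon<1$, where $T(n)=\mu_nH_+^{-1}(1/\alpha)$; or (ii) $\lim_{n\to\infty}\mu_n/\log n=\infty$, with $\mu_n=o(n)$ and $k_n=o(\sqrt{\mu_n})$. Then the VD-algorithm fails to recover the planted clique in $G_{k_n}(n,r_n)$ with high probability, that is, $\lim_{n\to\infty}\mathbb P(\hat K_n^{(\mathrm{VD})}=K_n)=0$.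
   Context: Random graph model. Fix $d\ge1$. Let $X_1,X_2,\dots$ be i.i.d. uniform on $[0,1]^d$ with the toroidal metric $d_T(x,y)=\bigl(\sum_{i=1}^d \min(|x_i-y_i|,1-|x_i-y_i|)^2\bigr)^{1/2}$, and let $N_n$ be a Poisson random variable with mean $n$, independent of the positions. The hard random geometric graph $G(n,r_n)$ has vertex set $V=\{1,\dots,N_n\}$, and two distinct vertices $i,j$ are adjacent if and only if $d_T(X_i,X_j)\le r_n$. It is assumed that $0<r_n<1/4$. The expected degree is $\mu_n=n\phi_d r_n^d$, where $\phi_d$ is the volume of the unit ball in $\mathbb R^d$. Planted clique. Given integers $k_n\ge2$, select uniformly at random a set $K_n\subset V$ of $k_n$ vertices (it is implicit that $k_n\le N_n$) and add all missing edges between pairs of vertices of $K_n$. The resulting graph is $G_{k_n}(n,r_n)$. VD-algorithm. Given the graph $G_{k_n}(n,r_n)$ and $k_n$, compute the degrees $Z_i$ of all vertices $i\in V$ in $G_{k_n}(n,r_n)$ and return the set $\hat K_n^{(\mathrm{VD})}$ of the $k_n$ vertices with the largest degrees. The recovery event $\{\hat K_n^{(\mathrm{VD})}=K_n\}$ is identified with $\{\min_{i\in K_n}Z_i>\max_{i\in V\setminus K_n}Z_i\}$. Function. $H(x)=1-x+x\log x$; $H_+^{-1}$ is the inverse of $H$ restricted to $[1,\infty)$. *)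

theory Defs
  imports "HOL-Probability.Probability"
begin

definition torus_dist :: "real ^ 'd \<Rightarrow> real ^ 'd \<Rightarrow> real" where
  "torus_dist x y = sqrt (\<Sum>i\<in>UNIV. (min \<bar>x $ i - y $ i\<bar> (1 - \<bar>x $ i - y $ i\<bar>))\<^sup>2)"

(* Graphs on the vertex set {1..m} are given by their edge sets, an edge being a
   two-element set of vertices. *)

definition rgg_edges :: "(nat \<Rightarrow> real ^ 'd) \<Rightarrow> nat \<Rightarrow> real \<Rightarrow> nat set set" where
  "rgg_edges x m r =
     {{i, j} | i j. i \<in> {1..m} \<and> j \<in> {1..m} \<and> i \<noteq> j \<and> torus_dist (x i) (x j) \<le> r}"

definition add_clique :: "nat set set \<Rightarrow> nat set \<Rightarrow> nat set set" where
  "add_clique E K = E \<union> {{i, j} | i j. i \<in> K \<and> j \<in> K \<and> i \<noteq> j}"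

definition vdegree :: "nat set set \<Rightarrow> nat \<Rightarrow> nat" where
  "vdegree E i = card {e \<in> E. i \<in> e}"

(* S is a set of k vertices of largest degree; there are several such sets exactly when
   there is a tie between a vertex inside S and a vertex outside S. *)

definition vd_output :: "nat set \<Rightarrow> nat set set \<Rightarrow> nat \<Rightarrow> nat set \<Rightarrow> bool" where
  "vd_output V E k S \<longleftrightarrow>
     S \<subseteq> V \<and> card S = k \<and> (\<forall>i\<in>S. \<forall>j\<in>V - S. vdegree E j \<le> vdegree E i)"

(* The recovery event: the minimal degree in K exceeds the maximal degree outside K (which
   is vacuous if K = V).  By vd_recovers_iff this says that K is the only possible output
   of the algorithm, i.e. a tie at the boundary counts as failure. *)

definition vd_recovers :: "nat set \<Rightarrow> nat set set \<Rightarrow> nat set \<Rightarrow> bool" where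
  "vd_recovers V E K \<longleftrightarrow>
     (V - K \<noteq> {} \<longrightarrow> Min (vdegree E ` K) > Max (vdegree E ` (V - K)))"

lemma vd_recovers_iff:
  assumes "finite V" "K \<subseteq> V" "K \<noteq> {}"
  shows "vd_recovers V E K \<longleftrightarrow> (\<forall>S. vd_output V E (card K) S \<longleftrightarrow> S = K)"
proof -
  have fin: "finite K" using assms finite_subset by blast
  have eq: "vd_recovers V E K \<longleftrightarrow> (\<forall>i\<in>K. \<forall>j\<in>V - K. vdegree E j < vdegree E i)"
    unfolding vd_recovers_def using assms fin by (subst Min_gr_iff; force)
  show ?thesis
  proof
    assume R: "vd_recovers V E K"
    show "\<forall>S. vd_output V E (card K) S \<longleftrightarrow> S = K"
    proof (intro allI iffI)
      fix S assume S: "vd_output V E (card K) S"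
      show "S = K"
      proof (rule ccontr)
        assume ne: "S \<noteq> K"
        have fS: "finite S" and cS: "card S = card K"
          using S assms(1) finite_subset by (auto simp: vd_output_def)
        have "\<not> S \<subseteq> K" "\<not> K \<subseteq> S"
          using card_subset_eq[OF fin] card_subset_eq[OF fS] ne cS by auto
        then obtain i j where ij: "i \<in> S - K" "j \<in> K - S" by blast
        then have "i \<in> V" "j \<in> V" using S assms(2) by (auto simp: vd_output_def)
        then have "vdegree E i < vdegree E j" "vdegree E j \<le> vdegree E i"
          using S R ij by (auto simp: eq vd_output_def)
        then show False by simp
      qed
    qed (use R assms(2) in \<open>auto simp: eq vd_output_def intro: less_imp_le\<close>)
  next
    assume U: "\<forall>S. vd_output V E (card K) S \<longleftrightarrow> S = K"
    then have K: "vd_output V E (card K) K" by blast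
    show "vd_recovers V E K" unfolding eq
    proof (intro ballI)
      fix i j assume i: "i \<in> K" and j: "j \<in> V - K"
      have le: "vdegree E j \<le> vdegree E i" using K i j by (auto simp: vd_output_def)
      show "vdegree E j < vdegree E i"
      proof (rule ccontr)
        assume "\<not> ?thesis"
        then have e: "vdegree E j = vdegree E i" using le by simp
        have a: "vdegree E i \<le> vdegree E a" if "a \<in> K" for a
          using K j that unfolding e[symmetric] vd_output_def by blast
        let ?S = "insert j (K - {i})"
        have "card ?S = card K"
          using i j fin card_Suc_Diff1[OF fin i] by (subst card_insert_disjoint) auto
        moreover have "\<forall>a\<in>?S. \<forall>b\<in>V - ?S. vdegree E b \<le> vdegree E a"
          using a K i j e by (auto simp: vd_output_def)
        ultimately have "vd_output V E (card K) ?S"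
          using i j assms(2) by (auto simp: vd_output_def)
        then show False using U i j by auto
      qed
    qed
  qed
qed

(* The n-th graph uses the positions X 1, X 2, ... (shared by all n), the number N n of
   vertices and the planted set K n.  The pair (N n, K n) is independent of the positions;
   given N n = m with m >= k n, K n is uniform on the k n-subsets of {1..m}.  If
   N n < k n, nothing is assumed about K n except finiteness, so that every convention for
   this case is covered. *)

locale planted_rgg = prob_space M
  for M :: "'a measure" +
  fixes X :: "nat \<Rightarrow> 'a \<Rightarrow> real ^ 'd"
    and N :: "nat \<Rightarrow> 'a \<Rightarrow> nat"
    and K :: "nat \<Rightarrow> 'a \<Rightarrow> nat set"
    and k :: "nat \<Rightarrow> nat"
  assumes X_indep: "indep_vars (\<lambda>_. borel) X {1..}"
    and X_uniform: "\<And>i. i \<ge> 1 \<Longrightarrow> distr M borel (X i) = uniform_measure lborel (cbox 0 1)"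
    and N_measurable: "\<And>n. n \<ge> 1 \<Longrightarrow> N n \<in> measurable M (count_space UNIV)"
    and N_poisson: "\<And>n. n \<ge> 1 \<Longrightarrow>
          distr M (count_space UNIV) (N n) = measure_pmf (poisson_pmf (real n))"
    and K_measurable: "\<And>n. n \<ge> 1 \<Longrightarrow> K n \<in> measurable M (count_space {S. finite S})"
    and NK_indep_X: "\<And>n. n \<ge> 1 \<Longrightarrow>
          indep_set
            {{\<omega> \<in> space M. (N n \<omega>, K n \<omega>) \<in> B} | B. True}
            {{\<omega> \<in> space M. (\<lambda>i\<in>{1..}. X i \<omega>) \<in> A} | A. A \<in> sets (Pi\<^sub>M {1..} (\<lambda>_. borel))}"
    and K_uniform: "\<And>n m S. n \<ge> 1 \<Longrightarrow> S \<subseteq> {1..m} \<Longrightarrow> card S = k n \<Longrightarrow>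
          prob {\<omega> \<in> space M. N n \<omega> = m \<and> K n \<omega> = S} =
          prob {\<omega> \<in> space M. N n \<omega> = m} / real (m choose k n)"

(* Measurability matters here because measure is 0 on every non-measurable set. *)

lemma (in planted_rgg) recovery_event_measurable:
  assumes n: "n \<ge> 1"
  shows "{\<omega> \<in> space M. vd_recovers {1..N n \<omega>}
           (add_clique (rgg_edges (\<lambda>i. X i \<omega>) (N n \<omega>) \<rho>) (K n \<omega>)) (K n \<omega>)} \<in> events"
proof -
  let ?P = "\<lambda>\<omega> m S. vd_recovers {1..m} (add_clique (rgg_edges (\<lambda>i. X i \<omega>) m \<rho>) S) S"
  have X[measurable]: "X i \<in> borel_measurable M" if "i \<ge> 1" for i
    using X_indep that by (auto simp: indep_vars_def)
  note N_measurable[OF n, measurable] K_measurable[OF n, measurable]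
  have fix_mS: "{\<omega> \<in> space M. ?P \<omega> m S} \<in> events" for m S
  proof -
    let ?I = "{1..m} \<times> {1..m}"
    let ?A = "\<lambda>J. {\<omega> \<in> space M. \<forall>p\<in>?I. torus_dist (X (fst p) \<omega>) (X (snd p) \<omega>) \<le> \<rho> \<longleftrightarrow> p \<in> J}"
    let ?E = "\<lambda>J. {{i, j} | i j. (i, j) \<in> J \<and> i \<in> {1..m} \<and> j \<in> {1..m} \<and> i \<noteq> j}"
    let ?Q = "\<lambda>J. vd_recovers {1..m} (add_clique (?E J) S) S"
    have A: "?A J \<in> events" for J
    proof (rule sets.sets_Collect_finite_All)
      fix p assume "p \<in> ?I"
      then have [measurable]: "X (fst p) \<in> borel_measurable M" "X (snd p) \<in> borel_measurable M"
        by (auto intro: X)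
      show "{\<omega> \<in> space M. torus_dist (X (fst p) \<omega>) (X (snd p) \<omega>) \<le> \<rho> \<longleftrightarrow> p \<in> J} \<in> events"
        unfolding torus_dist_def cart_eq_inner_axis by (cases "p \<in> J") simp_all
    qed auto
    have E: "rgg_edges (\<lambda>i. X i \<omega>) m \<rho> = ?E J" if "\<omega> \<in> ?A J" for J \<omega>
      using that unfolding rgg_edges_def by fastforce
    have "{\<omega> \<in> space M. ?P \<omega> m S} = (\<Union>J\<in>{J\<in>Pow ?I. ?Q J}. ?A J)" (is "?L = ?R")
    proof (intro set_eqI iffI)
      fix \<omega> assume w: "\<omega> \<in> ?L"
      define J where "J = {p\<in>?I. torus_dist (X (fst p) \<omega>) (X (snd p) \<omega>) \<le> \<rho>}"
      have "\<omega> \<in> ?A J" using w by (auto simp: J_def)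
      moreover from E[OF this] w have "?Q J" by simp
      moreover have "J \<in> Pow ?I" by (auto simp: J_def)
      ultimately show "\<omega> \<in> ?R" by blast
    next
      fix \<omega> assume "\<omega> \<in> ?R"
      then obtain J where "?Q J" and J: "\<omega> \<in> ?A J" by blast
      then show "\<omega> \<in> ?L" using E[OF J] by simp
    qed
    also have "\<dots> \<in> events" by (rule sets.finite_UN[OF _ A]) simp
    finally show ?thesis .
  qed
  have "{\<omega> \<in> space M. ?P \<omega> (N n \<omega>) (K n \<omega>)} =
      (\<Union>m. \<Union>S\<in>{S. finite S}. {\<omega> \<in> space M. N n \<omega> = m} \<inter> (K n -` {S} \<inter> space M) \<inter> {\<omega> \<in> space M. ?P \<omega> m S})"
    using measurable_space[OF K_measurable[OF n]] by auto
  also have "\<dots> \<in> events"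
  proof -
    have "K n -` {S} \<inter> space M \<in> events" if "finite S" for S
      by (rule measurable_sets[OF K_measurable[OF n]]) (use that in auto)
    moreover have "{\<omega> \<in> space M. N n \<omega> = m} \<in> events" for m
      by measurable
    ultimately have "{\<omega> \<in> space M. N n \<omega> = m} \<inter> (K n -` {S} \<inter> space M) \<inter>
        {\<omega> \<in> space M. ?P \<omega> m S} \<in> events" if "finite S" for m S
      using that fix_mS by blast
    then show ?thesis
      using countable_Collect_finite[where ?'a = nat]
      by (intro sets.countable_UN'[OF countableI_type] sets.countable_UN') auto
  qed
  finally show ?thesis .
qed

definition H :: "real \<Rightarrow> real" where
  "H x = 1 - x + x * ln x"

definition H_plus_inv :: "real \<Rightarrow> real" where
  "H_plus_inv = the_inv_into {1..} H"

end

theory Submission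
  imports Defs "HOL-Real_Asymp.Real_Asymp"
begin

text \<open>
  Recovery requires every vertex of the clique to have larger degree than every vertex outside.
  Planting the clique raises a degree by less than \<open>k\<close>, so it forces, for each \<open>v\<close> in the
  clique and each \<open>w\<close> outside, that the degree of \<open>w\<close> in the geometric graph is less than that
  of \<open>v\<close> plus \<open>k\<close> (\<open>degrees_compatible\<close>).  This is an event about the positions alone, which
  are independent of the number \<open>m\<close> of vertices and of the clique \<open>S\<close>; by the Poisson tail
  bounds only \<open>m\<close> between \<open>(1 - \<delta>) n\<close> and \<open>(1 + \<delta>) n\<close> matter.  It is therefore enough to bound
  its probability for \<open>m\<close> independent uniform points and fixed \<open>m\<close> and \<open>S\<close>.  Let \<open>p\<close> be the
  volume of a ball of radius \<open>r\<close>, so that \<open>\<mu> = n p\<close>.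

  Logarithmic regime.  One fixed clique vertex has degree at most \<open>(1 + 2 \<delta>) \<mu>\<close> with high
  probability, by Chebyshev's inequality, so it is enough to find a vertex outside the clique of
  degree at least \<open>t = \<lceil>a \<mu>\<rceil>\<close>, where \<open>a < H_plus_inv (1 / \<alpha>)\<close> is chosen such that
  \<open>(1 + 2 \<delta>) \<mu> + k \<le> a \<mu>\<close>.  Take about \<open>\<delta> n\<close> candidates outside the clique, and let each of them count
  its neighbours in a disjoint reservoir of about \<open>(1 - 3 \<delta>) n\<close> other vertices.  The count equals
  \<open>t\<close> with a binomial probability \<open>q\<close>, which is of larger order than \<open>1 / n\<close> because
  \<open>\<alpha> H a < 1\<close> (\<open>binomial_prob_rate\<close>).  For two candidates with disjoint balls the
  two events are negatively correlated up to a factor close to 1, and two candidates are close with probability \<open>O(p)\<close>, where \<open>p = o(q)\<close>; the second moment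
  method shows that some candidate has count exactly \<open>t\<close>.  Working with an exact value
  rather than a tail keeps the comparison of the multinomial and the binomial probability explicit.

  Dense regime.  Fix \<open>J\<close> and compare one clique vertex with \<open>J\<close> vertices outside.  Their counts in
  the set of the remaining vertices are exchangeable, so the clique vertex has the strictly largest
  count with probability at most \<open>1 / (J + 1)\<close>.  If it does not, recovery still needs two counts
  within \<open>J + k\<close> of each other.  For disjoint balls, given the set of points that fall in their union,
  one of the counts is a binomial variable with parameter one half, so this has probability
  \<open>O((J + k) / sqrt \<mu>)\<close>, which tends to 0 (\<open>prob_PiM_count_diff_le\<close>).  Finally let \<open>J\<close> tend to infinity.
\<close>

section \<open>The rate function H\<close>

lemma H_pos:
  assumes "0 < x" "x \<noteq> 1"
  shows "0 < H x"
proof -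
  have "ln (1 / x) < 1 / x - 1"
    using assms ln_le_minus_one[of "1 / x"] ln_eq_minus_one[of "1 / x"] by fastforce
  then have "x * ln (1 / x) < x * (1 / x - 1)" using assms by (intro mult_strict_left_mono) auto
  then show ?thesis using assms by (simp add: H_def ln_div algebra_simps)
qed

lemma H_deriv: "0 < x \<Longrightarrow> (H has_real_derivative ln x) (at x)"
  unfolding H_def by (auto intro!: derivative_eq_intros)

lemma H_continuous_on: "0 < x \<Longrightarrow> continuous_on {x..y} H"
  by (intro continuous_at_imp_continuous_on ballI DERIV_isCont[OF H_deriv]) auto

lemma H_strict_mono: "1 \<le> x \<Longrightarrow> x < y \<Longrightarrow> H x < H y"
proof (rule DERIV_pos_imp_increasing_open[of x y H])
  assume "1 \<le> x"
  then show "\<exists>z. (H has_real_derivative z) (at u) \<and> 0 < z" if "x < u" "u < y" for u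
    using that by (intro exI[of _ "ln u"]) (auto intro!: H_deriv)
  show "continuous_on {x..y} H"
    using \<open>1 \<le> x\<close> by (intro H_continuous_on) auto
qed

text \<open>The function \<open>H\<close> increases from 0 to infinity on \<open>[1, \<infinity>)\<close>, so its inverse there is a genuine one.\<close>

lemma H_plus_inv_props:
  assumes "0 < y"
  shows "1 < H_plus_inv y" "H (H_plus_inv y) = y"
proof -
  have inj: "inj_on H {1..}"
    by (rule linorder_inj_onI) (use H_strict_mono in \<open>force+\<close>)
  let ?b = "exp (1 + y)"
  have b: "1 \<le> ?b" using assms by simp
  have "H ?b = 1 + ?b * y" unfolding H_def by (simp add: algebra_simps)
  moreover have "1 * y \<le> ?b * y" using b assms by (intro mult_right_mono) auto
  ultimately have "y \<le> H ?b" by simp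
  moreover have "H 1 = 0" by (simp add: H_def)
  moreover have "continuous_on {1..?b} H"
    by (intro H_continuous_on) auto
  ultimately obtain x where x: "1 \<le> x" "H x = y"
    using IVT'[of H 1 y ?b] b assms by force
  have "H_plus_inv y = x"
    unfolding H_plus_inv_def x(2)[symmetric] by (rule the_inv_into_f_f[OF inj]) (use x in simp)
  moreover have "x \<noteq> 1" using x assms \<open>H 1 = 0\<close> by auto
  ultimately show "1 < H_plus_inv y" "H (H_plus_inv y) = y" using x by auto
qed

section \<open>Poisson tails\<close>

lemma poisson_exp_moment:
  assumes "0 < l" "0 \<le> z"
  shows "(\<integral>\<^sup>+k. ennreal (z ^ k) \<partial>measure_pmf (poisson_pmf l)) = ennreal (exp (l * (z - 1)))"
proof -
  have sm: "(\<lambda>k. (l * z) ^ k / fact k) sums exp (l * z)"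
    using exp_converges[of "l * z"] by (simp add: divide_inverse mult.commute)
  then have sm2: "(\<lambda>k. (l * z) ^ k / fact k * exp (- l)) sums (exp (l * z) * exp (- l))"
    by (rule sums_mult2)
  have "(\<integral>\<^sup>+k. ennreal (z ^ k) \<partial>measure_pmf (poisson_pmf l)) =
      (\<integral>\<^sup>+k. ennreal (pmf (poisson_pmf l) k) * ennreal (z ^ k) \<partial>count_space UNIV)"
    by (rule nn_integral_measure_pmf)
  also have "\<dots> = (\<integral>\<^sup>+k. ennreal ((l * z) ^ k / fact k * exp (- l)) \<partial>count_space UNIV)"
    using assms by (intro nn_integral_cong) (simp add: power_mult_distrib mult_ac flip: ennreal_mult)
  also have "\<dots> = (\<Sum>k. ennreal ((l * z) ^ k / fact k * exp (- l)))"
    by (rule nn_integral_count_space_nat)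
  also have "\<dots> = ennreal (exp (l * z) * exp (- l))"
    using sm2 assms by (intro suminf_ennreal_eq) auto
  also have "exp (l * z) * exp (- l) = exp (l * (z - 1))"
    by (simp add: exp_add[symmetric] algebra_simps)
  finally show ?thesis .
qed

text \<open>The event is the upper tail at \<open>z * l\<close> if \<open>z > 1\<close>, and the lower tail if \<open>z < 1\<close>.\<close>

lemma poisson_chernoff:
  assumes l: "0 < l" and z: "0 < z"
  shows "measure (measure_pmf (poisson_pmf l)) {k. z powr (z * l) \<le> z ^ k} \<le> exp (- l * H z)"
proof -
  let ?P = "measure_pmf (poisson_pmf l)"
  have "emeasure ?P {k. z powr (z * l) \<le> z ^ k} =
      emeasure ?P {k \<in> UNIV. 1 \<le> ennreal (1 / z powr (z * l)) * ennreal (z ^ k)}"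
    using z by (intro arg_cong2[of _ _ _ _ emeasure] refl)
      (auto simp: ennreal_mult[symmetric] ennreal_1[symmetric] simp del: ennreal_1)
  also have "\<dots> \<le> ennreal (1 / z powr (z * l)) * (\<integral>\<^sup>+k. ennreal (z ^ k) * indicator UNIV k \<partial>?P)"
    by (rule nn_integral_Markov_inequality) auto
  also have "\<dots> = ennreal (1 / z powr (z * l)) * ennreal (exp (l * (z - 1)))"
    using poisson_exp_moment[OF l, of z] z by simp
  also have "\<dots> = ennreal (exp (l * (z - 1)) / z powr (z * l))"
    by (simp add: ennreal_mult[symmetric])
  also have "exp (l * (z - 1)) / z powr (z * l) = exp (- l * H z)"
    using z by (simp add: powr_def H_def exp_diff[symmetric] algebra_simps)
  finally show ?thesis by (simp add: measure_pmf.emeasure_eq_measure)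
qed

lemma poisson_upper_tail:
  assumes "0 < l" "1 < z"
  shows "measure (measure_pmf (poisson_pmf l)) {k. z * l \<le> real k} \<le> exp (- l * H z)"
proof -
  have "{k. z * l \<le> real k} = {k. z powr (z * l) \<le> z ^ k}"
    using assms by (simp flip: powr_realpow)
  then show ?thesis using poisson_chernoff[of l z] assms by simp
qed

lemma poisson_lower_tail:
  assumes "0 < l" "0 < z" "z < 1"
  shows "measure (measure_pmf (poisson_pmf l)) {k. real k \<le> z * l} \<le> exp (- l * H z)"
proof -
  have "ln z < 0" using assms by simp
  then have "{k. real k \<le> z * l} = {k. z powr (z * l) \<le> z ^ k}"
    using assms by (auto simp: powr_def mult_le_cancel_right simp flip: powr_realpow)
  then show ?thesis using poisson_chernoff[of l z] assms by simp
qed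

section \<open>Binomial probabilities and coefficients\<close>

lemma binomial_fact_ge: "t \<le> R \<Longrightarrow> (R - t) ^ t \<le> (R choose t) * fact t"
proof (induction t)
  case (Suc t)
  have "(R - Suc t) ^ Suc t \<le> (R - t) ^ t * (R - t)"
    using mult_mono[OF power_mono[of "R - Suc t" "R - t" t], of "R - Suc t" "R - t"] by (simp add: mult.commute)
  also have "\<dots> \<le> (R choose t) * fact t * (R - t)" using Suc by (intro mult_le_mono1) auto
  also have "\<dots> = ((R - t) * (R choose t)) * fact t" by (simp add: mult_ac)
  also have "(R - t) * (R choose t) = Suc t * (R choose Suc t)"
    using binomial_absorb_comp[of R t] binomial_absorption[of t R] by simp
  also have "Suc t * (R choose Suc t) * fact t = (R choose Suc t) * fact (Suc t)"
    by (simp only: fact_Suc of_nat_id mult_ac)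
  finally show ?case .
qed simp

text \<open>A weak form of Stirling's formula: the polynomial factor that it loses is invisible on the
  logarithmic scale, whereas a loss of \<open>exp t\<close> would not be.\<close>

lemma ln_fact_le:
  assumes "1 \<le> t"
  shows "ln (fact t) \<le> (real t + 1) * ln (real t) + 1 - real t"
  using assms
proof (induction t rule: dec_induct)
  case (step t)
  have t: "0 < real t" using step by simp
  have "1 - 1 / (1 + 1 / real t) \<le> ln (1 + 1 / real t)"
    using ln_le_minus_one[of "1 / (1 + 1 / real t)"] t add_pos_pos[of 1 "1 / real t"] by (simp add: ln_div)
  also have "1 - 1 / (1 + 1 / real t) = 1 / (real t + 1)" using t by (simp add: field_simps)
  also have "1 + 1 / real t = real (Suc t) / real t" using t by (simp add: field_simps)
  also have "ln (real (Suc t) / real t) = ln (real (Suc t)) - ln (real t)" using t by (simp add: ln_div)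
  finally have *: "1 \<le> (real t + 1) * (ln (real (Suc t)) - ln (real t))"
    using t by (simp add: field_simps)
  have "ln (fact (Suc t)) = ln (real (Suc t)) + ln (fact t)"
    unfolding fact_Suc by (subst ln_mult) auto
  also have "\<dots> \<le> ln (real (Suc t)) + ((real t + 1) * ln (real t) + 1 - real t)" using step by simp
  also have "\<dots> \<le> (real (Suc t) + 1) * ln (real (Suc t)) + 1 - real (Suc t)"
    using * by (simp add: algebra_simps)
  finally show ?case .
qed simp

lemma ln_binomial_prob_ge:
  fixes p :: real
  assumes t: "1 \<le> t" "t < R" and p: "0 < p" "p < 1"
  shows "real t * ln ((real R - real t) * p / real t) + real t - ln (real t) - 1 + real R * ln (1 - p) \<le>
           ln (real (R choose t) * p ^ t * (1 - p) ^ (R - t))"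
proof -
  have t0: "0 < real t" and Rt: "0 < real R - real t" using t by auto
  have C: "0 < real (R choose t)" using t by simp
  have "real ((R - t) ^ t) \<le> real ((R choose t) * fact t)"
    by (intro of_nat_mono binomial_fact_ge) (use t in simp)
  then have "(real R - real t) ^ t \<le> real (R choose t) * fact t"
    using t by (simp add: of_nat_diff)
  then have "ln ((real R - real t) ^ t) \<le> ln (real (R choose t) * fact t)"
    using Rt C by (subst ln_le_cancel_iff) auto
  then have 1: "real t * ln (real R - real t) - ln (fact t) \<le> ln (real (R choose t))"
    using Rt C by (simp add: ln_mult ln_realpow)
  have 2: "ln (real (R choose t) * p ^ t * (1 - p) ^ (R - t)) =
      ln (real (R choose t)) + real t * ln p + real (R - t) * ln (1 - p)"
    using C p by (simp add: ln_mult ln_realpow)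
  have 3: "real R * ln (1 - p) \<le> real (R - t) * ln (1 - p)"
    using p by (intro mult_right_mono_neg) auto
  have 4: "ln ((real R - real t) * p / real t) = ln (real R - real t) + ln p - ln (real t)"
    using Rt t0 p by (simp add: ln_mult ln_div)
  show ?thesis using 1 2 3 ln_fact_le[OF t(1)] unfolding 4 by (simp add: algebra_simps)
qed

text \<open>The probability that a binomial variable with mean about \<open>\<rho> * \<mu> n\<close> has a given value of about
  \<open>a * \<mu> n\<close> is at least a power of \<open>n\<close> whose exponent can be taken as close as desired to
  \<open>- \<alpha> * (\<rho> - a + a * ln (a / \<rho>))\<close>.  For \<open>\<rho> = 1\<close> this is \<open>- \<alpha> * H a\<close>.\<close>

lemma binomial_prob_rate:
  fixes p \<mu> :: "nat \<Rightarrow> real" and R t :: "nat \<Rightarrow> nat"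
  assumes \<mu>: "\<And>n. \<mu> n = real n * p n" and p0: "\<And>n. 1 \<le> n \<Longrightarrow> 0 < p n"
    and \<alpha>: "(\<lambda>n. \<mu> n / ln (real n)) \<longlonglongrightarrow> \<alpha>" "0 < \<alpha>"
    and R: "(\<lambda>n. real (R n) / real n) \<longlonglongrightarrow> \<rho>" "0 < \<rho>"
    and t: "(\<lambda>n. real (t n) / \<mu> n) \<longlonglongrightarrow> a" "0 < a"
    and \<kappa>: "\<alpha> * (\<rho> - a + a * ln (a / \<rho>)) < \<kappa>"
  shows "\<forall>\<^sub>F n in sequentially.
           real n powr (- \<kappa>) \<le> real (R n choose t n) * p n ^ t n * (1 - p n) ^ (R n - t n)"
proof -
  have lnn: "(\<lambda>n. ln (real n) / real n) \<longlonglongrightarrow> 0" by real_asymp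
  have ln_top: "filterlim (\<lambda>n. ln (real n)) at_top sequentially" by real_asymp
  have ev: "\<forall>\<^sub>F n in sequentially. 3 \<le> n" by (rule eventually_ge_at_top)
  have ln_pos: "0 < ln (real n)" if "3 \<le> n" for n using that by simp
  have p_lim: "p \<longlonglongrightarrow> 0"
  proof -
    have "(\<lambda>n. \<mu> n / ln (real n) * (ln (real n) / real n)) \<longlonglongrightarrow> 0"
      using tendsto_mult[OF \<alpha>(1) lnn] by simp
    then show ?thesis
    proof (rule Lim_transform_eventually)
      show "\<forall>\<^sub>F n in sequentially. \<mu> n / ln (real n) * (ln (real n) / real n) = p n"
        using ev by eventually_elim (use ln_pos in \<open>auto simp: \<mu>\<close>)
    qed
  qed
  have t_ln: "(\<lambda>n. real (t n) / ln (real n)) \<longlonglongrightarrow> a * \<alpha>"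
  proof -
    have "(\<lambda>n. real (t n) / \<mu> n * (\<mu> n / ln (real n))) \<longlonglongrightarrow> a * \<alpha>"
      by (intro tendsto_mult t \<alpha>)
    then show ?thesis
    proof (rule Lim_transform_eventually)
      show "\<forall>\<^sub>F n in sequentially. real (t n) / \<mu> n * (\<mu> n / ln (real n)) = real (t n) / ln (real n)"
        using ev
      proof eventually_elim
        case (elim n)
        then have "\<mu> n \<noteq> 0" using p0[of n] by (simp add: \<mu>)
        then show ?case by simp
      qed
    qed
  qed
  have t_n: "(\<lambda>n. real (t n) / real n) \<longlonglongrightarrow> 0"
  proof -
    have "(\<lambda>n. real (t n) / ln (real n) * (ln (real n) / real n)) \<longlonglongrightarrow> 0"
      using tendsto_mult[OF t_ln lnn] by simp
    then show ?thesis
    proof (rule Lim_transform_eventually)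
      show "\<forall>\<^sub>F n in sequentially. real (t n) / ln (real n) * (ln (real n) / real n) = real (t n) / real n"
        using ev by eventually_elim (use ln_pos in auto)
    qed
  qed
  have t_top: "filterlim (\<lambda>n. real (t n)) at_top sequentially"
  proof -
    have "filterlim (\<lambda>n. real (t n) / ln (real n) * ln (real n)) at_top sequentially"
      by (rule filterlim_tendsto_pos_mult_at_top[OF t_ln _ ln_top]) (use \<alpha> t in auto)
    then show ?thesis
    proof (rule filterlim_mono_eventually[OF _ order_refl order_refl])
      show "\<forall>\<^sub>F n in sequentially. real (t n) / ln (real n) * ln (real n) = real (t n)"
        using ev by eventually_elim (use ln_pos in auto)
    qed
  qed
  have ratio: "(\<lambda>n. (real (R n) - real (t n)) * p n / real (t n)) \<longlonglongrightarrow> \<rho> / a"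
  proof -
    have "(\<lambda>n. (real (R n) / real n - real (t n) / real n) / (real (t n) / \<mu> n)) \<longlonglongrightarrow> \<rho> / a"
      using tendsto_divide[OF tendsto_diff[OF R(1) t_n] t(1)] t(2) by simp
    then show ?thesis
    proof (rule Lim_transform_eventually)
      show "\<forall>\<^sub>F n in sequentially. (real (R n) / real n - real (t n) / real n) / (real (t n) / \<mu> n) =
          (real (R n) - real (t n)) * p n / real (t n)"
        using ev by eventually_elim (simp add: \<mu> flip: diff_divide_distrib)
    qed
  qed
  have lnt: "(\<lambda>n. ln (real (t n)) / ln (real n)) \<longlonglongrightarrow> 0"
  proof -
    have "((\<lambda>x::real. ln x / x) \<longlongrightarrow> 0) at_top" by real_asymp
    then have "(\<lambda>n. ln (real (t n)) / real (t n)) \<longlonglongrightarrow> 0"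
      by (rule filterlim_compose[OF _ t_top])
    then have "(\<lambda>n. ln (real (t n)) / real (t n) * (real (t n) / ln (real n))) \<longlonglongrightarrow> 0"
      using tendsto_mult[OF _ t_ln] by fastforce
    moreover have "\<forall>\<^sub>F n in sequentially. 1 \<le> real (t n)"
      using t_top unfolding filterlim_at_top by blast
    then have "\<forall>\<^sub>F n in sequentially.
        ln (real (t n)) / real (t n) * (real (t n) / ln (real n)) = ln (real (t n)) / ln (real n)"
      by eventually_elim auto
    ultimately show ?thesis by (rule Lim_transform_eventually)
  qed
  have ln1: "(\<lambda>n. ln (1 - p n) / p n) \<longlonglongrightarrow> -1"
  proof -
    have "((\<lambda>x::real. ln (1 - x) / x) \<longlongrightarrow> -1) (at_right 0)" by real_asymp
    moreover have "filterlim p (at_right 0) sequentially"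
      using p_lim p0 by (intro tendsto_imp_filterlim_at_right eventually_sequentiallyI[of 1]) auto
    ultimately show ?thesis by (rule filterlim_compose)
  qed
  \<comment> \<open>The lower bound of \<open>ln_binomial_prob_ge\<close> divided by \<open>ln n\<close>, arranged in convergent factors.\<close>
  define E where "E = (\<lambda>n. (real (t n) / ln (real n)) * ln ((real (R n) - real (t n)) * p n / real (t n)) +
     real (t n) / ln (real n) - ln (real (t n)) / ln (real n) - 1 / ln (real n) +
     (real (R n) / real n) * (\<mu> n / ln (real n)) * (ln (1 - p n) / p n))"
  have "E \<longlonglongrightarrow> a * \<alpha> * ln (\<rho> / a) + a * \<alpha> - 0 - 0 + \<rho> * \<alpha> * (-1)"
    unfolding E_def using R t
    by (intro tendsto_add tendsto_diff tendsto_mult tendsto_ln ratio t_ln lnt R \<alpha> ln1) 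
       (auto, real_asymp)
  also have "a * \<alpha> * ln (\<rho> / a) + a * \<alpha> - 0 - 0 + \<rho> * \<alpha> * (-1) = - (\<alpha> * (\<rho> - a + a * ln (a / \<rho>)))"
    using R t by (simp add: ln_div algebra_simps)
  finally have "\<forall>\<^sub>F n in sequentially. - \<kappa> < E n"
    by (rule order_tendstoD) (use \<kappa> in simp)
  moreover have "\<forall>\<^sub>F n in sequentially. 1 \<le> real (t n)"
    using t_top unfolding filterlim_at_top by blast
  moreover have "\<forall>\<^sub>F n in sequentially. real (t n) / real n < real (R n) / real n"
  proof -
    have "\<forall>\<^sub>F n in sequentially. real (t n) / real n < \<rho> / 2"
      using t_n by (rule order_tendstoD) (use R in simp)
    moreover have "\<forall>\<^sub>F n in sequentially. \<rho> / 2 < real (R n) / real n"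
      using R(1) by (rule order_tendstoD) (use R in simp)
    ultimately show ?thesis by eventually_elim linarith
  qed
  moreover have "\<forall>\<^sub>F n in sequentially. p n < 1"
    using p_lim by (rule order_tendstoD) simp
  ultimately show ?thesis using ev
  proof eventually_elim
    case (elim n)
    have pp: "0 < p n" using p0[of n] elim by simp
    have L: "0 < ln (real n)" and n0: "0 < real n" using ln_pos elim by auto
    have tR: "t n < R n" and t1: "1 \<le> t n" using elim n0 by (auto simp: divide_less_cancel)
    let ?q = "real (R n choose t n) * p n ^ t n * (1 - p n) ^ (R n - t n)"
    have q0: "0 < ?q" using tR pp elim by simp
    have "E n * ln (real n) = real (t n) * ln ((real (R n) - real (t n)) * p n / real (t n)) + real (t n)
        - ln (real (t n)) - 1 + real (R n) * ln (1 - p n)"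
    proof -
      have "(real (R n) / real n) * (\<mu> n / ln (real n)) * (ln (1 - p n) / p n) * ln (real n) = real (R n) * ln (1 - p n)"
        using n0 L pp by (simp add: \<mu>)
      then show ?thesis using L unfolding E_def by (simp add: distrib_right left_diff_distrib)
    qed
    also have "\<dots> \<le> ln ?q"
      by (rule ln_binomial_prob_ge) (use t1 tR pp elim in auto)
    finally have "- \<kappa> * ln (real n) \<le> ln ?q"
      using elim L by (meson mult_right_mono less_imp_le order_trans)
    then have "exp (- \<kappa> * ln (real n)) \<le> ?q"
      using q0 by (metis exp_le_cancel_iff exp_ln)
    then show ?case using n0 by (simp add: powr_def)
  qed
qed

lemma central_binomial_Suc:
  "Suc n * (2 * Suc n choose Suc n) = 2 * (2 * n + 1) * (2 * n choose n)"
proof -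
  have "Suc (Suc (2 * n)) * (Suc (2 * n) choose n) = (Suc (Suc (2 * n)) choose Suc n) * Suc n"
    by (rule Suc_times_binomial_eq)
  moreover have "Suc (2 * n) * (2 * n choose n) = (Suc (2 * n) choose Suc n) * Suc n"
    by (rule Suc_times_binomial_eq)
  moreover have "Suc (2 * n) choose Suc n = Suc (2 * n) choose n"
    using central_binomial_odd[of "Suc (2 * n)"] by simp
  ultimately show ?thesis by (simp add: algebra_simps)
qed

lemma central_binomial_sq_le: "(2 * n + 1) * (2 * n choose n)\<^sup>2 \<le> 16 ^ n"
proof (induction n)
  case (Suc n)
  define A where "A = 2 * Suc n choose Suc n"
  define B where "B = 2 * n choose n"
  have AB: "Suc n * A = 2 * (2 * n + 1) * B"
    unfolding A_def B_def by (rule central_binomial_Suc)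
  have "(Suc n)\<^sup>2 * ((2 * Suc n + 1) * A\<^sup>2) = (2 * Suc n + 1) * (Suc n * A)\<^sup>2"
    by (simp only: power_mult_distrib mult_ac)
  also have "\<dots> = 4 * (2 * n + 3) * (2 * n + 1) * ((2 * n + 1) * B\<^sup>2)"
    unfolding AB by (simp add: power_mult_distrib algebra_simps power2_eq_square)
  also have "\<dots> \<le> 4 * (2 * n + 3) * (2 * n + 1) * 16 ^ n"
    by (intro mult_le_mono2) (use Suc.IH in \<open>simp add: B_def\<close>)
  also have "\<dots> = 4 * ((2 * n + 3) * (2 * n + 1)) * 16 ^ n"
    by (simp only: mult.assoc)
  also have "\<dots> \<le> 4 * (4 * (Suc n)\<^sup>2) * 16 ^ n"
    by (intro mult_le_mono1 mult_le_mono2) (simp add: power2_eq_square algebra_simps)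
  also have "\<dots> = (Suc n)\<^sup>2 * 16 ^ Suc n" by simp
  finally have "(2 * Suc n + 1) * A\<^sup>2 \<le> 16 ^ Suc n" by (simp only: mult_le_cancel1) simp
  then show ?case unfolding A_def .
qed simp

lemma middle_binomial_sq_le: "u * (u choose (u div 2))\<^sup>2 \<le> 4 ^ u"
proof (cases "even u")
  case True
  then obtain n where u: "u = 2 * n" by (elim evenE)
  have "u * (u choose (u div 2))\<^sup>2 \<le> (2 * n + 1) * (2 * n choose n)\<^sup>2"
    by (simp add: u)
  also have "\<dots> \<le> 16 ^ n" by (rule central_binomial_sq_le)
  finally show ?thesis by (simp add: u power_mult)
next
  case False
  then obtain n where u: "u = 2 * n + 1" by (elim oddE)
  have "Suc (Suc (2 * n)) * (Suc (2 * n) choose n) = (Suc (Suc (2 * n)) choose Suc n) * Suc n"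
    by (rule Suc_times_binomial_eq)
  then have "Suc n * (2 * (Suc (2 * n) choose n)) = Suc n * (2 * Suc n choose Suc n)"
    by (simp add: algebra_simps)
  then have eq: "2 * (u choose (u div 2)) = 2 * Suc n choose Suc n"
    using u by (simp only: mult_cancel1) simp
  have "4 * (u * (u choose (u div 2))\<^sup>2) \<le> (2 * Suc n + 1) * (2 * (u choose (u div 2)))\<^sup>2"
    by (simp add: u power_mult_distrib)
  also have "\<dots> \<le> 16 ^ Suc n" unfolding eq by (rule central_binomial_sq_le)
  finally show ?thesis by (simp add: u power_mult)
qed

lemma binomial_le_pow2_div_sqrt:
  assumes "0 < u"
  shows "real (u choose j) \<le> 2 ^ u / sqrt (real u)"
proof -
  define A where "A = u choose (u div 2)"
  have "real (u * A\<^sup>2) \<le> real (4 ^ u)"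
    unfolding A_def by (intro of_nat_mono middle_binomial_sq_le)
  moreover have "(2 ^ u)\<^sup>2 = (4 :: real) ^ u"
    by (simp add: power2_eq_square flip: power_mult_distrib)
  ultimately have "(sqrt (real u) * real A)\<^sup>2 \<le> (2 ^ u)\<^sup>2"
    by (simp add: power_mult_distrib)
  then have "sqrt (real u) * real A \<le> 2 ^ u"
    by (rule power2_le_imp_le) simp
  moreover have "real (u choose j) \<le> real A"
    unfolding A_def by (intro of_nat_mono binomial_maximum)
  ultimately have "sqrt (real u) * real (u choose j) \<le> 2 ^ u"
    by (meson mult_left_mono order_trans real_sqrt_ge_zero of_nat_0_le_iff)
  then show ?thesis using assms by (simp add: field_simps)
qed

text \<open>Subsets of \<open>W\<close> that split \<open>W\<close> into two parts whose sizes differ by at most \<open>\<kappa>\<close>: there are at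
  most \<open>\<kappa> + 1\<close> possible cardinalities, and a binomial coefficient is at most
  \<open>2 ^ card W / sqrt (card W)\<close>.\<close>

lemma card_balanced_subsets_le:
  assumes W: "finite W" "W \<noteq> {}"
  shows "real (card {T. T \<subseteq> W \<and> \<bar>2 * real (card T) - real (card W)\<bar> \<le> real \<kappa>}) \<le>
           (real \<kappa> + 1) * (2 ^ card W / sqrt (real (card W)))"
proof -
  let ?u = "card W"
  let ?J = "{(?u - \<kappa> + 1) div 2..(?u + \<kappa>) div 2}"
  have u: "0 < ?u" using W by (simp add: card_gt_0_iff)
  have "{T. T \<subseteq> W \<and> \<bar>2 * real (card T) - real ?u\<bar> \<le> real \<kappa>} \<subseteq>
      (\<Union>j\<in>?J. {T. T \<subseteq> W \<and> card T = j})"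
    by auto
  then have "card {T. T \<subseteq> W \<and> \<bar>2 * real (card T) - real ?u\<bar> \<le> real \<kappa>} \<le>
      card (\<Union>j\<in>?J. {T. T \<subseteq> W \<and> card T = j})"
    using W by (intro card_mono) auto
  also have "\<dots> \<le> (\<Sum>j\<in>?J. card {T. T \<subseteq> W \<and> card T = j})"
    by (rule card_UN_le) simp
  also have "\<dots> = (\<Sum>j\<in>?J. ?u choose j)"
    using n_subsets[OF W(1)] by simp
  finally have "real (card {T. T \<subseteq> W \<and> \<bar>2 * real (card T) - real ?u\<bar> \<le> real \<kappa>}) \<le>
      (\<Sum>j\<in>?J. real (?u choose j))"
    unfolding of_nat_sum[symmetric] by (rule of_nat_mono)
  also have "\<dots> \<le> (\<Sum>j\<in>?J. 2 ^ ?u / sqrt (real ?u))"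
    by (intro sum_mono binomial_le_pow2_div_sqrt u)
  also have "\<dots> = real (card ?J) * (2 ^ ?u / sqrt (real ?u))" by simp
  also have "\<dots> \<le> (real \<kappa> + 1) * (2 ^ ?u / sqrt (real ?u))"
  proof (intro mult_right_mono)
    have "card ?J \<le> \<kappa> + 1" by auto
    then show "real (card ?J) \<le> real \<kappa> + 1" by linarith
  qed auto
  finally show ?thesis .
qed

lemma sum_Pow_power_card:
  fixes a b :: real
  assumes "finite R"
  shows "(\<Sum>W\<in>Pow R. a ^ card W * b ^ (card R - card W)) = (a + b) ^ card R"
proof -
  have "(a + b) ^ card R = (\<Prod>i\<in>R. a + b)" by simp
  also have "\<dots> = (\<Sum>W\<in>Pow R. (\<Prod>i\<in>W. a) * (\<Prod>i\<in>R - W. b))"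
    by (rule prod_add[OF assms])
  also have "\<dots> = (\<Sum>W\<in>Pow R. a ^ card W * b ^ (card R - card W))"
    using assms by (intro sum.cong) (auto simp: card_Diff_subset finite_subset)
  finally show ?thesis by simp
qed

section \<open>Independent points with a common law\<close>

lemma (in prob_space) product_prob_space_const: "product_prob_space (\<lambda>_. M)"
  by unfold_locales

text \<open>The probability that \<open>T\<close> and \<open>T'\<close> are exactly the index sets of the points in two disjoint
  sets \<open>B\<close> and \<open>B'\<close>.\<close>

lemma (in prob_space) prob_PiM_pattern:
  fixes R :: "'i set"
  assumes R: "finite R" "T \<subseteq> R" "T' \<subseteq> R" "T \<inter> T' = {}"
    and B: "B \<in> events" "B' \<in> events" "B \<inter> B' = {}"
  shows "measure (PiM R (\<lambda>_. M))
           {x \<in> space (PiM R (\<lambda>_. M)). {i\<in>R. x i \<in> B} = T \<and> {i\<in>R. x i \<in> B'} = T'} =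
         prob B ^ card T * prob B' ^ card T' * (1 - prob B - prob B') ^ (card R - card T - card T')"
proof -
  interpret P: product_prob_space "\<lambda>_. M" R by (rule product_prob_space_const)
  define F where "F = (\<lambda>i. if i \<in> T then B else if i \<in> T' then B' else space M - (B \<union> B'))"
  have F: "F i \<in> events" for i using B by (auto simp: F_def)
  have card: "card (R - T - T') = card R - card T - card T'"
  proof -
    have fin: "finite T" "finite T'" using finite_subset[OF R(2,1)] finite_subset[OF R(3,1)] by auto
    have "card (R - T) = card R - card T" using fin R by (intro card_Diff_subset) auto
    moreover have "card (R - T - T') = card (R - T) - card T'"
      using fin R by (intro card_Diff_subset) auto
    ultimately show ?thesis by simp
  qed
  have "{x \<in> space (PiM R (\<lambda>_. M)). {i\<in>R. x i \<in> B} = T \<and> {i\<in>R. x i \<in> B'} = T'} =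
        {x \<in> space (PiM R (\<lambda>_. M)). \<forall>i\<in>R. x i \<in> F i}"
  proof (intro Collect_cong conj_cong refl)
    fix x assume x: "x \<in> space (PiM R (\<lambda>_. M))"
    have xs: "x i \<in> space M" if "i \<in> R" for i using x that by (auto simp: space_PiM)
    show "({i\<in>R. x i \<in> B} = T \<and> {i\<in>R. x i \<in> B'} = T') = (\<forall>i\<in>R. x i \<in> F i)"
    proof
      assume "{i\<in>R. x i \<in> B} = T \<and> {i\<in>R. x i \<in> B'} = T'"
      then show "\<forall>i\<in>R. x i \<in> F i" using xs by (auto simp: F_def)
    next
      assume *: "\<forall>i\<in>R. x i \<in> F i"
      have "x i \<in> B \<longleftrightarrow> i \<in> T" "x i \<in> B' \<longleftrightarrow> i \<in> T'" if "i \<in> R" for i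
        using *[rule_format, OF that] B(3) R(4) by (auto simp: F_def split: if_splits)
      then show "{i\<in>R. x i \<in> B} = T \<and> {i\<in>R. x i \<in> B'} = T'" using R by auto
    qed
  qed
  also have "measure (PiM R (\<lambda>_. M)) \<dots> = (\<Prod>i\<in>R. prob (F i))"
    using P.emeasure_PiM_Collect[of R F] R(1) F
    by (simp add: P.P.emeasure_eq_measure emeasure_eq_measure prod_ennreal prod_nonneg)
  also have "\<dots> = (\<Prod>i\<in>T. prob B) * (\<Prod>i\<in>T'. prob B') * (\<Prod>i\<in>R - T - T'. 1 - prob B - prob B')"
  proof -
    have fin: "finite T" "finite T'" using finite_subset[OF R(2,1)] finite_subset[OF R(3,1)] by auto
    have "(\<Prod>i\<in>R. prob (F i)) = (\<Prod>i\<in>R - T. prob (F i)) * (\<Prod>i\<in>T. prob (F i))"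
      using R by (simp add: prod.subset_diff)
    also have "(\<Prod>i\<in>R - T. prob (F i)) = (\<Prod>i\<in>R - T - T'. prob (F i)) * (\<Prod>i\<in>T'. prob (F i))"
      by (rule prod.subset_diff) (use R in auto)
    also have "(\<Prod>i\<in>T. prob (F i)) = (\<Prod>i\<in>T. prob B)"
      by (intro prod.cong) (auto simp: F_def)
    also have "(\<Prod>i\<in>T'. prob (F i)) = (\<Prod>i\<in>T'. prob B')"
      using R by (intro prod.cong) (auto simp: F_def)
    also have "(\<Prod>i\<in>R - T - T'. prob (F i)) = (\<Prod>i\<in>R - T - T'. 1 - prob B - prob B')"
      using B by (intro prod.cong) (auto simp: F_def prob_compl finite_measure_Union)
    finally show ?thesis by (simp add: mult_ac)
  qed
  finally show ?thesis by (simp add: card)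
qed

lemma (in prob_space) sets_PiM_pattern:
  fixes R :: "'i set"
  assumes "finite R" "B \<in> events"
  shows "{x \<in> space (PiM R (\<lambda>_. M)). {i\<in>R. x i \<in> B} = T} \<in> sets (PiM R (\<lambda>_. M))"
proof (cases "T \<subseteq> R")
  case True
  have "{x \<in> space (PiM R (\<lambda>_. M)). {i\<in>R. x i \<in> B} = T} =
     {x \<in> space (PiM R (\<lambda>_. M)). \<forall>i\<in>R. x i \<in> B \<longleftrightarrow> i \<in> T}"
    using True by blast
  also have "\<dots> \<in> sets (PiM R (\<lambda>_. M))"
  proof (rule sets.sets_Collect_finite_All)
    fix i assume i: "i \<in> R"
    note assms(2)[measurable]
    have [measurable]: "(\<lambda>x. x i) \<in> measurable (PiM R (\<lambda>_. M)) M"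
      using i by (rule measurable_component_singleton)
    show "{x \<in> space (PiM R (\<lambda>_. M)). (x i \<in> B) = (i \<in> T)} \<in> sets (PiM R (\<lambda>_. M))"
      by measurable
  qed (use assms in auto)
  finally show ?thesis .
next
  case False
  then have "{x \<in> space (PiM R (\<lambda>_. M)). {i\<in>R. x i \<in> B} = T} = {}" by auto
  then show ?thesis by (simp only: sets.empty_sets)
qed

lemma (in prob_space) prob_PiM_count_eq:
  fixes R :: "'i set"
  assumes R: "finite R" and B: "B \<in> events"
  shows "measure (PiM R (\<lambda>_. M)) {x \<in> space (PiM R (\<lambda>_. M)). card {i\<in>R. x i \<in> B} = t} =
         real (card R choose t) * prob B ^ t * (1 - prob B) ^ (card R - t)"
proof -
  interpret P: product_prob_space "\<lambda>_. M" R by (rule product_prob_space_const)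
  let ?A = "\<lambda>T. {x \<in> space (PiM R (\<lambda>_. M)). {i\<in>R. x i \<in> B} = T}"
  let ?S = "{T. T \<subseteq> R \<and> card T = t}"
  have fS: "finite ?S" using R by auto
  have "{x \<in> space (PiM R (\<lambda>_. M)). card {i\<in>R. x i \<in> B} = t} = (\<Union>T\<in>?S. ?A T)"
    by auto
  also have "measure (PiM R (\<lambda>_. M)) \<dots> = (\<Sum>T\<in>?S. measure (PiM R (\<lambda>_. M)) (?A T))"
    using sets_PiM_pattern[OF R B] fS
    by (intro P.P.finite_measure_finite_Union) (auto simp: disjoint_family_on_def)
  also have "\<dots> = (\<Sum>T\<in>?S. prob B ^ t * (1 - prob B) ^ (card R - t))"
  proof (intro sum.cong refl)
    fix T assume T: "T \<in> ?S"
    show "measure (PiM R (\<lambda>_. M)) (?A T) = prob B ^ t * (1 - prob B) ^ (card R - t)"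
      using prob_PiM_pattern[OF R, of T "{}" B "{}"] T B by simp
  qed
  also have "\<dots> = real (card R choose t) * prob B ^ t * (1 - prob B) ^ (card R - t)"
    using n_subsets[OF R] by simp
  finally show ?thesis .
qed

text \<open>The bound is the multinomial probability with \<open>(R - t choose t)\<close> enlarged to
  \<open>(R choose t)\<close>.  Up to powers of \<open>1 - p\<close> this is the square of the
  probability for one set, so these events are negatively correlated up to a factor close to 1.\<close>

lemma (in prob_space) prob_PiM_two_counts_le:
  fixes R :: "'i set"
  assumes R: "finite R" and B: "B \<in> events" "B' \<in> events" "B \<inter> B' = {}"
    and p: "prob B = p" "prob B' = p"
  shows "measure (PiM R (\<lambda>_. M))
           {x \<in> space (PiM R (\<lambda>_. M)). card {i\<in>R. x i \<in> B} = t \<and> card {i\<in>R. x i \<in> B'} = t} \<le>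
         real (card R choose t) ^ 2 * p ^ (2 * t) * (1 - 2 * p) ^ (card R - 2 * t)"
proof -
  interpret P: product_prob_space "\<lambda>_. M" R by (rule product_prob_space_const)
  let ?A = "\<lambda>TT. {x \<in> space (PiM R (\<lambda>_. M)). {i\<in>R. x i \<in> B} = fst TT \<and> {i\<in>R. x i \<in> B'} = snd TT}"
  let ?S = "{T. T \<subseteq> R \<and> card T = t}"
  have p2: "0 \<le> 1 - 2 * p"
    using finite_measure_Union[OF B] prob_le_1[of "B \<union> B'"] p by simp
  have p0: "0 \<le> p" using p(1) measure_nonneg[of M B] by simp
  have fS: "finite (?S \<times> ?S)" using R by auto
  have A: "?A TT \<in> sets (PiM R (\<lambda>_. M))" for TT
    by (intro sets.sets_Collect_conj sets_PiM_pattern R B)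
  have L: "{x \<in> space (PiM R (\<lambda>_. M)). card {i\<in>R. x i \<in> B} = t \<and> card {i\<in>R. x i \<in> B'} = t} =
      (\<Union>TT\<in>?S \<times> ?S. ?A TT)" (is "?L = ?R")
  proof (intro set_eqI iffI)
    fix x assume "x \<in> ?L"
    then show "x \<in> ?R"
      by (intro UN_I[of "({i\<in>R. x i \<in> B}, {i\<in>R. x i \<in> B'})"]) (simp_all add: subset_eq)
  next
    fix x assume "x \<in> ?R"
    then obtain TT where "TT \<in> ?S \<times> ?S" "x \<in> ?A TT" by (rule UN_E)
    then show "x \<in> ?L" by (simp add: mem_Times_iff)
  qed
  have 1: "measure (PiM R (\<lambda>_. M)) ?L \<le> (\<Sum>TT\<in>?S\<times>?S. measure (PiM R (\<lambda>_. M)) (?A TT))"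
    unfolding L using A fS by (intro P.P.finite_measure_subadditive_finite) auto
  have 2: "(\<Sum>TT\<in>?S\<times>?S. measure (PiM R (\<lambda>_. M)) (?A TT)) \<le> (\<Sum>TT\<in>?S\<times>?S. p ^ (2 * t) * (1 - 2 * p) ^ (card R - 2 * t))"
  proof (rule sum_mono)
    fix TT assume TT: "TT \<in> ?S \<times> ?S"
    define T T' where "T = fst TT" and "T' = snd TT"
    have T: "T \<subseteq> R" "T' \<subseteq> R" "card T = t" "card T' = t"
      using TT unfolding T_def T'_def mem_Times_iff by simp_all
    show "measure (PiM R (\<lambda>_. M)) (?A TT) \<le> p ^ (2 * t) * (1 - 2 * p) ^ (card R - 2 * t)"
    proof (cases "T \<inter> T' = {}")
      case True
      have "measure (PiM R (\<lambda>_. M)) (?A TT) = p ^ t * p ^ t * (1 - p - p) ^ (card R - t - t)"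
        unfolding prob_PiM_pattern[OF R T(1,2) True B, unfolded T(3,4) p, symmetric] T_def T'_def ..
      also have "\<dots> = p ^ (2 * t) * (1 - 2 * p) ^ (card R - 2 * t)"
        by (simp add: diff_diff_left flip: power_add mult_2)
      finally show ?thesis by simp
    next
      case False
      then obtain i where i: "i \<in> T" "i \<in> T'" by blast
      have "x \<notin> ?A TT" for x
      proof
        assume "x \<in> ?A TT"
        then have "{i\<in>R. x i \<in> B} = T" "{i\<in>R. x i \<in> B'} = T'" unfolding T_def T'_def by simp_all
        then have "x i \<in> B" "x i \<in> B'" using i by auto
        then show False using B(3) by blast
      qed
      then have "?A TT = {}" by (simp only: set_eq_iff empty_iff simp_thms)
      then have "measure (PiM R (\<lambda>_. M)) (?A TT) = 0" by (simp only: measure_empty)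
      then show ?thesis using p0 p2 by simp
    qed
  qed
  have 3: "(\<Sum>TT\<in>?S\<times>?S. p ^ (2 * t) * (1 - 2 * p) ^ (card R - 2 * t)) = real (card R choose t) ^ 2 * p ^ (2 * t) * (1 - 2 * p) ^ (card R - 2 * t)"
    using n_subsets[OF R] by (simp add: card_cartesian_product power2_eq_square)
  show ?thesis using order_trans[OF 1 2] unfolding 3 .
qed

text \<open>Chebyshev's inequality for the number of those events among the \<open>E i\<close> that occur.\<close>

lemma (in prob_space) count_second_moment:
  assumes I: "finite I" and E: "\<And>i. i \<in> I \<Longrightarrow> E i \<in> events"
    and q: "\<And>i. i \<in> I \<Longrightarrow> prob (E i) = q"
    and b: "\<And>i j. i \<in> I \<Longrightarrow> j \<in> I \<Longrightarrow> i \<noteq> j \<Longrightarrow> prob (E i \<inter> E j) \<le> b"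
    and qb: "q\<^sup>2 \<le> b" and s: "0 < s"
  shows "prob {\<omega> \<in> space M. s \<le> \<bar>real (card {i\<in>I. \<omega> \<in> E i}) - real (card I) * q\<bar>} \<le>
           (real (card I) * q + (real (card I))\<^sup>2 * (b - q\<^sup>2)) / s\<^sup>2"
proof -
  define f where "f = (\<lambda>\<omega>. \<Sum>i\<in>I. indicator (E i) \<omega> :: real)"
  have f_card: "f \<omega> = real (card {i\<in>I. \<omega> \<in> E i})" for \<omega>
    unfolding f_def indicator_def using I by (simp add: sum.If_cases Int_def)
  have int: "integrable M (indicator (E i) :: _ \<Rightarrow> real)" if "i \<in> I" for i
    using E[OF that] by (simp add: integrable_indicator_iff emeasure_eq_measure)
  have fm: "f \<in> borel_measurable M" unfolding f_def using E by measurable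
  have f2: "(f \<omega>)\<^sup>2 = (\<Sum>i\<in>I. \<Sum>j\<in>I. indicator (E i \<inter> E j) \<omega>)" for \<omega>
    unfolding f_def power2_eq_square sum_product by (simp add: indicator_inter_arith)
  have int2: "integrable M (indicator (E i \<inter> E j) :: _ \<Rightarrow> real)" if "i \<in> I" "j \<in> I" for i j
    using E that by (simp add: integrable_indicator_iff emeasure_eq_measure sets.Int)
  have i1: "integrable M f" unfolding f_def using int by auto
  have i2: "integrable M (\<lambda>\<omega>. (f \<omega>)\<^sup>2)" unfolding f2 using int2 by auto
  have ind_expectation: "expectation (indicator A) = prob A" if "A \<in> events" for A
    using that sets.sets_into_space[OF that] by (simp add: Int_absorb2)
  have ex: "expectation f = real (card I) * q"
    unfolding f_def using int q by (simp add: Bochner_Integration.integral_sum ind_expectation E)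
  have "expectation (\<lambda>\<omega>. (f \<omega>)\<^sup>2) = (\<Sum>i\<in>I. \<Sum>j\<in>I. prob (E i \<inter> E j))"
    unfolding f2 using int2
    by (simp add: Bochner_Integration.integral_sum ind_expectation E sets.Int cong: sum.cong)
  also have "\<dots> \<le> (\<Sum>i\<in>I. \<Sum>j\<in>I. (if j = i then q else 0) + b)"
  proof (intro sum_mono)
    fix i j assume "i \<in> I" "j \<in> I"
    then show "prob (E i \<inter> E j) \<le> (if j = i then q else 0) + b"
      using q[of i] b[of i j] qb zero_le_power2[of q] by (cases "i = j") (auto intro: order_trans[OF zero_le_power2 qb])
  qed
  also have "\<dots> = real (card I) * q + (real (card I))\<^sup>2 * b"
    using I by (simp add: sum.distrib power2_eq_square algebra_simps)
  finally have "variance f \<le> real (card I) * q + (real (card I))\<^sup>2 * (b - q\<^sup>2)"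
    using variance_eq[OF i1 i2] ex by (simp add: power_mult_distrib algebra_simps)
  moreover have "prob {\<omega> \<in> space M. s \<le> \<bar>f \<omega> - expectation f\<bar>} \<le> variance f / s\<^sup>2"
    by (rule Chebyshev_inequality) (use fm i2 s in auto)
  ultimately have "prob {\<omega> \<in> space M. s \<le> \<bar>f \<omega> - expectation f\<bar>} \<le>
      (real (card I) * q + (real (card I))\<^sup>2 * (b - q\<^sup>2)) / s\<^sup>2"
    using s by (meson divide_right_mono order_trans zero_le_power2)
  then show ?thesis unfolding ex f_card .
qed

text \<open>Bounding the conditional probability given the coordinates in \<open>A\<close>, which may be worse by \<open>b\<close> on
  an exceptional set \<open>G\<close> of these coordinates.\<close>

lemma (in prob_space) prob_PiM_fold_le:
  fixes A R :: "'i set"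
  assumes fin: "finite A" "finite R" "A \<inter> R = {}"
    and E: "E \<in> sets (PiM (A \<union> R) (\<lambda>_. M))" and G: "G \<in> sets (PiM A (\<lambda>_. M))"
    and ab: "0 \<le> a" "0 \<le> b"
    and le: "\<And>x. x \<in> space (PiM A (\<lambda>_. M)) \<Longrightarrow>
        measure (PiM R (\<lambda>_. M)) {y \<in> space (PiM R (\<lambda>_. M)). merge A R (x, y) \<in> E} \<le> a + b * indicator G x"
  shows "measure (PiM (A \<union> R) (\<lambda>_. M)) E \<le> a + b * measure (PiM A (\<lambda>_. M)) G"
proof -
  interpret P: product_prob_space "\<lambda>_. M" "A \<union> R" by (rule product_prob_space_const)
  interpret PA: product_prob_space "\<lambda>_. M" A by (rule product_prob_space_const)
  interpret PR: product_prob_space "\<lambda>_. M" R by (rule product_prob_space_const)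
  have "emeasure (PiM (A \<union> R) (\<lambda>_. M)) E =
      (\<integral>\<^sup>+x. emeasure (PiM R (\<lambda>_. M)) ((\<lambda>y. merge A R (x, y)) -` E \<inter> space (PiM R (\<lambda>_. M))) \<partial>PiM A (\<lambda>_. M))"
    by (rule P.emeasure_fold_integral) (use fin E in auto)
  also have "\<dots> \<le> (\<integral>\<^sup>+x. ennreal a + ennreal b * indicator G x \<partial>PiM A (\<lambda>_. M))"
  proof (rule nn_integral_mono)
    fix x assume x: "x \<in> space (PiM A (\<lambda>_. M))"
    have "(\<lambda>y. merge A R (x, y)) -` E \<inter> space (PiM R (\<lambda>_. M)) =
        {y \<in> space (PiM R (\<lambda>_. M)). merge A R (x, y) \<in> E}" by auto
    then have "emeasure (PiM R (\<lambda>_. M)) ((\<lambda>y. merge A R (x, y)) -` E \<inter> space (PiM R (\<lambda>_. M))) \<le>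
        ennreal (a + b * indicator G x)"
      using le[OF x] by (simp add: PR.P.emeasure_eq_measure ennreal_leI)
    also have "\<dots> = ennreal a + ennreal b * indicator G x"
      using ab by (cases "x \<in> G") auto
    finally show "emeasure (PiM R (\<lambda>_. M)) ((\<lambda>y. merge A R (x, y)) -` E \<inter> space (PiM R (\<lambda>_. M))) \<le>
        ennreal a + ennreal b * indicator G x" .
  qed
  also have "\<dots> = ennreal a + ennreal b * emeasure (PiM A (\<lambda>_. M)) G"
    using G by (simp add: nn_integral_add nn_integral_cmult_indicator PA.P.emeasure_space_1)
  also have "\<dots> = ennreal (a + b * measure (PiM A (\<lambda>_. M)) G)"
    using ab by (simp add: PA.P.emeasure_eq_measure ennreal_mult[symmetric] flip: ennreal_plus)
  finally show ?thesis
    using ab by (simp add: P.P.emeasure_eq_measure ennreal_le_iff del: ennreal_plus)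
qed

lemma (in prob_space) prob_PiM_fold_const:
  fixes A R :: "'i set"
  assumes fin: "finite A" "finite R" "A \<inter> R = {}"
    and E: "E \<in> sets (PiM (A \<union> R) (\<lambda>_. M))"
    and eq: "\<And>x. x \<in> space (PiM A (\<lambda>_. M)) \<Longrightarrow>
        measure (PiM R (\<lambda>_. M)) {y \<in> space (PiM R (\<lambda>_. M)). merge A R (x, y) \<in> E} = a"
  shows "measure (PiM (A \<union> R) (\<lambda>_. M)) E = a"
proof -
  interpret P: product_prob_space "\<lambda>_. M" "A \<union> R" by (rule product_prob_space_const)
  interpret PA: product_prob_space "\<lambda>_. M" A by (rule product_prob_space_const)
  interpret PR: product_prob_space "\<lambda>_. M" R by (rule product_prob_space_const)
  have "emeasure (PiM (A \<union> R) (\<lambda>_. M)) E =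
      (\<integral>\<^sup>+x. emeasure (PiM R (\<lambda>_. M)) ((\<lambda>y. merge A R (x, y)) -` E \<inter> space (PiM R (\<lambda>_. M))) \<partial>PiM A (\<lambda>_. M))"
    by (rule P.emeasure_fold_integral) (use fin E in auto)
  also have "\<dots> = (\<integral>\<^sup>+x. ennreal a \<partial>PiM A (\<lambda>_. M))"
  proof (rule nn_integral_cong)
    fix x assume x: "x \<in> space (PiM A (\<lambda>_. M))"
    have "(\<lambda>y. merge A R (x, y)) -` E \<inter> space (PiM R (\<lambda>_. M)) =
        {y \<in> space (PiM R (\<lambda>_. M)). merge A R (x, y) \<in> E}" by auto
    then show "emeasure (PiM R (\<lambda>_. M)) ((\<lambda>y. merge A R (x, y)) -` E \<inter> space (PiM R (\<lambda>_. M))) =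
        ennreal a"
      using eq[OF x] by (simp add: PR.P.emeasure_eq_measure)
  qed
  also have "\<dots> = ennreal a" by (simp add: PA.P.emeasure_space_1)
  finally have "ennreal (measure (PiM (A \<union> R) (\<lambda>_. M)) E) = ennreal a"
    by (simp add: P.P.emeasure_eq_measure)
  moreover have "0 \<le> a"
  proof -
    obtain x where "x \<in> space (PiM A (\<lambda>_. M))" using PA.P.not_empty by blast
    from eq[OF this, symmetric] show ?thesis by simp
  qed
  ultimately show ?thesis by simp
qed

lemma (in prob_space) prob_PiM_count_small:
  fixes R :: "'i set"
  assumes R: "finite R" "R \<noteq> {}" and B: "B \<in> events" "prob B = 2 * p" and p: "0 < p"
  shows "measure (PiM R (\<lambda>_. M))
           {x \<in> space (PiM R (\<lambda>_. M)). real (card {i\<in>R. x i \<in> B}) \<le> real (card R) * p} \<le>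
         2 / (real (card R) * p)"
proof -
  interpret P: product_prob_space "\<lambda>_. M" R by (rule product_prob_space_const)
  let ?P = "PiM R (\<lambda>_. M)"
  let ?E = "\<lambda>i. {x \<in> space ?P. x i \<in> B}"
  have c: "0 < real (card R)" using R by (simp add: card_gt_0_iff)
  have E: "?E i \<in> P.events" if "i \<in> R" for i
    using that B by measurable
  have m1: "P.prob (?E i) = 2 * p" if "i \<in> R" for i
    using P.emeasure_PiM_Collect_single[OF that B(1)] B(2) p
    by (simp add: P.P.emeasure_eq_measure emeasure_eq_measure)
  have m2: "P.prob (?E i \<inter> ?E j) \<le> (2 * p)\<^sup>2" if "i \<in> R" "j \<in> R" "i \<noteq> j" for i j
  proof -
    have "?E i \<inter> ?E j = {x \<in> space ?P. \<forall>l\<in>{i, j}. x l \<in> B}" by auto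
    then show ?thesis
      using P.emeasure_PiM_Collect[of "{i, j}" "\<lambda>_. B"] that B p
      by (simp add: P.P.emeasure_eq_measure emeasure_eq_measure power2_eq_square flip: ennreal_mult)
  qed
  have eq: "{i \<in> R. x \<in> ?E i} = {i \<in> R. x i \<in> B}" if "x \<in> space ?P" for x
    using that by auto
  have "P.prob {x \<in> space ?P. real (card {i\<in>R. x i \<in> B}) \<le> real (card R) * p} \<le>
      P.prob {x \<in> space ?P. real (card R) * p \<le> \<bar>real (card {i\<in>R. x \<in> ?E i}) - real (card R) * (2 * p)\<bar>}"
  proof (rule P.P.finite_measure_mono)
    show "{x \<in> space ?P. real (card {i\<in>R. x i \<in> B}) \<le> real (card R) * p} \<subseteq>
      {x \<in> space ?P. real (card R) * p \<le> \<bar>real (card {i\<in>R. x \<in> ?E i}) - real (card R) * (2 * p)\<bar>}"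
    proof (intro subsetI CollectI conjI; elim CollectE conjE)
      fix x assume x: "x \<in> space ?P" "real (card {i\<in>R. x i \<in> B}) \<le> real (card R) * p"
      have "real (card R) * (2 * p) = 2 * (real (card R) * p)" by simp
      with x show "real (card R) * p \<le> \<bar>real (card {i\<in>R. x \<in> ?E i}) - real (card R) * (2 * p)\<bar>"
        unfolding eq[OF x(1)] by linarith
    qed
    have "(\<lambda>x. \<Sum>i\<in>R. indicator (?E i) x :: real) \<in> borel_measurable ?P"
      using E by measurable
    moreover have "(\<Sum>i\<in>R. indicator (?E i) x :: real) = real (card {i\<in>R. x \<in> ?E i})" for x
      unfolding indicator_def using R by (simp add: sum.If_cases Int_def)
    ultimately have [measurable]: "(\<lambda>x. real (card {i\<in>R. x \<in> ?E i})) \<in> borel_measurable ?P" by simp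
    show "{x \<in> space ?P. real (card R) * p \<le> \<bar>real (card {i\<in>R. x \<in> ?E i}) - real (card R) * (2 * p)\<bar>} \<in> P.events"
      by measurable
  qed
  also have "\<dots> \<le> (real (card R) * (2 * p) + (real (card R))\<^sup>2 * ((2 * p)\<^sup>2 - (2 * p)\<^sup>2)) / (real (card R) * p)\<^sup>2"
    by (rule P.P.count_second_moment) (use R E m1 m2 c p in auto)
  also have "\<dots> = 2 / (real (card R) * p)"
    using c p by (simp add: power2_eq_square field_simps)
  finally show ?thesis .
qed

text \<open>Anticoncentration: the numbers of points in two disjoint sets of equal probability are
  unlikely to be within \<open>\<kappa>\<close> of each other.  Given the set \<open>W\<close> of indices of points in
  \<open>B \<union> B'\<close>, the set of indices of points in \<open>B\<close> is a uniformly random subset of \<open>W\<close>.\<close>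

lemma (in prob_space) prob_PiM_count_diff_le:
  fixes R :: "'i set"
  assumes R: "finite R" "R \<noteq> {}" and B: "B \<in> events" "B' \<in> events" "B \<inter> B' = {}"
    and p: "prob B = p" "prob B' = p" "0 < p"
  shows "measure (PiM R (\<lambda>_. M)) {x \<in> space (PiM R (\<lambda>_. M)).
             \<bar>real (card {i\<in>R. x i \<in> B}) - real (card {i\<in>R. x i \<in> B'})\<bar> \<le> real \<kappa>} \<le>
         2 / (real (card R) * p) + (real \<kappa> + 1) / sqrt (real (card R) * p)"
proof -
  interpret P: product_prob_space "\<lambda>_. M" R by (rule product_prob_space_const)
  let ?P = "PiM R (\<lambda>_. M)"
  define u where "u = real (card R) * p"
  have u: "0 < u" using R p by (simp add: u_def card_gt_0_iff)
  define Sm where "Sm = {x \<in> space ?P. real (card {i\<in>R. x i \<in> B \<union> B'}) \<le> u}"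
  \<comment> \<open>The possible index sets of points in the union, and their nearly balanced subsets.  On the
    remaining event \<open>Sm\<close> the union contains at most half of the expected number of points.\<close>
  define Ws where "Ws = {W. W \<subseteq> R \<and> u < real (card W)}"
  define Ts where "Ts = (\<lambda>W :: 'i set. {T. T \<subseteq> W \<and> \<bar>2 * real (card T) - real (card W)\<bar> \<le> real \<kappa>})"
  define Pat where "Pat = (\<lambda>(W, T). {x \<in> space ?P. {i\<in>R. x i \<in> B} = T \<and> {i\<in>R. x i \<in> B'} = W - T})"
  have BB: "B \<union> B' \<in> events" "prob (B \<union> B') = 2 * p"
    using B p by (auto simp: finite_measure_Union)
  have p2: "0 \<le> 1 - 2 * p" using BB(2) prob_le_1[of "B \<union> B'"] by simp
  have fin: "finite Ws" "finite W" "finite (Ts W)" if "W \<in> Ws" for W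
  proof -
    show "finite Ws" using R by (auto simp: Ws_def)
    show "finite W" using that R finite_subset by (auto simp: Ws_def)
    then show "finite (Ts W)" by (auto simp: Ts_def)
  qed
  have finWs: "finite Ws" using R by (auto simp: Ws_def)
  have fS: "finite (Sigma Ws Ts)" using finWs fin by auto
  have Pat_events: "Pat WT \<in> P.events" for WT
    unfolding Pat_def by (cases WT) (simp add: sets.sets_Collect_conj sets_PiM_pattern R B)
  have SmE: "Sm \<in> P.events"
  proof -
    have eq: "Sm = (\<Union>T\<in>{T. T \<subseteq> R \<and> real (card T) \<le> u}. {x \<in> space ?P. {i\<in>R. x i \<in> B \<union> B'} = T})"
      by (auto simp: Sm_def)
    show ?thesis
      unfolding eq by (intro sets.finite_UN sets_PiM_pattern R(1) BB(1)) (use R in auto)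
  qed
  have PatU: "(\<Union>WT\<in>Sigma Ws Ts. Pat WT) \<in> P.events"
    by (intro sets.finite_UN fS Pat_events)
  have Pat_prob: "P.prob (Pat (W, T)) = p ^ card W * (1 - 2 * p) ^ (card R - card W)"
    if W: "W \<in> Ws" and T: "T \<in> Ts W" for W T
  proof -
    have WR: "W \<subseteq> R" and TW: "T \<subseteq> W" using W T by (auto simp: Ws_def Ts_def)
    have fW: "finite W" "finite T" using fin[OF W] finite_subset[OF TW] by auto
    have c: "card T + card (W - T) = card W"
      using fW TW card_mono[OF fW(1) TW] by (simp add: card_Diff_subset)
    have "P.prob (Pat (W, T)) =
        p ^ card T * p ^ card (W - T) * (1 - p - p) ^ (card R - card T - card (W - T))"
      unfolding Pat_def prod.case
      using prob_PiM_pattern[OF R(1), of T "W - T", OF _ _ _ B] WR TW p by auto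
    then show ?thesis by (simp add: diff_diff_left c flip: power_add)
  qed
  have "{x \<in> space ?P. \<bar>real (card {i\<in>R. x i \<in> B}) - real (card {i\<in>R. x i \<in> B'})\<bar> \<le> real \<kappa>} \<subseteq>
      Sm \<union> (\<Union>WT\<in>Sigma Ws Ts. Pat WT)"
  proof
    fix x
    assume x: "x \<in> {x \<in> space ?P. \<bar>real (card {i\<in>R. x i \<in> B}) - real (card {i\<in>R. x i \<in> B'})\<bar> \<le> real \<kappa>}"
    define T T' where "T = {i\<in>R. x i \<in> B}" and "T' = {i\<in>R. x i \<in> B'}"
    have d: "T \<inter> T' = {}" "finite T" "finite T'" using B R by (auto simp: T_def T'_def)
    have "{i\<in>R. x i \<in> B \<union> B'} = T \<union> T'" by (auto simp: T_def T'_def)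
    moreover have "card (T \<union> T') = card T + card T'" using d by (intro card_Un_disjoint) auto
    moreover have "T \<union> T' - T = T'" using d by auto
    moreover have "T \<union> T' \<subseteq> R" by (auto simp: T_def T'_def)
    ultimately have "x \<in> Sm \<or> (T \<union> T' \<in> Ws \<and> T \<in> Ts (T \<union> T') \<and> x \<in> Pat (T \<union> T', T))"
      using x by (auto simp: Sm_def Ws_def Ts_def Pat_def T_def[symmetric] T'_def[symmetric])
    then show "x \<in> Sm \<union> (\<Union>WT\<in>Sigma Ws Ts. Pat WT)" by blast
  qed
  then have "P.prob {x \<in> space ?P. \<bar>real (card {i\<in>R. x i \<in> B}) - real (card {i\<in>R. x i \<in> B'})\<bar> \<le> real \<kappa>} \<le>
      P.prob (Sm \<union> (\<Union>WT\<in>Sigma Ws Ts. Pat WT))"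
    by (rule P.P.finite_measure_mono) (intro sets.Un SmE PatU)
  also have "\<dots> \<le> P.prob Sm + P.prob (\<Union>WT\<in>Sigma Ws Ts. Pat WT)"
    by (rule measure_Un_le[OF SmE PatU])
  also have "P.prob Sm \<le> 2 / u"
    unfolding Sm_def u_def by (rule prob_PiM_count_small) (use R BB p in auto)
  also have "P.prob (\<Union>WT\<in>Sigma Ws Ts. Pat WT) \<le> (\<Sum>WT\<in>Sigma Ws Ts. P.prob (Pat WT))"
    using Pat_events fS by (intro P.P.finite_measure_subadditive_finite) auto
  also have "(\<Sum>WT\<in>Sigma Ws Ts. P.prob (Pat WT)) = (\<Sum>W\<in>Ws. \<Sum>T\<in>Ts W. P.prob (Pat (W, T)))"
    using sum.Sigma[of Ws Ts "\<lambda>W T. P.prob (Pat (W, T))"] finWs fin by (simp add: case_prod_beta)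
  also have "\<dots> = (\<Sum>W\<in>Ws. real (card (Ts W)) * (p ^ card W * (1 - 2 * p) ^ (card R - card W)))"
    by (intro sum.cong refl) (simp add: Pat_prob)
  also have "\<dots> \<le> (\<Sum>W\<in>Ws. (real \<kappa> + 1) / sqrt u * ((2 * p) ^ card W * (1 - 2 * p) ^ (card R - card W)))"
  proof (rule sum_mono)
    fix W assume W: "W \<in> Ws"
    have cW: "u < real (card W)" using W by (simp add: Ws_def)
    have "real (card (Ts W)) \<le> (real \<kappa> + 1) * (2 ^ card W / sqrt (real (card W)))"
      unfolding Ts_def by (rule card_balanced_subsets_le) (use fin[OF W] cW u in auto)
    also have "\<dots> \<le> (real \<kappa> + 1) * (2 ^ card W / sqrt u)"
      using u cW by (intro mult_left_mono divide_left_mono) auto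
    finally have "real (card (Ts W)) * (p ^ card W * (1 - 2 * p) ^ (card R - card W)) \<le>
        (real \<kappa> + 1) * (2 ^ card W / sqrt u) * (p ^ card W * (1 - 2 * p) ^ (card R - card W))"
      using p p2 by (intro mult_right_mono) auto
    then show "real (card (Ts W)) * (p ^ card W * (1 - 2 * p) ^ (card R - card W)) \<le>
        (real \<kappa> + 1) / sqrt u * ((2 * p) ^ card W * (1 - 2 * p) ^ (card R - card W))"
      by (simp add: power_mult_distrib mult_ac)
  qed
  also have "\<dots> \<le> (\<Sum>W\<in>Pow R. (real \<kappa> + 1) / sqrt u * ((2 * p) ^ card W * (1 - 2 * p) ^ (card R - card W)))"
    using R p p2 u by (intro sum_mono2) (auto simp: Ws_def)
  also have "\<dots> = (real \<kappa> + 1) / sqrt u"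
    unfolding sum_distrib_left[symmetric] sum_Pow_power_card[OF R(1)] by simp
  finally show ?thesis unfolding u_def by simp
qed

section \<open>Neighbour counts of independent points\<close>

text \<open>The number of indices in \<open>R\<close> whose points are adjacent to the point with index \<open>w\<close>.\<close>

definition nbr_count :: "('b \<Rightarrow> 'b \<Rightarrow> bool) \<Rightarrow> ('i \<Rightarrow> 'b) \<Rightarrow> 'i set \<Rightarrow> 'i \<Rightarrow> nat" where
  "nbr_count adj x R w = card {j\<in>R. adj (x w) (x j)}"

lemma nbr_count_mono:
  assumes "finite R'" "R \<subseteq> R'"
  shows "nbr_count adj x R w \<le> nbr_count adj x R' w"
  unfolding nbr_count_def using assms by (intro card_mono) auto

text \<open>What the argument uses of the geometry: all balls have the same probability \<open>p\<close>, points
  with a common neighbour are \<open>near\<close>, and a random point is near a given one with probability at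
  most \<open>c * p\<close>.\<close>

locale proximity = prob_space U for U :: "'b measure" +
  fixes adj near :: "'b \<Rightarrow> 'b \<Rightarrow> bool" and p c :: real
  assumes adj_sets: "{z \<in> space (U \<Otimes>\<^sub>M U). adj (fst z) (snd z)} \<in> sets (U \<Otimes>\<^sub>M U)"
    and near_sets: "{z \<in> space (U \<Otimes>\<^sub>M U). near (fst z) (snd z)} \<in> sets (U \<Otimes>\<^sub>M U)"
    and adj_prob: "\<And>x. x \<in> space U \<Longrightarrow> prob {y \<in> space U. adj x y} = p"
    and near_prob: "\<And>x. x \<in> space U \<Longrightarrow> prob {y \<in> space U. near x y} \<le> c * p"
    and common_nbr: "\<And>x x' z. x \<in> space U \<Longrightarrow> x' \<in> space U \<Longrightarrow> z \<in> space U \<Longrightarrow>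
        adj x z \<Longrightarrow> adj x' z \<Longrightarrow> near x x'"
    and p_pos: "0 < p" and p_half: "p \<le> 1 / 2" and c_nonneg: "0 \<le> c"
begin

abbreviation Pts :: "'i set \<Rightarrow> ('i \<Rightarrow> 'b) measure" where
  "Pts I \<equiv> PiM I (\<lambda>_. U)"

lemma prob_space_Pts: "prob_space (Pts I)"
  by (intro prob_space_PiM) unfold_locales

lemma adj_ball: "x \<in> space U \<Longrightarrow> {y \<in> space U. adj x y} \<in> events"
  using sets_Pair1[OF adj_sets, of x] by (simp add: space_pair_measure vimage_def)

lemma adj_Pts [measurable]:
  assumes "i \<in> I" "j \<in> I"
  shows "{x \<in> space (Pts I). adj (x i) (x j)} \<in> sets (Pts I)"
proof -
  have "(\<lambda>x. (x i, x j)) \<in> measurable (Pts I) (U \<Otimes>\<^sub>M U)"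
    using assms by (intro measurable_Pair measurable_component_singleton)
  from measurable_sets[OF this adj_sets]
  have "(\<lambda>x. (x i, x j)) -` {z \<in> space (U \<Otimes>\<^sub>M U). adj (fst z) (snd z)} \<inter> space (Pts I) \<in> sets (Pts I)" .
  also have "(\<lambda>x. (x i, x j)) -` {z \<in> space (U \<Otimes>\<^sub>M U). adj (fst z) (snd z)} \<inter> space (Pts I) =
      {x \<in> space (Pts I). adj (x i) (x j)}"
    using assms by (auto simp: space_PiM space_pair_measure)
  finally show ?thesis .
qed

lemma near_Pts [measurable]:
  assumes "i \<in> I" "j \<in> I"
  shows "{x \<in> space (Pts I). near (x i) (x j)} \<in> sets (Pts I)"
proof -
  have "(\<lambda>x. (x i, x j)) \<in> measurable (Pts I) (U \<Otimes>\<^sub>M U)"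
    using assms by (intro measurable_Pair measurable_component_singleton)
  from measurable_sets[OF this near_sets]
  have "(\<lambda>x. (x i, x j)) -` {z \<in> space (U \<Otimes>\<^sub>M U). near (fst z) (snd z)} \<inter> space (Pts I) \<in> sets (Pts I)" .
  also have "(\<lambda>x. (x i, x j)) -` {z \<in> space (U \<Otimes>\<^sub>M U). near (fst z) (snd z)} \<inter> space (Pts I) =
      {x \<in> space (Pts I). near (x i) (x j)}"
    using assms by (auto simp: space_PiM space_pair_measure)
  finally show ?thesis .
qed

lemma nbr_count_measurable [measurable]:
  assumes "finite R" "R \<subseteq> I" "w \<in> I"
  shows "(\<lambda>x. real (nbr_count adj x R w)) \<in> borel_measurable (Pts I)"
proof -
  have "(\<lambda>x. \<Sum>j\<in>R. indicator {x \<in> space (Pts I). adj (x w) (x j)} x :: real) \<in> borel_measurable (Pts I)"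
    using assms by (intro borel_measurable_sum borel_measurable_indicator adj_Pts) auto
  moreover have "(\<Sum>j\<in>R. indicator {x \<in> space (Pts I). adj (x w) (x j)} x) = real (nbr_count adj x R w)"
    if "x \<in> space (Pts I)" for x
    unfolding indicator_def nbr_count_def using that assms(1) by (simp add: sum.If_cases Int_def)
  ultimately show ?thesis by (simp cong: measurable_cong)
qed

lemma nbr_count_merge:
  assumes "w \<in> A" "A \<inter> R = {}" "x \<in> space (Pts A)" "y \<in> space (Pts R)"
  shows "nbr_count adj (merge A R (x, y)) R w = card {j\<in>R. y j \<in> {z \<in> space U. adj (x w) z}}"
proof -
  have "{j\<in>R. adj (merge A R (x, y) w) (merge A R (x, y) j)} = {j\<in>R. y j \<in> {z \<in> space U. adj (x w) z}}"
    using assms by (auto simp: merge_def space_PiM)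
  then show ?thesis by (simp add: nbr_count_def)
qed

lemma merge_space:
  assumes "x \<in> space (Pts A)" "y \<in> space (Pts R)"
  shows "merge A R (x, y) \<in> space (Pts (A \<union> R))"
  using assms by (auto simp: space_PiM merge_def PiE_iff extensional_def)

lemma prob_nbr_count_eq:
  assumes I: "finite I" "R \<subseteq> I" "w \<in> I - R"
  shows "measure (Pts I) {x \<in> space (Pts I). nbr_count adj x R w = t} =
           real (card R choose t) * p ^ t * (1 - p) ^ (card R - t)"
proof -
  let ?A = "I - R"
  have IA: "I = ?A \<union> R" using I by auto
  have fR: "finite R" using I finite_subset by auto
  let ?E = "{x \<in> space (Pts I). nbr_count adj x R w = t}"
  have "measure (Pts (?A \<union> R)) ?E = real (card R choose t) * p ^ t * (1 - p) ^ (card R - t)"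
  proof (rule prob_PiM_fold_const)
    have [measurable]: "(\<lambda>x. real (nbr_count adj x R w)) \<in> borel_measurable (Pts I)"
      using I fR by (intro nbr_count_measurable) auto
    have "{x \<in> space (Pts I). real (nbr_count adj x R w) = real t} \<in> sets (Pts I)" by measurable
    then show "?E \<in> sets (Pts (?A \<union> R))" using IA by simp
    fix x assume x: "x \<in> space (Pts ?A)"
    have xw: "x w \<in> space U" using x I by (auto simp: space_PiM)
    have merged: "merge ?A R (x, y) \<in> space (Pts I)" if "y \<in> space (Pts R)" for y
      using merge_space[OF x that] unfolding IA[symmetric] .
    have cnt: "nbr_count adj (merge ?A R (x, y)) R w = card {j\<in>R. y j \<in> {z \<in> space U. adj (x w) z}}"
      if "y \<in> space (Pts R)" for y
      by (rule nbr_count_merge) (use I x that in auto)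
    have "{y \<in> space (Pts R). merge ?A R (x, y) \<in> ?E} =
        {y \<in> space (Pts R). card {j\<in>R. y j \<in> {z \<in> space U. adj (x w) z}} = t}"
      by (intro Collect_cong conj_cong refl) (simp only: mem_Collect_eq merged cnt simp_thms)
    then show "measure (Pts R) {y \<in> space (Pts R). merge ?A R (x, y) \<in> ?E} =
        real (card R choose t) * p ^ t * (1 - p) ^ (card R - t)"
      using prob_PiM_count_eq[OF fR adj_ball[OF xw], of t] adj_prob[OF xw] by simp
  qed (use I fR in auto)
  then show ?thesis using IA by simp
qed

lemma prob_near_le:
  assumes I: "finite I" "v \<in> I" "w \<in> I" "v \<noteq> w"
  shows "measure (Pts I) {x \<in> space (Pts I). near (x v) (x w)} \<le> c * p"
proof -
  interpret P: product_prob_space "\<lambda>_. U" "{w}" by (rule product_prob_space_const)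
  let ?A = "I - {w}"
  have IA: "I = ?A \<union> {w}" using I by auto
  let ?E = "{x \<in> space (Pts I). near (x v) (x w)}"
  have "measure (Pts (?A \<union> {w})) ?E \<le> c * p + 0 * measure (Pts ?A) {}"
  proof (rule prob_PiM_fold_le)
    show "?E \<in> sets (Pts (?A \<union> {w}))" using near_Pts[of v I w] I IA by simp
    fix x assume x: "x \<in> space (Pts ?A)"
    have xv: "x v \<in> space U" using x I by (auto simp: space_PiM)
    have nb: "{y \<in> space U. near (x v) y} \<in> events"
      using sets_Pair1[OF near_sets, of "x v"] xv
      by (simp add: space_pair_measure vimage_def)
    have "{y \<in> space (Pts {w}). merge ?A {w} (x, y) \<in> ?E} =
        {y \<in> space (Pts {w}). y w \<in> {y \<in> space U. near (x v) y}}"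
      using merge_space[OF x, of _ "{w}"] x I IA
      by (auto simp: merge_def space_PiM)
    then have "measure (Pts {w}) {y \<in> space (Pts {w}). merge ?A {w} (x, y) \<in> ?E} =
        prob {y \<in> space U. near (x v) y}"
      using P.emeasure_PiM_Collect_single[OF _ nb, of w]
      by (simp add: P.P.emeasure_eq_measure emeasure_eq_measure)
    then show "measure (Pts {w}) {y \<in> space (Pts {w}). merge ?A {w} (x, y) \<in> ?E} \<le>
        c * p + 0 * indicator {} x"
      using near_prob[OF xv] by simp
  qed (use I p_pos c_nonneg in auto)
  then show ?thesis using IA by simp
qed

text \<open>Here \<open>q\<close> is the probability that one of the counts equals \<open>t\<close>.  The last summand accounts for
  near points, for which the second count is ignored.\<close>

lemma prob_two_nbr_counts_eq_le:
  assumes I: "finite I" "R \<subseteq> I" "v \<in> I - R" "w \<in> I - R" "v \<noteq> w" and t: "2 * t \<le> card R"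
    and q: "q = real (card R choose t) * p ^ t * (1 - p) ^ (card R - t)"
  shows "measure (Pts I) {x \<in> space (Pts I). nbr_count adj x R v = t \<and> nbr_count adj x R w = t} \<le>
           q\<^sup>2 / (1 - p) ^ (2 * t) + q * (c * p)"
proof -
  interpret PR: product_prob_space "\<lambda>_. U" R by (rule product_prob_space_const)
  let ?A = "I - R"
  have IA: "I = ?A \<union> R" using I by auto
  have fR: "finite R" using I finite_subset by auto
  have q0: "0 \<le> q" using q p_pos p_half by simp
  let ?E = "{x \<in> space (Pts I). nbr_count adj x R v = t \<and> nbr_count adj x R w = t}"
  let ?G = "{x \<in> space (Pts ?A). near (x v) (x w)}"
  have G: "?G \<in> sets (Pts ?A)" using near_Pts[of v ?A w] I by auto
  have E: "?E \<in> sets (Pts I)"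
  proof -
    have [measurable]: "(\<lambda>x. real (nbr_count adj x R w)) \<in> borel_measurable (Pts I)"
      "(\<lambda>x. real (nbr_count adj x R v)) \<in> borel_measurable (Pts I)"
      using I fR by (auto intro!: nbr_count_measurable)
    have "{x \<in> space (Pts I). real (nbr_count adj x R v) = real t \<and> real (nbr_count adj x R w) = real t}
        \<in> sets (Pts I)" by measurable
    then show ?thesis by simp
  qed
  have "measure (Pts (?A \<union> R)) ?E \<le> q\<^sup>2 / (1 - p) ^ (2 * t) + q * measure (Pts ?A) ?G"
  proof (rule prob_PiM_fold_le)
    show "?E \<in> sets (Pts (?A \<union> R))" using E IA by simp
    fix x assume x: "x \<in> space (Pts ?A)"
    have xv: "x v \<in> space U" and xw: "x w \<in> space U" using x I by (auto simp: space_PiM)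
    let ?B = "{z \<in> space U. adj (x v) z}" and ?B' = "{z \<in> space U. adj (x w) z}"
    have merged: "merge ?A R (x, y) \<in> space (Pts I)" if "y \<in> space (Pts R)" for y
      using merge_space[OF x that] unfolding IA[symmetric] .
    have cnt_v: "nbr_count adj (merge ?A R (x, y)) R v = card {j\<in>R. y j \<in> {z \<in> space U. adj (x v) z}}"
      if "y \<in> space (Pts R)" for y
      by (rule nbr_count_merge) (use I x that in auto)
    have cnt_w: "nbr_count adj (merge ?A R (x, y)) R w = card {j\<in>R. y j \<in> {z \<in> space U. adj (x w) z}}"
      if "y \<in> space (Pts R)" for y
      by (rule nbr_count_merge) (use I x that in auto)
    have eq: "{y \<in> space (Pts R). merge ?A R (x, y) \<in> ?E} =
        {y \<in> space (Pts R). card {j\<in>R. y j \<in> ?B} = t \<and> card {j\<in>R. y j \<in> ?B'} = t}"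
      by (intro Collect_cong conj_cong refl) (simp only: mem_Collect_eq merged cnt_v cnt_w simp_thms)
    show "measure (Pts R) {y \<in> space (Pts R). merge ?A R (x, y) \<in> ?E} \<le>
        q\<^sup>2 / (1 - p) ^ (2 * t) + q * indicator ?G x"
    proof (cases "x \<in> ?G")
      case True
      have "measure (Pts R) {y \<in> space (Pts R). merge ?A R (x, y) \<in> ?E} \<le>
          measure (Pts R) {y \<in> space (Pts R). card {j\<in>R. y j \<in> ?B} = t}"
        unfolding eq
      proof (rule PR.P.finite_measure_mono)
        have "{y \<in> space (Pts R). card {j\<in>R. y j \<in> ?B} = t} =
           (\<Union>T\<in>{T. T \<subseteq> R \<and> card T = t}. {y \<in> space (Pts R). {j\<in>R. y j \<in> ?B} = T})" by auto
        also have "\<dots> \<in> sets (Pts R)"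
          by (intro sets.finite_UN sets_PiM_pattern fR adj_ball xv) (use fR in auto)
        finally show "{y \<in> space (Pts R). card {j\<in>R. y j \<in> ?B} = t} \<in> sets (Pts R)" .
      qed auto
      also have "\<dots> = q"
        using prob_PiM_count_eq[OF fR adj_ball[OF xv], of t] adj_prob[OF xv] q by simp
      finally show ?thesis using True q0 p_half
        by (simp add: add_increasing)
    next
      case False
      then have "?B \<inter> ?B' = {}" using common_nbr[OF xv xw] x by auto
      then have "measure (Pts R) {y \<in> space (Pts R). merge ?A R (x, y) \<in> ?E} \<le>
          real (card R choose t) ^ 2 * p ^ (2 * t) * (1 - 2 * p) ^ (card R - 2 * t)"
        unfolding eq by (intro prob_PiM_two_counts_le fR adj_ball xv xw adj_prob)
      also have "\<dots> \<le> real (card R choose t) ^ 2 * p ^ (2 * t) * ((1 - p)\<^sup>2) ^ (card R - 2 * t)"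
      proof (intro mult_left_mono power_mono)
        show "1 - 2 * p \<le> (1 - p)\<^sup>2" by (simp add: power2_eq_square algebra_simps)
      qed (use p_pos p_half in auto)
      also have "\<dots> = q\<^sup>2 / (1 - p) ^ (2 * t)"
      proof -
        have "(1 - p) ^ (2 * (card R - t)) = (1 - p) ^ (2 * (card R - 2 * t)) * (1 - p) ^ (2 * t)"
          unfolding power_add[symmetric] using t by (intro arg_cong[of _ _ "\<lambda>n. (1 - p) ^ n"]) simp
        moreover have "q\<^sup>2 = real (card R choose t) ^ 2 * p ^ (2 * t) * (1 - p) ^ (2 * (card R - t))"
          unfolding q by (simp add: power_mult_distrib power_mult[symmetric] mult.commute)
        ultimately show ?thesis using p_half
          by (simp add: power_mult[symmetric])
      qed
      finally show ?thesis using False by simp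
    qed
  qed (use I fR G q0 p_half in auto)
  also have "\<dots> \<le> q\<^sup>2 / (1 - p) ^ (2 * t) + q * (c * p)"
    using I q0 by (intro add_left_mono mult_left_mono prob_near_le) auto
  finally show ?thesis using IA by simp
qed

lemma prob_no_vertex_of_degree_le:
  assumes I: "finite I" "R \<subseteq> I" "A \<subseteq> I - R" and t: "2 * t \<le> card R"
    and q: "q = real (card R choose t) * p ^ t * (1 - p) ^ (card R - t)" and pos: "0 < q" "A \<noteq> {}"
  shows "measure (Pts I) {x \<in> space (Pts I). \<forall>w\<in>A. nbr_count adj x R w \<noteq> t} \<le>
           1 / (real (card A) * q) + (1 / (1 - p) ^ (2 * t) - 1) + c * p / q"
proof -
  interpret P: prob_space "Pts I" by (rule prob_space_Pts)
  have fA: "finite A" and fR: "finite R" using I by (auto intro: finite_subset)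
  define b where "b = q\<^sup>2 / (1 - p) ^ (2 * t) + q * (c * p)"
  let ?E = "\<lambda>w. {x \<in> space (Pts I). nbr_count adj x R w = t}"
  have L: "0 < real (card A)" using fA pos by (simp add: card_gt_0_iff)
  have E: "?E w \<in> P.events" if "w \<in> A" for w
  proof -
    have [measurable]: "(\<lambda>x. real (nbr_count adj x R w)) \<in> borel_measurable (Pts I)"
      using I fR that by (intro nbr_count_measurable) auto
    have "{x \<in> space (Pts I). real (nbr_count adj x R w) = real t} \<in> sets (Pts I)" by measurable
    then show ?thesis by simp
  qed
  have "P.prob {x \<in> space (Pts I). \<forall>w\<in>A. nbr_count adj x R w \<noteq> t} \<le>
     P.prob {x \<in> space (Pts I). real (card A) * q \<le> \<bar>real (card {w\<in>A. x \<in> ?E w}) - real (card A) * q\<bar>}"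
  proof (rule P.finite_measure_mono)
    show "{x \<in> space (Pts I). \<forall>w\<in>A. nbr_count adj x R w \<noteq> t} \<subseteq>
      {x \<in> space (Pts I). real (card A) * q \<le> \<bar>real (card {w\<in>A. x \<in> ?E w}) - real (card A) * q\<bar>}"
    proof (intro subsetI CollectI conjI; elim CollectE conjE)
      fix x assume "x \<in> space (Pts I)" "\<forall>w\<in>A. nbr_count adj x R w \<noteq> t"
      then have *: "{w\<in>A. x \<in> ?E w} = {}" by auto
      show "real (card A) * q \<le> \<bar>real (card {w\<in>A. x \<in> ?E w}) - real (card A) * q\<bar>"
        unfolding * by simp
    qed
    have "(\<lambda>x. \<Sum>i\<in>A. indicator (?E i) x :: real) \<in> borel_measurable (Pts I)"
      using E by measurable
    moreover have "(\<Sum>i\<in>A. indicator (?E i) x :: real) = real (card {i\<in>A. x \<in> ?E i})" for x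
      unfolding indicator_def using fA by (simp add: sum.If_cases Int_def)
    ultimately have [measurable]: "(\<lambda>x. real (card {i\<in>A. x \<in> ?E i})) \<in> borel_measurable (Pts I)" by simp
    show "{x \<in> space (Pts I). real (card A) * q \<le> \<bar>real (card {w\<in>A. x \<in> ?E w}) - real (card A) * q\<bar>} \<in> P.events"
      by measurable
  qed
  also have "\<dots> \<le> (real (card A) * q + (real (card A))\<^sup>2 * (b - q\<^sup>2)) / (real (card A) * q)\<^sup>2"
  proof (rule P.count_second_moment)
    fix v w assume vw: "v \<in> A" "w \<in> A" "v \<noteq> w"
    have eq: "?E v \<inter> ?E w = {x \<in> space (Pts I). nbr_count adj x R v = t \<and> nbr_count adj x R w = t}"
      by auto
    show "P.prob (?E v \<inter> ?E w) \<le> b"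
      unfolding eq b_def using I vw t q by (intro prob_two_nbr_counts_eq_le) auto
  next
    fix w assume "w \<in> A"
    then show "P.prob (?E w) = q" unfolding q using I by (intro prob_nbr_count_eq) auto
  next
    have "q\<^sup>2 \<le> q\<^sup>2 / (1 - p) ^ (2 * t)"
      using p_pos p_half by (simp add: le_divide_eq mult_left_le power_le_one)
    then show "q\<^sup>2 \<le> b" unfolding b_def using pos c_nonneg p_pos by (simp add: add_increasing2)
  qed (use fA E L pos in auto)
  also have "\<dots> = 1 / (real (card A) * q) + (1 / (1 - p) ^ (2 * t) - 1) + c * p / q"
  proof -
    have "(b - q\<^sup>2) / q\<^sup>2 = 1 / (1 - p) ^ (2 * t) - 1 + c * p / q"
      using pos p_half unfolding b_def by (simp add: field_simps power2_eq_square)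
    moreover have "(real (card A) * q + (real (card A))\<^sup>2 * (b - q\<^sup>2)) / (real (card A) * q)\<^sup>2 =
       1 / (real (card A) * q) + (b - q\<^sup>2) / q\<^sup>2"
      using pos L by (simp add: field_simps power2_eq_square)
    ultimately show ?thesis by simp
  qed
  finally show ?thesis .
qed

lemma prob_nbr_count_deviation_le:
  assumes I: "finite I" "R \<subseteq> I" "v \<in> I - R" and s: "0 < s"
  shows "measure (Pts I) {x \<in> space (Pts I). s \<le> \<bar>real (nbr_count adj x R v) - real (card R) * p\<bar>} \<le>
           real (card R) * p / s\<^sup>2"
proof -
  interpret P: prob_space "Pts I" by (rule prob_space_Pts)
  have fR: "finite R" using I finite_subset by auto
  let ?E = "\<lambda>j. {x \<in> space (Pts I). adj (x v) (x j)}"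
  have eq: "nbr_count adj x R v = card {j\<in>R. x \<in> ?E j}" if "x \<in> space (Pts I)" for x
    using that by (simp add: nbr_count_def)
  have "{x \<in> space (Pts I). s \<le> \<bar>real (nbr_count adj x R v) - real (card R) * p\<bar>} =
      {x \<in> space (Pts I). s \<le> \<bar>real (card {j\<in>R. x \<in> ?E j}) - real (card R) * p\<bar>}"
    using eq by (intro Collect_cong conj_cong refl) simp
  moreover have "P.prob {x \<in> space (Pts I). s \<le> \<bar>real (card {j\<in>R. x \<in> ?E j}) - real (card R) * p\<bar>} \<le>
     (real (card R) * p + (real (card R))\<^sup>2 * (p\<^sup>2 - p\<^sup>2)) / s\<^sup>2"
  proof (rule P.count_second_moment)
    fix j assume j: "j \<in> R"
    show "?E j \<in> P.events" using I j by (intro adj_Pts) auto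
    have "?E j = {x \<in> space (Pts I). nbr_count adj x {j} v = 1}"
    proof (intro Collect_cong conj_cong refl)
      fix x
      have "{i\<in>{j}. adj (x v) (x i)} = (if adj (x v) (x j) then {j} else {})" by auto
      then show "adj (x v) (x j) = (nbr_count adj x {j} v = 1)" by (simp add: nbr_count_def)
    qed
    then show "P.prob (?E j) = p"
      using prob_nbr_count_eq[of I "{j}" v 1] I j by auto
  next
    fix i j assume ij: "i \<in> R" "j \<in> R" "i \<noteq> j"
    have "?E i \<inter> ?E j = {x \<in> space (Pts I). nbr_count adj x {i, j} v = 2}"
    proof -
      have "{l\<in>{i, j}. adj (x v) (x l)} = (if adj (x v) (x i) then {i} else {}) \<union> (if adj (x v) (x j) then {j} else {})" for x
        by auto
      then have "nbr_count adj x {i, j} v = 2 \<longleftrightarrow> adj (x v) (x i) \<and> adj (x v) (x j)" for x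
        using ij by (simp add: nbr_count_def)
      then show ?thesis by auto
    qed
    moreover have "P.prob {x \<in> space (Pts I). nbr_count adj x {i, j} v = 2} = p\<^sup>2"
      using prob_nbr_count_eq[of I "{i, j}" v 2] I ij by (auto simp: numeral_2_eq_2)
    ultimately show "P.prob (?E i \<inter> ?E j) \<le> p\<^sup>2" by simp
  qed (use fR s in auto)
  ultimately show ?thesis by simp
qed

lemma prob_nbr_counts_close_le:
  assumes I: "finite I" "R \<subseteq> I" "v \<in> I - R" "w \<in> I - R" "v \<noteq> w" and R: "R \<noteq> {}"
  shows "measure (Pts I) {x \<in> space (Pts I).
             \<bar>real (nbr_count adj x R v) - real (nbr_count adj x R w)\<bar> \<le> real \<kappa>} \<le>
           2 / (real (card R) * p) + (real \<kappa> + 1) / sqrt (real (card R) * p) + c * p"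
    (is "measure _ ?E \<le> ?a + _")
proof -
  interpret PR: product_prob_space "\<lambda>_. U" R by (rule product_prob_space_const)
  let ?A = "I - R"
  have IA: "I = ?A \<union> R" using I by auto
  have fR: "finite R" using I finite_subset by auto
  have a0: "0 \<le> ?a" using p_pos by simp
  let ?G = "{x \<in> space (Pts ?A). near (x v) (x w)}"
  have G: "?G \<in> sets (Pts ?A)" using near_Pts[of v ?A w] I by auto
  have E: "?E \<in> sets (Pts I)"
  proof -
    have [measurable]: "(\<lambda>x. real (nbr_count adj x R w)) \<in> borel_measurable (Pts I)"
      "(\<lambda>x. real (nbr_count adj x R v)) \<in> borel_measurable (Pts I)"
      using I fR by (auto intro!: nbr_count_measurable)
    show ?thesis by measurable
  qed
  have "measure (Pts (?A \<union> R)) ?E \<le> ?a + 1 * measure (Pts ?A) ?G"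
  proof (rule prob_PiM_fold_le)
    show "?E \<in> sets (Pts (?A \<union> R))" using E IA by simp
    fix x assume x: "x \<in> space (Pts ?A)"
    have xv: "x v \<in> space U" and xw: "x w \<in> space U" using x I by (auto simp: space_PiM)
    let ?B = "{z \<in> space U. adj (x v) z}" and ?B' = "{z \<in> space U. adj (x w) z}"
    have merged: "merge ?A R (x, y) \<in> space (Pts I)" if "y \<in> space (Pts R)" for y
      using merge_space[OF x that] unfolding IA[symmetric] .
    have cnt_v: "nbr_count adj (merge ?A R (x, y)) R v = card {j\<in>R. y j \<in> {z \<in> space U. adj (x v) z}}"
      if "y \<in> space (Pts R)" for y
      by (rule nbr_count_merge) (use I x that in auto)
    have cnt_w: "nbr_count adj (merge ?A R (x, y)) R w = card {j\<in>R. y j \<in> {z \<in> space U. adj (x w) z}}"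
      if "y \<in> space (Pts R)" for y
      by (rule nbr_count_merge) (use I x that in auto)
    have eq: "{y \<in> space (Pts R). merge ?A R (x, y) \<in> ?E} = {y \<in> space (Pts R).
        \<bar>real (card {j\<in>R. y j \<in> ?B}) - real (card {j\<in>R. y j \<in> ?B'})\<bar> \<le> real \<kappa>}"
      by (intro Collect_cong conj_cong refl) (simp only: mem_Collect_eq merged cnt_v cnt_w simp_thms)
    show "measure (Pts R) {y \<in> space (Pts R). merge ?A R (x, y) \<in> ?E} \<le> ?a + 1 * indicator ?G x"
    proof (cases "x \<in> ?G")
      case True
      then show ?thesis using a0 PR.P.prob_le_1 by (simp add: add_increasing)
    next
      case False
      then have "?B \<inter> ?B' = {}" using common_nbr[OF xv xw] x by auto
      then have "measure (Pts R) {y \<in> space (Pts R). merge ?A R (x, y) \<in> ?E} \<le> ?a"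
        unfolding eq by (intro prob_PiM_count_diff_le fR R adj_ball xv xw adj_prob p_pos)
      then show ?thesis using False by simp
    qed
  qed (use I fR G a0 in auto)
  also have "\<dots> \<le> ?a + c * p"
    using prob_near_le[of ?A v w] I by simp
  finally show ?thesis using IA by simp
qed

text \<open>The counts in \<open>R\<close> of indices outside \<open>R\<close> are exchangeable, so each member of \<open>J\<close> is equally
  likely to have the strictly largest count.\<close>

lemma prob_strict_max_le:
  assumes I: "finite I" "R \<subseteq> I" "J \<subseteq> I - R" and v: "v \<in> J"
  shows "measure (Pts I) {x \<in> space (Pts I). \<forall>w\<in>J - {v}. nbr_count adj x R w < nbr_count adj x R v} \<le>
           1 / real (card J)"
proof -
  interpret P: prob_space "Pts I" by (rule prob_space_Pts)
  have fR: "finite R" and fJ: "finite J" using I by (auto intro: finite_subset)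
  let ?F = "\<lambda>u. {x \<in> space (Pts I). \<forall>w\<in>J - {u}. nbr_count adj x R w < nbr_count adj x R u}"
  have F: "?F u \<in> P.events" if "u \<in> J" for u
  proof (rule sets.sets_Collect_finite_All)
    fix w assume "w \<in> J - {u}"
    then have [measurable]: "(\<lambda>x. real (nbr_count adj x R w)) \<in> borel_measurable (Pts I)"
      "(\<lambda>x. real (nbr_count adj x R u)) \<in> borel_measurable (Pts I)"
      using I fR that by (auto intro!: nbr_count_measurable)
    have "{x \<in> space (Pts I). real (nbr_count adj x R w) < real (nbr_count adj x R u)} \<in> P.events"
      by measurable
    then show "{x \<in> space (Pts I). nbr_count adj x R w < nbr_count adj x R u} \<in> P.events" by simp
  qed (use fJ in auto)
  have sym: "P.prob (?F v) = P.prob (?F u)" if u: "u \<in> J" for u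
  proof -
    \<comment> \<open>The transposition exchanges the two points and fixes all points with an index in \<open>R\<close>.\<close>
    let ?\<tau> = "Transposition.transpose u v"
    let ?T = "\<lambda>\<omega>. \<lambda>n\<in>I. \<omega> (?\<tau> n)"
    have \<tau>I: "?\<tau> n \<in> I" if "n \<in> I" for n
      using that u v I by (auto simp: Transposition.transpose_def)
    have T: "?T \<in> measurable (Pts I) (Pts I)"
      using \<tau>I by (intro measurable_restrict measurable_component_singleton)
    have "distr (Pts I) (Pts I) ?T = Pts I"
      by (rule distr_PiM_reindex) (use \<tau>I prob_space_axioms in \<open>auto intro: inj_on_subset[OF inj_transpose]\<close>)
    then have "P.prob (?F v) = measure (distr (Pts I) (Pts I) ?T) (?F v)" by simp
    also have "\<dots> = P.prob (?T -` ?F v \<inter> space (Pts I))"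
      by (rule measure_distr[OF T F[OF v]])
    also have "?T -` ?F v \<inter> space (Pts I) = ?F u"
    proof -
      have cnt: "nbr_count adj (?T \<omega>) R w = nbr_count adj \<omega> R (?\<tau> w)" if "w \<in> J" for w \<omega>
      proof -
        have "?T \<omega> j = \<omega> j" if "j \<in> R" for j
          using that u v I by (auto simp: Transposition.transpose_def)
        moreover have "?T \<omega> w = \<omega> (?\<tau> w)" using that I by auto
        ultimately show ?thesis
          unfolding nbr_count_def by (intro arg_cong[of _ _ card] Collect_cong conj_cong refl) simp_all
      qed
      have "(\<forall>w\<in>J - {v}. nbr_count adj (?T \<omega>) R w < nbr_count adj (?T \<omega>) R v) \<longleftrightarrow>
          (\<forall>w\<in>J - {u}. nbr_count adj \<omega> R w < nbr_count adj \<omega> R u)" for \<omega>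
      proof -
        have "(\<forall>w\<in>J - {v}. nbr_count adj (?T \<omega>) R w < nbr_count adj (?T \<omega>) R v) \<longleftrightarrow>
            (\<forall>w\<in>J - {v}. nbr_count adj \<omega> R (?\<tau> w) < nbr_count adj \<omega> R u)"
          using cnt v by auto
        also have "\<dots> \<longleftrightarrow> (\<forall>w\<in>?\<tau> ` (J - {v}). nbr_count adj \<omega> R w < nbr_count adj \<omega> R u)"
          by simp
        also have "?\<tau> ` (J - {v}) = J - {u}"
          using u v by (auto simp: Transposition.transpose_def image_iff)
        finally show ?thesis .
      qed
      then show ?thesis using measurable_space[OF T] by auto
    qed
    finally show ?thesis .
  qed
  \<comment> \<open>These events are disjoint and have the same probability.\<close>
  have "(\<Sum>u\<in>J. P.prob (?F u)) = (\<Sum>u\<in>J. P.prob (?F v))"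
    by (rule sum.cong[OF refl]) (rule sym[symmetric])
  then have "real (card J) * P.prob (?F v) = (\<Sum>u\<in>J. P.prob (?F u))"
    by (simp only: sum_constant)
  also have "\<dots> = P.prob (\<Union>u\<in>J. ?F u)"
  proof (rule P.finite_measure_finite_Union[symmetric])
    show "disjoint_family_on ?F J"
      unfolding disjoint_family_on_def
    proof (intro ballI impI equals0I)
      fix u w x assume *: "u \<in> J" "w \<in> J" "u \<noteq> w" "x \<in> ?F u \<inter> ?F w"
      then have "nbr_count adj x R w < nbr_count adj x R u" "nbr_count adj x R u < nbr_count adj x R w"
        by auto
      then show False by simp
    qed
  qed (use fJ F in auto)
  also have "\<dots> \<le> 1" by (rule P.prob_le_1)
  finally have le: "real (card J) * P.prob (?F v) \<le> 1" .
  have "0 < real (card J)" using v fJ by (auto simp: card_gt_0_iff)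
  with le show ?thesis by (simp only: pos_le_divide_eq mult.commute[of _ "real (card J)"])
qed

text \<open>On the event \<open>E\<close>, either \<open>v\<close> has a strictly larger count in \<open>R\<close> than every member of \<open>W\<close>, or its count is within
  \<open>card W + k\<close> of some other one, since it has at most \<open>card W\<close> neighbours outside \<open>R\<close>.\<close>

lemma prob_below_le_exchangeable:
  assumes I: "finite I" "v \<in> I" "W \<subseteq> I - {v}" and R: "R = I - {v} - W" "R \<noteq> {}"
    and E: "E \<subseteq> {x \<in> space (Pts I).
             \<forall>w\<in>W. nbr_count adj x (I - {w}) w < nbr_count adj x (I - {v}) v + k}"
  shows "measure (Pts I) E \<le>
           1 / (real (card W) + 1) + real (card W) *
             (2 / (real (card R) * p) + (real (card W + k) + 1) / sqrt (real (card R) * p) + c * p)"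
proof -
  interpret P: prob_space "Pts I" by (rule prob_space_Pts)
  have fin: "finite W" "finite R" using I R by (auto intro: finite_subset)
  have RI: "R \<subseteq> I" "v \<in> I - R" and WI: "\<And>w. w \<in> W \<Longrightarrow> w \<in> I - R" and vW: "v \<notin> W"
    using I R by auto
  define \<beta> where "\<beta> = 2 / (real (card R) * p) + (real (card W + k) + 1) / sqrt (real (card R) * p) + c * p"
  let ?Mx = "{x \<in> space (Pts I). \<forall>w\<in>insert v W - {v}. nbr_count adj x R w < nbr_count adj x R v}"
  let ?Cl = "\<lambda>w. {x \<in> space (Pts I).
      \<bar>real (nbr_count adj x R v) - real (nbr_count adj x R w)\<bar> \<le> real (card W + k)}"
  have m [measurable]: "(\<lambda>x. real (nbr_count adj x R w)) \<in> borel_measurable (Pts I)" if "w \<in> insert v W" for w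
    using that fin RI WI by (intro nbr_count_measurable) auto
  have Mx: "?Mx \<in> P.events"
  proof (rule sets.sets_Collect_finite_All)
    fix w assume w: "w \<in> insert v W - {v}"
    have [measurable]: "(\<lambda>x. real (nbr_count adj x R w)) \<in> borel_measurable (Pts I)"
      "(\<lambda>x. real (nbr_count adj x R v)) \<in> borel_measurable (Pts I)"
      using w by (auto intro: m)
    have "{x \<in> space (Pts I). real (nbr_count adj x R w) < real (nbr_count adj x R v)} \<in> P.events"
      by measurable
    then show "{x \<in> space (Pts I). nbr_count adj x R w < nbr_count adj x R v} \<in> P.events" by simp
  qed (use fin in auto)
  have Cl: "?Cl w \<in> P.events" if w: "w \<in> W" for w
  proof -
    have [measurable]: "(\<lambda>x. real (nbr_count adj x R w)) \<in> borel_measurable (Pts I)"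
      "(\<lambda>x. real (nbr_count adj x R v)) \<in> borel_measurable (Pts I)"
      using w by (auto intro: m)
    show ?thesis by measurable
  qed
  have ClU: "(\<Union>w\<in>W. ?Cl w) \<in> P.events"
    by (intro sets.finite_UN fin Cl)
  have "{x \<in> space (Pts I). \<forall>w\<in>W. nbr_count adj x (I - {w}) w < nbr_count adj x (I - {v}) v + k} \<subseteq>
      ?Mx \<union> (\<Union>w\<in>W. ?Cl w)"
  proof
    fix x assume x: "x \<in> {x \<in> space (Pts I).
        \<forall>w\<in>W. nbr_count adj x (I - {w}) w < nbr_count adj x (I - {v}) v + k}"
    have up: "nbr_count adj x (I - {v}) v \<le> nbr_count adj x R v + card W"
    proof -
      have "{j\<in>I - {v}. adj (x v) (x j)} \<subseteq> {j\<in>R. adj (x v) (x j)} \<union> W"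
        using R by auto
      then have "card {j\<in>I - {v}. adj (x v) (x j)} \<le> card ({j\<in>R. adj (x v) (x j)} \<union> W)"
        using fin by (intro card_mono) auto
      also have "\<dots> \<le> card {j\<in>R. adj (x v) (x j)} + card W" by (rule card_Un_le)
      finally show ?thesis by (simp add: nbr_count_def)
    qed
    have less: "nbr_count adj x R w < nbr_count adj x R v + (card W + k)" if w: "w \<in> W" for w
    proof -
      have "nbr_count adj x R w \<le> nbr_count adj x (I - {w}) w"
        using I(1) RI WI[OF w] by (intro nbr_count_mono) auto
      then show ?thesis using x w up by fastforce
    qed
    show "x \<in> ?Mx \<union> (\<Union>w\<in>W. ?Cl w)"
    proof (cases "\<forall>w\<in>W. nbr_count adj x R w < nbr_count adj x R v")
      case True
      then show ?thesis using x by auto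
    next
      case False
      then obtain w where w: "w \<in> W" "nbr_count adj x R v \<le> nbr_count adj x R w" by (auto simp: not_less)
      then have "x \<in> ?Cl w" using less[OF w(1)] x by auto
      then show ?thesis using w by blast
    qed
  qed
  then have "E \<subseteq> ?Mx \<union> (\<Union>w\<in>W. ?Cl w)" using E by (rule order_trans[rotated])
  then have "P.prob E \<le> P.prob (?Mx \<union> (\<Union>w\<in>W. ?Cl w))"
    by (rule P.finite_measure_mono) (intro sets.Un Mx ClU)
  also have "\<dots> \<le> P.prob ?Mx + P.prob (\<Union>w\<in>W. ?Cl w)"
    by (rule measure_Un_le[OF Mx ClU])
  also have "P.prob ?Mx \<le> 1 / real (card (insert v W))"
    by (rule prob_strict_max_le) (use I RI WI in auto)
  also have "real (card (insert v W)) = real (card W) + 1" using fin vW by simp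
  also have "P.prob (\<Union>w\<in>W. ?Cl w) \<le> (\<Sum>w\<in>W. P.prob (?Cl w))"
    using fin Cl by (intro P.finite_measure_subadditive_finite) auto
  also have "\<dots> \<le> (\<Sum>w\<in>W. \<beta>)"
    unfolding \<beta>_def using I R RI WI vW by (intro sum_mono prob_nbr_counts_close_le) auto
  finally show ?thesis by (simp add: \<beta>_def)
qed

text \<open>The parameter \<open>t\<close> is so large that, on the event \<open>E\<close>, a member of \<open>A\<close> with \<open>t\<close> neighbours in \<open>R\<close> forces the degree of
  \<open>v\<close> to exceed its mean by \<open>s\<close>.\<close>

lemma prob_below_le_second_moment:
  assumes I: "finite I" "v \<in> I" "A \<subseteq> I - {v}" "A \<noteq> {}" and R: "R \<subseteq> I - {v} - A" and t: "2 * t \<le> card R"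
    and q: "q = real (card R choose t) * p ^ t * (1 - p) ^ (card R - t)" "0 < q"
    and s: "0 < s" "real (card I) * p + s + real k \<le> real t"
    and E: "E \<subseteq> {x \<in> space (Pts I).
             \<forall>w\<in>A. nbr_count adj x (I - {w}) w < nbr_count adj x (I - {v}) v + k}"
  shows "measure (Pts I) E \<le>
           real (card I) * p / s\<^sup>2 + (1 / (real (card A) * q) + (1 / (1 - p) ^ (2 * t) - 1) + c * p / q)"
proof -
  interpret P: prob_space "Pts I" by (rule prob_space_Pts)
  have fin: "finite A" "finite R" using I R by (auto intro: finite_subset)
  let ?Dv = "{x \<in> space (Pts I). s \<le> \<bar>real (nbr_count adj x (I - {v}) v) - real (card (I - {v})) * p\<bar>}"
  let ?No = "{x \<in> space (Pts I). \<forall>w\<in>A. nbr_count adj x R w \<noteq> t}"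
  have Dv: "?Dv \<in> P.events"
  proof -
    have [measurable]: "(\<lambda>x. real (nbr_count adj x (I - {v}) v)) \<in> borel_measurable (Pts I)"
      using I by (intro nbr_count_measurable) auto
    show ?thesis by measurable
  qed
  have No: "?No \<in> P.events"
  proof (rule sets.sets_Collect_finite_All)
    fix w assume w: "w \<in> A"
    have [measurable]: "(\<lambda>x. real (nbr_count adj x R w)) \<in> borel_measurable (Pts I)"
      using w I R fin by (intro nbr_count_measurable) auto
    have "{x \<in> space (Pts I). real (nbr_count adj x R w) \<noteq> real t} \<in> P.events"
      by measurable
    then show "{x \<in> space (Pts I). nbr_count adj x R w \<noteq> t} \<in> P.events" by simp
  qed (use fin in auto)
  have "{x \<in> space (Pts I). \<forall>w\<in>A. nbr_count adj x (I - {w}) w < nbr_count adj x (I - {v}) v + k} \<subseteq>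
      ?Dv \<union> ?No"
  proof
    fix x assume x: "x \<in> {x \<in> space (Pts I).
        \<forall>w\<in>A. nbr_count adj x (I - {w}) w < nbr_count adj x (I - {v}) v + k}"
    show "x \<in> ?Dv \<union> ?No"
    proof (rule ccontr)
      assume n: "x \<notin> ?Dv \<union> ?No"
      with x obtain w where w: "w \<in> A" "nbr_count adj x R w = t" by auto
      have "t \<le> nbr_count adj x (I - {w}) w"
        unfolding w(2)[symmetric] using I(1,3) R w(1) by (intro nbr_count_mono) auto
      then have "real t < real (nbr_count adj x (I - {v}) v) + real k" using x w(1) by fastforce
      moreover have "real (nbr_count adj x (I - {v}) v) < real (card (I - {v})) * p + s"
        using n x by (auto simp: not_le)
      moreover have "real (card (I - {v})) * p \<le> real (card I) * p"
        using I p_pos by (intro mult_right_mono) (auto intro!: card_mono)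
      ultimately show False using s by linarith
    qed
  qed
  then have "E \<subseteq> ?Dv \<union> ?No" using E by (rule order_trans[rotated])
  then have "P.prob E \<le> P.prob (?Dv \<union> ?No)"
    by (rule P.finite_measure_mono) (intro sets.Un Dv No)
  also have "\<dots> \<le> P.prob ?Dv + P.prob ?No"
    by (rule measure_Un_le[OF Dv No])
  also have "P.prob ?Dv \<le> real (card (I - {v})) * p / s\<^sup>2"
    by (rule prob_nbr_count_deviation_le) (use I s in auto)
  also have "\<dots> \<le> real (card I) * p / s\<^sup>2"
    using I p_pos by (intro divide_right_mono mult_right_mono) (auto intro!: card_mono)
  also have "P.prob ?No \<le> 1 / (real (card A) * q) + (1 / (1 - p) ^ (2 * t) - 1) + c * p / q"
    by (rule prob_no_vertex_of_degree_le) (use I R t q in auto)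
  finally show ?thesis by simp
qed

end

section \<open>Balls in the torus\<close>

text \<open>The integer vectors with entries between \<open>-b\<close> and \<open>b\<close>.\<close>

definition shifts :: "int \<Rightarrow> (real ^ 'd) set" where
  "shifts b = {s. \<forall>i. s $ i \<in> real_of_int ` {-b..b}}"

lemma shifts_bounds: "finite (shifts b :: (real ^ 'd) set)"
  "card (shifts b :: (real ^ 'd) set) \<le> card {-b..b} ^ CARD('d)"
proof -
  have sub: "shifts b \<subseteq> vec_lambda ` (PiE (UNIV :: 'd set) (\<lambda>_. real_of_int ` {-b..b}))"
  proof
    fix s :: "real ^ 'd" assume s: "s \<in> shifts b"
    have "s = vec_lambda (vec_nth s)" by simp
    moreover have "vec_nth s \<in> PiE (UNIV :: 'd set) (\<lambda>_. real_of_int ` {-b..b})"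
      using s unfolding shifts_def by blast
    ultimately show "s \<in> vec_lambda ` (PiE (UNIV :: 'd set) (\<lambda>_. real_of_int ` {-b..b}))" by blast
  qed
  have fin: "finite (PiE (UNIV :: 'd set) (\<lambda>_. real_of_int ` {-b..b}))"
    by (intro finite_PiE) auto
  show "finite (shifts b :: (real ^ 'd) set)"
    using finite_subset[OF sub] fin by blast
  have "card (shifts b :: (real ^ 'd) set) \<le> card (PiE (UNIV :: 'd set) (\<lambda>_. real_of_int ` {-b..b}))"
    using card_mono[OF finite_imageI[OF fin] sub] card_image_le[OF fin] by (rule order_trans)
  also have "\<dots> = card (real_of_int ` {-b..b}) ^ CARD('d)" by (simp add: card_PiE)
  also have "card (real_of_int ` {-b..b}) = card {-b..b}" by (intro card_image) (auto simp: inj_on_def)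
  finally show "card (shifts b :: (real ^ 'd) set) \<le> card {-b..b} ^ CARD('d)" .
qed

lemma norm_vec_eq_sqrt: "norm (x :: real ^ 'd) = sqrt (\<Sum>i\<in>UNIV. (x $ i)\<^sup>2)"
  by (simp add: norm_vec_def L2_set_def)

lemma unit_cube_component: "x \<in> cbox 0 (1 :: real ^ 'd) \<Longrightarrow> 0 \<le> x $ i \<and> x $ i \<le> 1"
  by (simp add: mem_box_cart)

text \<open>On the unit cube, the torus distance is the smallest Euclidean distance between translates.\<close>

lemma torus_dist_le_iff:
  fixes x y :: "real ^ 'd"
  assumes "x \<in> cbox 0 1" "y \<in> cbox 0 1"
  shows "torus_dist x y \<le> r \<longleftrightarrow> (\<exists>s\<in>shifts 1. norm (x - y + s) \<le> r)"
proof
  assume le: "torus_dist x y \<le> r"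
  define s :: "real ^ 'd" where "s = (\<chi> i. if \<bar>x $ i - y $ i\<bar> \<le> 1 / 2 then 0 else - sgn (x $ i - y $ i))"
  have s1: "s \<in> shifts 1"
  proof -
    have "s $ i \<in> real_of_int ` {-1..1}" for i
    proof -
      have "s $ i = 0 \<or> s $ i = 1 \<or> s $ i = -1" by (auto simp: s_def sgn_real_def)
      then show ?thesis
      proof (elim disjE)
        assume "s $ i = 0" then show ?thesis by (intro image_eqI[of _ _ 0]) auto
      next
        assume "s $ i = 1" then show ?thesis by (intro image_eqI[of _ _ 1]) auto
      next
        assume "s $ i = -1" then show ?thesis by (intro image_eqI[of _ _ "-1"]) auto
      qed
    qed
    then show ?thesis by (simp add: shifts_def)
  qed
  have "(min \<bar>x $ i - y $ i\<bar> (1 - \<bar>x $ i - y $ i\<bar>))\<^sup>2 = ((x - y + s) $ i)\<^sup>2" for i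
  proof -
    have "\<bar>min \<bar>x $ i - y $ i\<bar> (1 - \<bar>x $ i - y $ i\<bar>)\<bar> = \<bar>(x - y + s) $ i\<bar>"
      using unit_cube_component[OF assms(1), of i] unit_cube_component[OF assms(2), of i]
      by (auto simp: s_def sgn_real_def min_def abs_if)
    then show ?thesis by (metis power2_abs)
  qed
  then have "torus_dist x y = norm (x - y + s)"
    unfolding torus_dist_def norm_vec_eq_sqrt by simp
  then show "\<exists>s\<in>shifts 1. norm (x - y + s) \<le> r" using le s1 by auto
next
  assume "\<exists>s\<in>shifts 1. norm (x - y + s) \<le> r"
  then obtain s where s: "s \<in> shifts 1" "norm (x - y + s) \<le> r" by blast
  have "(min \<bar>x $ i - y $ i\<bar> (1 - \<bar>x $ i - y $ i\<bar>))\<^sup>2 \<le> ((x - y + s) $ i)\<^sup>2" for i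
  proof -
    obtain z :: int where z: "-1 \<le> z" "z \<le> 1" "s $ i = real_of_int z"
      using s(1) unfolding shifts_def by force
    then have "s $ i = 0 \<or> s $ i = 1 \<or> s $ i = -1" by force
    then have "\<bar>min \<bar>x $ i - y $ i\<bar> (1 - \<bar>x $ i - y $ i\<bar>)\<bar> \<le> \<bar>(x - y + s) $ i\<bar>"
      using unit_cube_component[OF assms(1), of i] unit_cube_component[OF assms(2), of i]
      by (auto simp: min_def abs_if)
    then show ?thesis using abs_le_square_iff by blast
  qed
  then have "torus_dist x y \<le> norm (x - y + s)"
    unfolding torus_dist_def norm_vec_eq_sqrt by (intro real_sqrt_le_mono sum_mono)
  then show "torus_dist x y \<le> r" using s by simp
qed

lemma shifts_distinct_component:
  assumes "s \<in> shifts b" "s' \<in> shifts b" "s \<noteq> (s' :: real ^ 'd)"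
  obtains i where "1 \<le> \<bar>s $ i - s' $ i\<bar>"
proof -
  obtain i where i: "s $ i \<noteq> s' $ i" using assms(3) by (auto simp: vec_eq_iff)
  obtain z z' :: int where z: "s $ i = real_of_int z" "s' $ i = real_of_int z'"
    using assms(1,2) unfolding shifts_def by blast
  then have "z \<noteq> z'" using i by auto
  then have "1 \<le> \<bar>z - z'\<bar>" by auto
  then have "1 \<le> \<bar>s $ i - s' $ i\<bar>" unfolding z by linarith
  then show ?thesis by (rule that)
qed

lemma torus_dist_measurable [measurable]:
  fixes f g :: "'a \<Rightarrow> real ^ 'd"
  assumes [measurable]: "f \<in> borel_measurable M" "g \<in> borel_measurable M"
  shows "(\<lambda>x. torus_dist (f x) (g x)) \<in> borel_measurable M"
  unfolding torus_dist_def cart_eq_inner_axis by measurable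

text \<open>The intersections of the Euclidean ball around \<open>x\<close> with the integer translates of the cube,
  moved back into the cube, are disjoint and make up the torus ball.\<close>

lemma measure_torus_ball:
  fixes x :: "real ^ 'd"
  assumes x: "x \<in> cbox 0 1" and r: "0 < r" "r < 1 / 2"
  shows "measure lborel {y \<in> cbox 0 1. torus_dist x y \<le> r} =
           measure lborel (ball (0 :: real ^ 'd) 1) * r ^ CARD('d)"
proof -
  \<comment> \<open>The pieces of the torus ball, and the same pieces translated back into the ball around \<open>x\<close>.\<close>
  let ?f = "\<lambda>s. cbox 0 1 \<inter> cball (x + s) r"
  let ?g = "\<lambda>s. {z. z + s \<in> cbox 0 1} \<inter> cball x r"
  let ?S = "shifts 1 :: (real ^ 'd) set"
  have fin: "finite ?S" by (rule shifts_bounds)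
  have Bf: "{y \<in> cbox 0 1. torus_dist x y \<le> r} = (\<Union>s\<in>?S. ?f s)"
    using torus_dist_le_iff[OF x] by (auto simp: dist_norm algebra_simps)
  have gf: "?f s = (+) s ` ?g s" for s
  proof (intro set_eqI iffI)
    fix y assume "y \<in> ?f s"
    then have "y - s \<in> ?g s" by (simp add: dist_norm algebra_simps)
    then show "y \<in> (+) s ` ?g s" by (intro image_eqI[of _ _ "y - s"]) auto
  next
    fix y assume "y \<in> (+) s ` ?g s"
    then show "y \<in> ?f s" by (auto simp: dist_norm algebra_simps)
  qed
  have gf': "?g s = (+) (- s) ` ?f s" for s
    unfolding gf by (simp add: image_image)
  have fl: "?f s \<in> lmeasurable" for s
    by (intro fmeasurable.Int lmeasurable_cbox lmeasurable_cball)
  have gl: "?g s \<in> lmeasurable" for s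
    unfolding gf' using measurable_translation[OF fl[of s], of "- s"] by simp
  have 1: "measure lborel {y \<in> cbox 0 1. torus_dist x y \<le> r} = measure lebesgue (\<Union>s\<in>?S. ?f s)"
  proof -
    have [measurable]: "(\<lambda>y. y) \<in> borel_measurable (borel :: (real ^ 'd) measure)" by simp
    have "{y \<in> space borel. y \<in> cbox 0 1 \<and> torus_dist x y \<le> r} \<in> sets borel"
      by measurable
    then have "{y \<in> cbox 0 1. torus_dist x y \<le> r} \<in> sets lborel"
      by (simp only: space_borel UNIV_I simp_thms sets_lborel)
    from measure_completion[OF this] show ?thesis unfolding Bf ..
  qed
  have 2: "measure lebesgue (\<Union>s\<in>?S. ?f s) = (\<Sum>s\<in>?S. measure lebesgue (?f s))"
  proof (rule measure_negligible_finite_Union_image[where f = ?f and S = ?S])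
    show "finite ?S" by (rule fin)
    show "?f s \<in> lmeasurable" for s by (rule fl)
    show "pairwise (\<lambda>s s'. negligible (?f s \<inter> ?f s')) ?S"
    proof (rule pairwiseI)
      fix s s' assume s: "s \<in> ?S" "s' \<in> ?S" "s \<noteq> s'"
      obtain i where i: "1 \<le> \<bar>s $ i - s' $ i\<bar>" by (rule shifts_distinct_component[OF s])
      have "?f s \<inter> ?f s' = {}"
      proof (rule equals0I)
        fix y assume "y \<in> ?f s \<inter> ?f s'"
        then have "dist (x + s) (x + s') \<le> r + r"
          by (intro dist_triangle_le[of _ y]) (auto simp: dist_commute)
        then have "norm (s - s') \<le> 2 * r" by (simp add: dist_norm)
        moreover have "\<bar>(s - s') $ i\<bar> \<le> norm (s - s')" by (rule component_le_norm_cart)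
        ultimately show False using i r by simp
      qed
      then show "negligible (?f s \<inter> ?f s')" by simp
    qed
  qed
  have 3: "measure lebesgue (?f s) = measure lebesgue (?g s)" for s
    unfolding gf by (rule measure_translation)
  have 4: "(\<Sum>s\<in>?S. measure lebesgue (?g s)) = measure lebesgue (\<Union>s\<in>?S. ?g s)"
  proof (rule measure_negligible_finite_Union_image[where f = ?g and S = ?S, symmetric])
    show "finite ?S" by (rule fin)
    show "?g s \<in> lmeasurable" for s by (rule gl)
    show "pairwise (\<lambda>s s'. negligible (?g s \<inter> ?g s')) ?S"
    proof (rule pairwiseI)
      fix s s' assume s: "s \<in> ?S" "s' \<in> ?S" "s \<noteq> s'"
      obtain i where i: "1 \<le> \<bar>s $ i - s' $ i\<bar>" by (rule shifts_distinct_component[OF s])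
      have "?g s \<inter> ?g s' \<subseteq> {z. z $ i = - min (s $ i) (s' $ i)}"
      proof
        fix z assume "z \<in> ?g s \<inter> ?g s'"
        then have "z + s \<in> cbox 0 1" "z + s' \<in> cbox 0 1" by auto
        then show "z \<in> {z. z $ i = - min (s $ i) (s' $ i)}"
          using unit_cube_component[of "z + s" i] unit_cube_component[of "z + s'" i] i
          by (auto simp: min_def abs_if split: if_splits)
      qed
      moreover have "negligible {z :: real ^ 'd. z $ i = - min (s $ i) (s' $ i)}"
        using negligible_standard_hyperplane[of "axis i (1 :: real)" "- min (s $ i) (s' $ i)"]
        by (simp add: inner_axis axis_in_Basis_iff)
      ultimately show "negligible (?g s \<inter> ?g s')" by (rule negligible_subset[rotated])
    qed
  qed
  have 5: "(\<Union>s\<in>?S. ?g s) = cball x r"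
  proof (intro set_eqI iffI)
    fix z assume z: "z \<in> cball x r"
    \<comment> \<open>The entries of \<open>z\<close> lie strictly between -1 and 2, since \<open>r\<close> is less than one half.\<close>
    define s :: "real ^ 'd" where "s = (\<chi> i. - of_int \<lfloor>z $ i\<rfloor>)"
    have "s \<in> ?S"
    proof -
      have "s $ i \<in> real_of_int ` {-1..1}" for i
      proof (intro image_eqI[of _ _ "- \<lfloor>z $ i\<rfloor>"])
        have "\<bar>(x - z) $ i\<bar> \<le> norm (x - z)" by (rule component_le_norm_cart)
        also have "\<dots> < 1 / 2" using z r by (simp add: dist_norm)
        finally have "-1 < z $ i" "z $ i < 2"
          using unit_cube_component[OF x, of i] by (auto simp: abs_if split: if_splits)
        then have "-1 \<le> \<lfloor>z $ i\<rfloor>" "\<lfloor>z $ i\<rfloor> \<le> 1" by linarith+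
        then show "- \<lfloor>z $ i\<rfloor> \<in> {-1..1}" by auto
      qed (simp add: s_def)
      then show ?thesis by (simp add: shifts_def)
    qed
    moreover have "z + s \<in> cbox 0 1"
    proof -
      have "0 \<le> (z + s) $ i \<and> (z + s) $ i \<le> 1" for i
        unfolding s_def by simp linarith
      then show ?thesis by (simp add: mem_box_cart)
    qed
    ultimately show "z \<in> (\<Union>s\<in>?S. ?g s)" using z by auto
  qed auto
  have 6: "measure lebesgue (cball x r) = measure lborel (ball (0 :: real ^ 'd) 1) * r ^ CARD('d)"
    using r content_cball[of r x] content_ball[of 1 "0 :: real ^ 'd"] by simp
  show ?thesis unfolding 1 2 3 4 5 6 ..
qed

text \<open>Some integer translates of the points have distance at most \<open>2 * r\<close>.  The bound 2 on the shifts
  makes this relation hold between any two points of the cube with a common neighbour.\<close>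

definition torus_near :: "real \<Rightarrow> real ^ 'd \<Rightarrow> real ^ 'd \<Rightarrow> bool" where
  "torus_near r x y \<longleftrightarrow> (\<exists>s\<in>shifts 2. norm (x - y + s) \<le> 2 * r)"

lemma shifts_diff: "s \<in> shifts 1 \<Longrightarrow> s' \<in> shifts 1 \<Longrightarrow> s - s' \<in> shifts 2"
  unfolding shifts_def
proof (intro CollectI allI)
  fix i assume "s \<in> {s. \<forall>i. s $ i \<in> real_of_int ` {-1..1}}" "s' \<in> {s. \<forall>i. s $ i \<in> real_of_int ` {-1..1}}"
  then obtain z z' where "s $ i = real_of_int z" "s' $ i = real_of_int z'" "z \<in> {-1..1}" "z' \<in> {-1..1}"
    by blast
  then show "(s - s') $ i \<in> real_of_int ` {-2..2}" by (intro image_eqI[of _ _ "z - z'"]) auto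
qed

lemma torus_near_common:
  fixes x x' z :: "real ^ 'd"
  assumes "x \<in> cbox 0 1" "x' \<in> cbox 0 1" "z \<in> cbox 0 1" "torus_dist x z \<le> r" "torus_dist x' z \<le> r"
  shows "torus_near r x x'"
proof -
  obtain s s' where s: "s \<in> shifts 1" "norm (x - z + s) \<le> r" "s' \<in> shifts 1" "norm (x' - z + s') \<le> r"
    using assms torus_dist_le_iff by blast
  have "norm (x - x' + (s - s')) = norm ((x - z + s) - (x' - z + s'))" by (simp add: algebra_simps)
  also have "\<dots> \<le> norm (x - z + s) + norm (x' - z + s')" by (rule norm_triangle_ineq4)
  also have "\<dots> \<le> 2 * r" using s by simp
  finally show ?thesis using shifts_diff[OF s(1,3)] by (auto simp: torus_near_def)
qed

lemma measure_torus_near_le: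
  fixes x :: "real ^ 'd"
  assumes r: "0 < r"
  shows "measure lborel {y \<in> cbox 0 1. torus_near r x y} \<le>
           10 ^ CARD('d) * (measure lborel (ball (0 :: real ^ 'd) 1) * r ^ CARD('d))"
proof -
  let ?S = "shifts 2 :: (real ^ 'd) set"
  have fin: "finite ?S" by (rule shifts_bounds)
  have sub: "{y \<in> cbox 0 1. torus_near r x y} \<subseteq> (\<Union>s\<in>?S. cball (x + s) (2 * r))"
    by (auto simp: torus_near_def dist_norm algebra_simps)
  have eq: "{y \<in> cbox 0 1. torus_near r x y} = (\<Union>s\<in>?S. cbox 0 1 \<inter> cball (x + s) (2 * r))"
    by (auto simp: torus_near_def dist_norm algebra_simps)
  have cb: "cball (x + s) (2 * r) \<in> fmeasurable lborel" for s
    by (rule fmeasurable_compact) auto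
  have "{y \<in> cbox 0 1. torus_near r x y} \<in> sets lborel"
    unfolding eq using fin by (intro sets.finite_UN) auto
  then have "measure lborel {y \<in> cbox 0 1. torus_near r x y} \<le>
      measure lborel (\<Union>s\<in>?S. cball (x + s) (2 * r))"
    using sub fin cb by (intro measure_mono_fmeasurable fmeasurable.finite_UN) auto
  also have "\<dots> \<le> (\<Sum>s\<in>?S. measure lborel (cball (x + s) (2 * r)))"
    using fin cb by (intro measure_UNION_le) (auto simp: fmeasurable_def)
  also have "\<dots> = real (card ?S) * (measure lborel (ball (0 :: real ^ 'd) 1) * (2 * r) ^ CARD('d))"
    using r content_ball[of 1 "0 :: real ^ 'd"] by (simp add: content_cball)
  also have "\<dots> \<le> real (5 ^ CARD('d)) * (measure lborel (ball (0 :: real ^ 'd) 1) * (2 * r) ^ CARD('d))"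
  proof (intro mult_right_mono of_nat_mono)
    have "card {-2..2::int} = 5" by simp
    then show "card ?S \<le> 5 ^ CARD('d)" using shifts_bounds(2)[of 2, where 'd='d] by simp
  qed (use r in auto)
  also have "\<dots> = 10 ^ CARD('d) * (measure lborel (ball (0 :: real ^ 'd) 1) * r ^ CARD('d))"
  proof -
    have "(10 :: real) ^ CARD('d) = 5 ^ CARD('d) * 2 ^ CARD('d)"
      by (simp flip: power_mult_distrib)
    then show ?thesis by (simp add: power_mult_distrib)
  qed
  finally show ?thesis .
qed

text \<open>The uniform distribution on the unit cube, as a measure whose space is the cube.  Thus all
  points of the space lie in the cube, not just almost all.\<close>

definition cube_points :: "(real ^ 'd) measure" where
  "cube_points = restrict_space lborel (cbox 0 1)"

lemma measure_unit_cube: "emeasure lborel (cbox 0 (1 :: real ^ 'd)) = 1"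
proof -
  have "b \<in> Basis \<Longrightarrow> (1 :: real ^ 'd) \<bullet> b = 1" for b
    by (auto simp: Basis_vec_def inner_axis)
  then show ?thesis by (subst emeasure_lborel_cbox) auto
qed

lemma space_cube_points: "space (cube_points :: (real ^ 'd) measure) = cbox 0 1"
  by (simp add: cube_points_def space_restrict_space)

lemma measure_cube_points:
  "A \<subseteq> cbox 0 1 \<Longrightarrow> measure (cube_points :: (real ^ 'd) measure) A = measure lborel A"
  unfolding cube_points_def by (rule measure_restrict_space) auto

lemma prob_space_cube_points: "prob_space (cube_points :: (real ^ 'd) measure)"
  by (rule prob_spaceI)
     (simp add: space_cube_points, simp add: cube_points_def emeasure_restrict_space measure_unit_cube)

lemma proximity_torus:
  fixes r :: real
  assumes r: "0 < r" "r < 1 / 2"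
    and half: "measure lborel (ball (0 :: real ^ 'd) 1) * r ^ CARD('d) \<le> 1 / 2"
  shows "proximity (cube_points :: (real ^ 'd) measure) (\<lambda>x y. torus_dist x y \<le> r) (torus_near r)
           (measure lborel (ball (0 :: real ^ 'd) 1) * r ^ CARD('d)) (10 ^ CARD('d))"
proof -
  let ?U = "cube_points :: (real ^ 'd) measure"
  interpret prob_space ?U by (rule prob_space_cube_points)
  have id: "(\<lambda>x. x) \<in> borel_measurable ?U"
    unfolding cube_points_def by (intro measurable_restrict_space1) simp
  have fs: "fst \<in> borel_measurable (?U \<Otimes>\<^sub>M ?U)" "snd \<in> borel_measurable (?U \<Otimes>\<^sub>M ?U)"
    using measurable_compose[OF measurable_fst id] measurable_compose[OF measurable_snd id]
    by (simp_all cong: measurable_cong)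
  note fs[measurable]
  show ?thesis
  proof
    show "{z \<in> space (?U \<Otimes>\<^sub>M ?U). torus_dist (fst z) (snd z) \<le> r} \<in> sets (?U \<Otimes>\<^sub>M ?U)"
      by measurable
    have "{z \<in> space (?U \<Otimes>\<^sub>M ?U). torus_near r (fst z) (snd z)} =
        (\<Union>s\<in>shifts 2. {z \<in> space (?U \<Otimes>\<^sub>M ?U). norm (fst z - snd z + s) \<le> 2 * r})"
      by (auto simp: torus_near_def)
    also have "\<dots> \<in> sets (?U \<Otimes>\<^sub>M ?U)"
      by (intro sets.finite_UN shifts_bounds) measurable
    finally show "{z \<in> space (?U \<Otimes>\<^sub>M ?U). torus_near r (fst z) (snd z)} \<in> sets (?U \<Otimes>\<^sub>M ?U)" .
    show "prob {y \<in> space ?U. torus_dist x y \<le> r} = measure lborel (ball (0 :: real ^ 'd) 1) * r ^ CARD('d)"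
      if "x \<in> space ?U" for x
      using that r measure_torus_ball[of x r] by (simp add: space_cube_points measure_cube_points)
    show "prob {y \<in> space ?U. torus_near r x y} \<le>
        10 ^ CARD('d) * (measure lborel (ball (0 :: real ^ 'd) 1) * r ^ CARD('d))" if "x \<in> space ?U" for x
      using measure_torus_near_le[OF r(1), of x] by (simp add: space_cube_points measure_cube_points)
    show "torus_near r x x'" if "x \<in> space ?U" "x' \<in> space ?U" "z \<in> space ?U"
      "torus_dist x z \<le> r" "torus_dist x' z \<le> r" for x x' z
      using that torus_near_common[of x x' z r] by (simp add: space_cube_points)
    show "0 < measure lborel (ball (0 :: real ^ 'd) 1) * r ^ CARD('d)"
      using r content_ball[of 1 "0 :: real ^ 'd"] by simp
  qed (use half in auto)
qed

section \<open>Degrees in the planted graph\<close>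

lemma torus_dist_commute: "torus_dist x y = torus_dist y x"
  by (simp add: torus_dist_def abs_minus_commute)

lemma finite_planted_edges:
  assumes "S \<subseteq> {1..m}"
  shows "finite (add_clique (rgg_edges x m r) S)"
proof (rule finite_subset)
  show "add_clique (rgg_edges x m r) S \<subseteq> Pow {1..m}"
    using assms by (auto simp: add_clique_def rgg_edges_def)
qed simp

lemma nbr_count_le_vdegree:
  assumes "w \<in> {1..m}" "S \<subseteq> {1..m}"
  shows "nbr_count (\<lambda>a b. torus_dist a b \<le> r) x ({1..m} - {w}) w \<le>
           vdegree (add_clique (rgg_edges x m r) S) w"
proof -
  let ?N = "{j\<in>{1..m} - {w}. torus_dist (x w) (x j) \<le> r}"
  have "card ?N = card ((\<lambda>j. {w, j}) ` ?N)"
    by (rule card_image[symmetric]) (auto simp: inj_on_def doubleton_eq_iff)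
  also have "\<dots> \<le> card {e \<in> add_clique (rgg_edges x m r) S. w \<in> e}"
  proof (rule card_mono)
    show "finite {e \<in> add_clique (rgg_edges x m r) S. w \<in> e}"
      by (rule finite_subset[OF _ finite_planted_edges[OF assms(2), of x r]]) auto
    show "(\<lambda>j. {w, j}) ` ?N \<subseteq> {e \<in> add_clique (rgg_edges x m r) S. w \<in> e}"
      using assms by (auto simp: add_clique_def rgg_edges_def)
  qed
  finally show ?thesis by (simp add: nbr_count_def vdegree_def)
qed

lemma vdegree_le_nbr_count:
  assumes "v \<in> S" "S \<subseteq> {1..m}"
  shows "vdegree (add_clique (rgg_edges x m r) S) v \<le>
           nbr_count (\<lambda>a b. torus_dist a b \<le> r) x ({1..m} - {v}) v + card S"
proof -
  let ?N = "{j\<in>{1..m} - {v}. torus_dist (x v) (x j) \<le> r}"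
  have fin: "finite ?N" "finite S" using assms(2) by (auto intro: finite_subset)
  have "{e \<in> add_clique (rgg_edges x m r) S. v \<in> e} \<subseteq> (\<lambda>j. {v, j}) ` (?N \<union> S)"
  proof
    fix e assume "e \<in> {e \<in> add_clique (rgg_edges x m r) S. v \<in> e}"
    then obtain i j where e: "e = {i, j}" "i \<noteq> j" "v \<in> {i, j}"
      and or: "(i \<in> {1..m} \<and> j \<in> {1..m} \<and> torus_dist (x i) (x j) \<le> r) \<or> (i \<in> S \<and> j \<in> S)"
      by (auto simp: add_clique_def rgg_edges_def)
    show "e \<in> (\<lambda>j. {v, j}) ` (?N \<union> S)"
    proof (cases "v = i")
      case True
      then have "j \<in> ?N \<union> S" using e or by auto
      then show ?thesis using e True by auto
    next
      case False
      then have "v = j" using e by auto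
      then have "i \<in> ?N \<union> S" using e or by (auto simp: torus_dist_commute)
      then show ?thesis using e \<open>v = j\<close> by (auto simp: insert_commute)
    qed
  qed
  then have "card {e \<in> add_clique (rgg_edges x m r) S. v \<in> e} \<le> card ((\<lambda>j. {v, j}) ` (?N \<union> S))"
    using fin by (intro card_mono) auto
  also have "\<dots> \<le> card (?N \<union> S)" using fin by (intro card_image_le) auto
  also have "\<dots> \<le> card ?N + card S" by (rule card_Un_le)
  finally show ?thesis by (simp add: nbr_count_def vdegree_def)
qed

lemma vd_recovers_imp_nbr_count_less:
  assumes rec: "vd_recovers {1..m} (add_clique (rgg_edges x m r) S) S"
    and S: "S \<subseteq> {1..m}" "v \<in> S" "w \<in> {1..m} - S"
  shows "nbr_count (\<lambda>a b. torus_dist a b \<le> r) x ({1..m} - {w}) w <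
           nbr_count (\<lambda>a b. torus_dist a b \<le> r) x ({1..m} - {v}) v + card S"
proof -
  let ?Z = "vdegree (add_clique (rgg_edges x m r) S)"
  have finS: "finite S" using S finite_subset by auto
  have "nbr_count (\<lambda>a b. torus_dist a b \<le> r) x ({1..m} - {w}) w \<le> ?Z w"
    using S by (intro nbr_count_le_vdegree) auto
  also have "?Z w \<le> Max (?Z ` ({1..m} - S))" using S by (intro Max_ge) auto
  also have "\<dots> < Min (?Z ` S)" using rec S unfolding vd_recovers_def by blast
  also have "\<dots> \<le> ?Z v" using S finS by (intro Min_le) auto
  also have "\<dots> \<le> nbr_count (\<lambda>a b. torus_dist a b \<le> r) x ({1..m} - {v}) v + card S"
    using S by (intro vdegree_le_nbr_count) auto
  finally show ?thesis .
qed

text \<open>The consequence of recovery for the geometric graph alone when \<open>S\<close> is the planted clique.  The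
  summand \<open>card S\<close> bounds the number of edges that the clique adds at one vertex.\<close>

definition degrees_compatible :: "real \<Rightarrow> nat \<Rightarrow> nat set \<Rightarrow> (nat \<Rightarrow> real ^ 'd) \<Rightarrow> bool" where
  "degrees_compatible r m S x \<longleftrightarrow> (\<forall>v\<in>S. \<forall>w\<in>{1..m} - S.
     nbr_count (\<lambda>a b. torus_dist a b \<le> r) x ({1..m} - {w}) w <
     nbr_count (\<lambda>a b. torus_dist a b \<le> r) x ({1..m} - {v}) v + card S)"

lemma degrees_compatible_cong:
  assumes "S \<subseteq> {1..m}" "\<And>i. i \<in> {1..m} \<Longrightarrow> x i = y i"
  shows "degrees_compatible r m S x \<longleftrightarrow> degrees_compatible r m S y"
proof -
  have eq: "nbr_count (\<lambda>a b. torus_dist a b \<le> r) x ({1..m} - {w}) w =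
        nbr_count (\<lambda>a b. torus_dist a b \<le> r) y ({1..m} - {w}) w" if "w \<in> {1..m}" for w
    unfolding nbr_count_def using assms(2) that by (intro arg_cong[of _ _ card]) auto
  show ?thesis
    unfolding degrees_compatible_def
    by (intro ball_cong refl) (simp only: eq subsetD[OF assms(1)] Diff_iff)
qed

lemma nbr_count_torus_measurable:
  fixes f :: "nat \<Rightarrow> 'a \<Rightarrow> real ^ 'd"
  assumes "\<And>i. i \<in> insert w R \<Longrightarrow> f i \<in> borel_measurable M" "finite R"
  shows "(\<lambda>\<omega>. real (nbr_count (\<lambda>a b. torus_dist a b \<le> r) (\<lambda>i. f i \<omega>) R w)) \<in> borel_measurable M"
proof -
  have "(\<lambda>\<omega>. \<Sum>j\<in>R. if torus_dist (f w \<omega>) (f j \<omega>) \<le> r then 1 else 0 :: real) \<in> borel_measurable M"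
  proof (rule borel_measurable_sum)
    fix j assume "j \<in> R"
    then have [measurable]: "f w \<in> borel_measurable M" "f j \<in> borel_measurable M" using assms by auto
    show "(\<lambda>\<omega>. if torus_dist (f w \<omega>) (f j \<omega>) \<le> r then 1 else 0 :: real) \<in> borel_measurable M"
      by measurable
  qed
  then show ?thesis using assms(2) by (simp add: nbr_count_def sum.If_cases Int_def)
qed

lemma degrees_compatible_sets:
  fixes f :: "nat \<Rightarrow> 'a \<Rightarrow> real ^ 'd"
  assumes f: "\<And>i. i \<in> {1..m} \<Longrightarrow> f i \<in> borel_measurable M" and S: "S \<subseteq> {1..m}"
  shows "{\<omega> \<in> space M. degrees_compatible r m S (\<lambda>i. f i \<omega>)} \<in> sets M"
  unfolding degrees_compatible_def
proof (intro sets.sets_Collect_finite_All)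
  let ?D = "\<lambda>v \<omega>. nbr_count (\<lambda>a b. torus_dist a b \<le> r) (\<lambda>i. f i \<omega>) ({1..m} - {v}) v"
  fix v w assume vw: "v \<in> S" "w \<in> {1..m} - S"
  have [measurable]: "(\<lambda>\<omega>. real (?D v \<omega>)) \<in> borel_measurable M" "(\<lambda>\<omega>. real (?D w \<omega>)) \<in> borel_measurable M"
    using vw S by (auto intro!: nbr_count_torus_measurable f)
  have "{\<omega> \<in> space M. real (?D w \<omega>) < real (?D v \<omega>) + real (card S)} \<in> sets M" by measurable
  also have "{\<omega> \<in> space M. real (?D w \<omega>) < real (?D v \<omega>) + real (card S)} =
      {\<omega> \<in> space M. ?D w \<omega> < ?D v \<omega> + card S}"
    by (simp flip: of_nat_add)
  finally show "{\<omega> \<in> space M. ?D w \<omega> < ?D v \<omega> + card S} \<in> sets M" .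
qed (use S in \<open>auto intro: finite_subset\<close>)

text \<open>The positions lie in the cube only almost surely; the other values are moved to the origin.\<close>

definition clip :: "real ^ 'd \<Rightarrow> real ^ 'd" where
  "clip x = (if x \<in> cbox 0 1 then x else 0)"

lemma clip_measurable: "clip \<in> measurable borel cube_points"
  unfolding cube_points_def
proof (rule measurable_restrict_space2)
  show "clip \<in> space borel \<rightarrow> cbox 0 1" by (auto simp: clip_def mem_box_cart)
  show "clip \<in> borel \<rightarrow>\<^sub>M lborel" unfolding clip_def by measurable
qed

lemma distr_clip_uniform:
  "distr (uniform_measure lborel (cbox 0 1)) cube_points clip = (cube_points :: (real ^ 'd) measure)"
proof (rule measure_eqI)
  fix A :: "(real ^ 'd) set" assume A: "A \<in> sets (distr (uniform_measure lborel (cbox 0 1)) cube_points clip)"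
  then have AU: "A \<in> sets cube_points" by simp
  have AC: "A \<subseteq> cbox 0 1" using sets.sets_into_space[OF AU] by (simp add: space_cube_points)
  have m: "clip \<in> measurable (uniform_measure lborel (cbox 0 1)) cube_points"
    using clip_measurable by (simp cong: measurable_cong_sets)
  have pre: "clip -` A \<in> sets borel"
    using measurable_sets[OF clip_measurable AU] by simp
  have "emeasure (distr (uniform_measure lborel (cbox 0 1)) cube_points clip) A =
      emeasure (uniform_measure lborel (cbox 0 1)) (clip -` A)"
    using AU m by (subst emeasure_distr) auto
  also have "\<dots> = emeasure lborel (cbox 0 1 \<inter> clip -` A)"
    using pre by (subst emeasure_uniform_measure) (auto simp: measure_unit_cube divide_ennreal_def)
  also have "cbox 0 1 \<inter> clip -` A = A" using AC by (auto simp: clip_def)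
  also have "emeasure lborel A = emeasure cube_points A"
    using AC by (simp add: cube_points_def emeasure_restrict_space)
  finally show "emeasure (distr (uniform_measure lborel (cbox 0 1)) cube_points clip) A = emeasure cube_points A" .
qed simp

context planted_rgg
begin

lemma X_measurable: "1 \<le> i \<Longrightarrow> X i \<in> borel_measurable M"
  using X_indep by (auto simp: indep_vars_def)

lemma AE_X_in_cube:
  assumes "1 \<le> i"
  shows "AE \<omega> in M. X i \<omega> \<in> cbox 0 1"
proof -
  have "AE x in distr M borel (X i). x \<in> cbox 0 1"
    unfolding X_uniform[OF assms] by (rule AE_uniform_measureI) auto
  then show ?thesis using X_measurable[OF assms] by (subst (asm) AE_distr_iff) auto
qed

lemma distr_positions:
  assumes m: "1 \<le> m"
  shows "distr M (PiM {1..m} (\<lambda>_. cube_points)) (\<lambda>\<omega>. \<lambda>i\<in>{1..m}. clip (X i \<omega>)) =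
           PiM {1..m} (\<lambda>_. cube_points)"
proof -
  have "indep_vars (\<lambda>_. borel) X {1..m}"
    by (rule indep_vars_subset[OF X_indep]) auto
  then have ind: "indep_vars (\<lambda>_. cube_points) (\<lambda>i. clip \<circ> X i) {1..m}"
    by (rule indep_vars_compose) (rule clip_measurable)
  have rv: "clip \<circ> X i \<in> measurable M cube_points" if "i \<in> {1..m}" for i
    using that by (intro measurable_comp[OF X_measurable clip_measurable]) auto
  have "distr M (PiM {1..m} (\<lambda>_. cube_points)) (\<lambda>\<omega>. \<lambda>i\<in>{1..m}. (clip \<circ> X i) \<omega>) =
      PiM {1..m} (\<lambda>i. distr M cube_points (clip \<circ> X i))"
    using indep_vars_iff_distr_eq_PiM'[of "{1..m}" "\<lambda>i. clip \<circ> X i" "\<lambda>_. cube_points"] m rv ind by auto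
  also have "\<dots> = PiM {1..m} (\<lambda>_. cube_points)"
  proof (rule PiM_cong)
    fix i assume i: "i \<in> {1..m}"
    have "distr M cube_points (clip \<circ> X i) = distr (distr M borel (X i)) cube_points clip"
      using i by (intro distr_distr[symmetric] clip_measurable X_measurable) auto
    also have "\<dots> = cube_points" using i by (simp add: X_uniform distr_clip_uniform)
    finally show "distr M cube_points (clip \<circ> X i) = cube_points" .
  qed simp
  finally show ?thesis by simp
qed

lemma prob_degrees_compatible:
  assumes m: "1 \<le> m" and S: "S \<subseteq> {1..m}"
  shows "prob {\<omega> \<in> space M. degrees_compatible r m S (\<lambda>i. X i \<omega>)} =
           measure (PiM {1..m} (\<lambda>_. cube_points :: (real ^ 'd) measure))
             {x \<in> space (PiM {1..m} (\<lambda>_. cube_points)). degrees_compatible r m S x}"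
proof -
  let ?P = "PiM {1..m} (\<lambda>_. cube_points :: (real ^ 'd) measure)"
  let ?T = "\<lambda>\<omega>. \<lambda>i\<in>{1..m}. clip (X i \<omega>)"
  have T: "?T \<in> measurable M ?P"
    by (intro measurable_restrict measurable_compose[OF X_measurable clip_measurable]) auto
  have id: "(\<lambda>x. x) \<in> borel_measurable (cube_points :: (real ^ 'd) measure)"
    unfolding cube_points_def by (intro measurable_restrict_space1) simp
  have E: "{x \<in> space ?P. degrees_compatible r m S x} \<in> sets ?P"
    by (rule degrees_compatible_sets[where f = "\<lambda>i x. x i"])
       (use S in \<open>auto intro!: measurable_compose[OF _ id] measurable_component_singleton\<close>)
  have AEc: "AE \<omega> in M. \<forall>i\<in>{1..m}. X i \<omega> \<in> cbox 0 1"
    using AE_X_in_cube by (intro AE_finite_allI) auto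
  have "prob {\<omega> \<in> space M. degrees_compatible r m S (\<lambda>i. X i \<omega>)} =
      prob (?T -` {x \<in> space ?P. degrees_compatible r m S x} \<inter> space M)"
  proof (rule finite_measure_eq_AE)
    show "{\<omega> \<in> space M. degrees_compatible r m S (\<lambda>i. X i \<omega>)} \<in> events"
      by (rule degrees_compatible_sets) (use X_measurable S in auto)
    show "?T -` {x \<in> space ?P. degrees_compatible r m S x} \<inter> space M \<in> events"
      by (rule measurable_sets[OF T E])
    show "AE \<omega> in M. \<omega> \<in> {\<omega> \<in> space M. degrees_compatible r m S (\<lambda>i. X i \<omega>)} \<longleftrightarrow>
        \<omega> \<in> ?T -` {x \<in> space ?P. degrees_compatible r m S x} \<inter> space M"
      using AEc
    proof eventually_elim
      case (elim \<omega>)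
      have "degrees_compatible r m S (?T \<omega>) \<longleftrightarrow> degrees_compatible r m S (\<lambda>i. X i \<omega>)"
        by (rule degrees_compatible_cong[OF S]) (use elim in \<open>auto simp: clip_def\<close>)
      then show ?case using measurable_space[OF T] by auto
    qed
  qed
  also have "\<dots> = measure (distr M ?P ?T) {x \<in> space ?P. degrees_compatible r m S x}"
    by (rule measure_distr[OF T E, symmetric])
  also have "distr M ?P ?T = ?P" by (rule distr_positions[OF m])
  finally show ?thesis .
qed

lemma prob_NK_positions:
  assumes n: "1 \<le> n" and m: "1 \<le> m" and S: "S \<subseteq> {1..m}"
  shows "prob ({\<omega> \<in> space M. N n \<omega> = m \<and> K n \<omega> = S} \<inter> {\<omega> \<in> space M. degrees_compatible r m S (\<lambda>i. X i \<omega>)}) =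
           prob {\<omega> \<in> space M. N n \<omega> = m \<and> K n \<omega> = S} * prob {\<omega> \<in> space M. degrees_compatible r m S (\<lambda>i. X i \<omega>)}"
proof (rule indep_setD[OF NK_indep_X[OF n]])
  show "{\<omega> \<in> space M. N n \<omega> = m \<and> K n \<omega> = S} \<in> {{\<omega> \<in> space M. (N n \<omega>, K n \<omega>) \<in> B} |B. True}"
    by (rule CollectI, rule exI[of _ "{(m, S)}"]) auto
  let ?A = "{x \<in> space (PiM {1..} (\<lambda>_. borel)). degrees_compatible r m S x}"
  have "?A \<in> sets (PiM {1..} (\<lambda>_. borel))"
    by (rule degrees_compatible_sets[where f = "\<lambda>i x. x i"]) (use S in auto)
  moreover have "{\<omega> \<in> space M. degrees_compatible r m S (\<lambda>i. X i \<omega>)} =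
      {\<omega> \<in> space M. (\<lambda>i\<in>{1..}. X i \<omega>) \<in> ?A}"
  proof (intro Collect_cong conj_cong refl)
    fix \<omega>
    have "degrees_compatible r m S (\<lambda>i\<in>{1..}. X i \<omega>) \<longleftrightarrow> degrees_compatible r m S (\<lambda>i. X i \<omega>)"
      by (rule degrees_compatible_cong[OF S]) auto
    then show "degrees_compatible r m S (\<lambda>i. X i \<omega>) \<longleftrightarrow> (\<lambda>i\<in>{1..}. X i \<omega>) \<in> ?A"
      by (auto simp: space_PiM)
  qed
  ultimately show "{\<omega> \<in> space M. degrees_compatible r m S (\<lambda>i. X i \<omega>)} \<in>
      {{\<omega> \<in> space M. (\<lambda>i\<in>{1..}. X i \<omega>) \<in> A} |A. A \<in> sets (PiM {1..} (\<lambda>_. borel))}"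
    by blast
qed

lemma NK_events:
  assumes n: "1 \<le> n"
  shows "{\<omega> \<in> space M. N n \<omega> = m} \<in> events"
    and "finite S \<Longrightarrow> {\<omega> \<in> space M. N n \<omega> = m \<and> K n \<omega> = S} \<in> events"
proof -
  note N_measurable[OF n, measurable]
  show N: "{\<omega> \<in> space M. N n \<omega> = m} \<in> events" by measurable
  assume S: "finite S"
  have "K n -` {S} \<inter> space M \<in> events"
    by (rule measurable_sets[OF K_measurable[OF n]]) (use S in auto)
  then have "{\<omega> \<in> space M. N n \<omega> = m} \<inter> (K n -` {S} \<inter> space M) \<in> events" using N by blast
  also have "{\<omega> \<in> space M. N n \<omega> = m} \<inter> (K n -` {S} \<inter> space M) = {\<omega> \<in> space M. N n \<omega> = m \<and> K n \<omega> = S}"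
    by auto
  finally show "{\<omega> \<in> space M. N n \<omega> = m \<and> K n \<omega> = S} \<in> events" .
qed

lemma sum_prob_NK:
  assumes n: "1 \<le> n" and k: "k n \<le> m"
  shows "(\<Sum>S | S \<subseteq> {1..m} \<and> card S = k n. prob {\<omega> \<in> space M. N n \<omega> = m \<and> K n \<omega> = S}) =
           prob {\<omega> \<in> space M. N n \<omega> = m}"
proof -
  have "(\<Sum>S | S \<subseteq> {1..m} \<and> card S = k n. prob {\<omega> \<in> space M. N n \<omega> = m \<and> K n \<omega> = S}) =
      (\<Sum>S | S \<subseteq> {1..m} \<and> card S = k n. prob {\<omega> \<in> space M. N n \<omega> = m} / real (m choose k n))"
    using K_uniform[OF n] by (intro sum.cong) auto
  also have "\<dots> = prob {\<omega> \<in> space M. N n \<omega> = m}"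
    using n_subsets[of "{1..m}" "k n"] k by (simp add: binomial_eq_0_iff not_less)
  finally show ?thesis .
qed

text \<open>Given the number \<open>m\<close> of vertices, the clique is almost surely a \<open>k n\<close>-subset of the vertex set,
  because the probabilities of these subsets sum up to that of \<open>N n = m\<close>.\<close>

lemma prob_recovery_given_size_le:
  assumes n: "1 \<le> n" and k: "1 \<le> k n" "k n \<le> m" and b: "0 \<le> b"
    and le: "\<And>S. S \<subseteq> {1..m} \<Longrightarrow> card S = k n \<Longrightarrow>
      measure (PiM {1..m} (\<lambda>_. cube_points :: (real ^ 'd) measure))
        {x \<in> space (PiM {1..m} (\<lambda>_. cube_points)). degrees_compatible r m S x} \<le> b"
  shows "prob {\<omega> \<in> space M. N n \<omega> = m \<and> vd_recovers {1..N n \<omega>}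
           (add_clique (rgg_edges (\<lambda>i. X i \<omega>) (N n \<omega>) r) (K n \<omega>)) (K n \<omega>)} \<le>
         b * prob {\<omega> \<in> space M. N n \<omega> = m}"
proof -
  let ?SS = "{S. S \<subseteq> {1..m} \<and> card S = k n}"
  let ?NK = "\<lambda>S. {\<omega> \<in> space M. N n \<omega> = m \<and> K n \<omega> = S}"
  let ?D = "\<lambda>S. {\<omega> \<in> space M. degrees_compatible r m S (\<lambda>i. X i \<omega>)}"
  let ?Nm = "{\<omega> \<in> space M. N n \<omega> = m}"
  have m: "1 \<le> m" using k by simp
  have finSS: "finite ?SS" by simp
  have NK: "?NK S \<in> events" if "S \<in> ?SS" for S
    using that by (intro NK_events n) (auto intro: finite_subset)
  have D: "?D S \<in> events" if "S \<in> ?SS" for S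
    using that by (intro degrees_compatible_sets X_measurable) auto
  have UNK: "(\<Union>S\<in>?SS. ?NK S) \<in> events" by (intro sets.finite_UN finSS NK)
  have UD: "(\<Union>S\<in>?SS. ?NK S \<inter> ?D S) \<in> events" by (intro sets.finite_UN finSS sets.Int NK D)
  \<comment> \<open>The event that the clique is not a \<open>k n\<close>-subset of the vertex set.\<close>
  have null: "prob (?Nm - (\<Union>S\<in>?SS. ?NK S)) = 0"
  proof -
    have "prob (\<Union>S\<in>?SS. ?NK S) = (\<Sum>S\<in>?SS. prob (?NK S))"
      using NK finSS by (intro finite_measure_finite_Union) (auto simp: disjoint_family_on_def)
    also have "\<dots> = prob ?Nm" by (rule sum_prob_NK[OF n k(2)])
    finally have "prob (\<Union>S\<in>?SS. ?NK S) = prob ?Nm" .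
    moreover have "prob (?Nm - (\<Union>S\<in>?SS. ?NK S)) = prob ?Nm - prob (\<Union>S\<in>?SS. ?NK S)"
      using UNK NK_events(1)[OF n] by (intro finite_measure_Diff) auto
    ultimately show ?thesis by simp
  qed
  have "{\<omega> \<in> space M. N n \<omega> = m \<and> vd_recovers {1..N n \<omega>}
           (add_clique (rgg_edges (\<lambda>i. X i \<omega>) (N n \<omega>) r) (K n \<omega>)) (K n \<omega>)} \<subseteq>
      (?Nm - (\<Union>S\<in>?SS. ?NK S)) \<union> (\<Union>S\<in>?SS. ?NK S \<inter> ?D S)"
  proof
    fix \<omega> assume w: "\<omega> \<in> {\<omega> \<in> space M. N n \<omega> = m \<and> vd_recovers {1..N n \<omega>}
           (add_clique (rgg_edges (\<lambda>i. X i \<omega>) (N n \<omega>) r) (K n \<omega>)) (K n \<omega>)}"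
    show "\<omega> \<in> (?Nm - (\<Union>S\<in>?SS. ?NK S)) \<union> (\<Union>S\<in>?SS. ?NK S \<inter> ?D S)"
    proof (cases "K n \<omega> \<in> ?SS")
      case True
      then have KS: "K n \<omega> \<subseteq> {1..m}" by simp
      have rec: "vd_recovers {1..m} (add_clique (rgg_edges (\<lambda>i. X i \<omega>) m r) (K n \<omega>)) (K n \<omega>)"
        using w by auto
      have "degrees_compatible r m (K n \<omega>) (\<lambda>i. X i \<omega>)"
        unfolding degrees_compatible_def
        by (intro ballI) (rule vd_recovers_imp_nbr_count_less[OF rec KS])
      then show ?thesis using w True by auto
    next
      case False
      then show ?thesis using w by auto
    qed
  qed
  then have "prob {\<omega> \<in> space M. N n \<omega> = m \<and> vd_recovers {1..N n \<omega>}
           (add_clique (rgg_edges (\<lambda>i. X i \<omega>) (N n \<omega>) r) (K n \<omega>)) (K n \<omega>)} \<le>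
      prob ((?Nm - (\<Union>S\<in>?SS. ?NK S)) \<union> (\<Union>S\<in>?SS. ?NK S \<inter> ?D S))"
    by (rule finite_measure_mono) (intro sets.Un sets.Diff NK_events(1) n UNK UD)
  also have "\<dots> \<le> prob (?Nm - (\<Union>S\<in>?SS. ?NK S)) + prob (\<Union>S\<in>?SS. ?NK S \<inter> ?D S)"
    by (intro measure_Un_le sets.Diff NK_events(1) n UNK UD)
  also have "prob (\<Union>S\<in>?SS. ?NK S \<inter> ?D S) \<le> (\<Sum>S\<in>?SS. prob (?NK S \<inter> ?D S))"
    using NK D finSS by (intro finite_measure_subadditive_finite) auto
  also have "\<dots> \<le> (\<Sum>S\<in>?SS. prob (?NK S) * b)"
  proof (rule sum_mono)
    fix S assume S: "S \<in> ?SS"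
    have "prob (?NK S \<inter> ?D S) = prob (?NK S) * prob (?D S)"
      using S by (intro prob_NK_positions n m) auto
    also have "\<dots> \<le> prob (?NK S) * b"
      using S le[of S] m by (intro mult_left_mono) (auto simp: prob_degrees_compatible)
    finally show "prob (?NK S \<inter> ?D S) \<le> prob (?NK S) * b" .
  qed
  also have "\<dots> = prob ?Nm * b"
    unfolding sum_distrib_right[symmetric] sum_prob_NK[OF n k(2)] ..
  finally show ?thesis using null by (simp add: mult.commute)
qed

lemma prob_recovery_le:
  assumes n: "1 \<le> n" and \<delta>: "0 < \<delta>" "\<delta> < 1" and k: "1 \<le> k n" "real (k n) \<le> (1 - \<delta>) * real n" and b: "0 \<le> b"
    and le: "\<And>m S. (1 - \<delta>) * real n \<le> real m \<Longrightarrow> real m \<le> (1 + \<delta>) * real n \<Longrightarrow>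
      S \<subseteq> {1..m} \<Longrightarrow> card S = k n \<Longrightarrow>
      measure (PiM {1..m} (\<lambda>_. cube_points :: (real ^ 'd) measure))
        {x \<in> space (PiM {1..m} (\<lambda>_. cube_points)). degrees_compatible r m S x} \<le> b"
  shows "prob {\<omega> \<in> space M. vd_recovers {1..N n \<omega>}
           (add_clique (rgg_edges (\<lambda>i. X i \<omega>) (N n \<omega>) r) (K n \<omega>)) (K n \<omega>)} \<le>
         b + exp (- real n * H (1 - \<delta>)) + exp (- real n * H (1 + \<delta>))"
proof -
  let ?rec = "\<lambda>\<omega>. vd_recovers {1..N n \<omega>}
           (add_clique (rgg_edges (\<lambda>i. X i \<omega>) (N n \<omega>) r) (K n \<omega>)) (K n \<omega>)"
  let ?J = "{m. (1 - \<delta>) * real n \<le> real m \<and> real m \<le> (1 + \<delta>) * real n}"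
  let ?L = "{m. real m \<le> (1 - \<delta>) * real n}" and ?U = "{m. (1 + \<delta>) * real n \<le> real m}"
  let ?Rm = "\<lambda>m. {\<omega> \<in> space M. N n \<omega> = m \<and> ?rec \<omega>}"
  have finJ: "finite ?J"
  proof (rule finite_subset)
    show "?J \<subseteq> {..nat \<lceil>(1 + \<delta>) * real n\<rceil>}" by (auto, linarith)
  qed simp
  note N_measurable[OF n, measurable]
  have tail: "prob {\<omega> \<in> space M. N n \<omega> \<in> B} = measure (measure_pmf (poisson_pmf (real n))) B" for B
  proof -
    have "measure (measure_pmf (poisson_pmf (real n))) B = measure (distr M (count_space UNIV) (N n)) B"
      unfolding N_poisson[OF n] ..
    also have "\<dots> = prob (N n -` B \<inter> space M)" by (rule measure_distr) auto
    also have "N n -` B \<inter> space M = {\<omega> \<in> space M. N n \<omega> \<in> B}" by auto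
    finally show ?thesis ..
  qed
  have LU: "{\<omega> \<in> space M. N n \<omega> \<in> B} \<in> events" for B by measurable
  have R: "?Rm m \<in> events" for m
  proof -
    have "{\<omega> \<in> space M. N n \<omega> = m} \<inter> {\<omega> \<in> space M. ?rec \<omega>} \<in> events"
      using NK_events(1)[OF n] recovery_event_measurable[OF n] by blast
    also have "{\<omega> \<in> space M. N n \<omega> = m} \<inter> {\<omega> \<in> space M. ?rec \<omega>} = ?Rm m" by auto
    finally show ?thesis .
  qed
  have UR: "(\<Union>m\<in>?J. ?Rm m) \<in> events" by (intro sets.finite_UN finJ R)
  have "{\<omega> \<in> space M. ?rec \<omega>} \<subseteq>
      (\<Union>m\<in>?J. ?Rm m) \<union> {\<omega> \<in> space M. N n \<omega> \<in> ?L} \<union> {\<omega> \<in> space M. N n \<omega> \<in> ?U}"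
    by auto
  then have "prob {\<omega> \<in> space M. ?rec \<omega>} \<le>
      prob ((\<Union>m\<in>?J. ?Rm m) \<union> {\<omega> \<in> space M. N n \<omega> \<in> ?L} \<union> {\<omega> \<in> space M. N n \<omega> \<in> ?U})"
    by (rule finite_measure_mono) (intro sets.Un UR LU)
  also have "\<dots> \<le> prob ((\<Union>m\<in>?J. ?Rm m) \<union> {\<omega> \<in> space M. N n \<omega> \<in> ?L}) + prob {\<omega> \<in> space M. N n \<omega> \<in> ?U}"
    by (intro measure_Un_le sets.Un UR LU)
  also have "prob ((\<Union>m\<in>?J. ?Rm m) \<union> {\<omega> \<in> space M. N n \<omega> \<in> ?L}) \<le>
      prob (\<Union>m\<in>?J. ?Rm m) + prob {\<omega> \<in> space M. N n \<omega> \<in> ?L}"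
    by (intro measure_Un_le UR LU)
  also have "prob {\<omega> \<in> space M. N n \<omega> \<in> ?U} \<le> exp (- real n * H (1 + \<delta>))"
    unfolding tail by (rule poisson_upper_tail) (use n \<delta> in auto)
  also have "prob {\<omega> \<in> space M. N n \<omega> \<in> ?L} \<le> exp (- real n * H (1 - \<delta>))"
    unfolding tail by (rule poisson_lower_tail) (use n \<delta> in auto)
  also have "prob (\<Union>m\<in>?J. ?Rm m) \<le> (\<Sum>m\<in>?J. prob (?Rm m))"
    using R finJ by (intro finite_measure_subadditive_finite) auto
  also have "\<dots> \<le> (\<Sum>m\<in>?J. b * prob {\<omega> \<in> space M. N n \<omega> = m})"
  proof (rule sum_mono)
    fix m assume m: "m \<in> ?J"
    then have "real (k n) \<le> real m" using k by auto
    then show "prob (?Rm m) \<le> b * prob {\<omega> \<in> space M. N n \<omega> = m}"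
      using m by (intro prob_recovery_given_size_le n k b le) auto
  qed
  also have "\<dots> = b * prob (\<Union>m\<in>?J. {\<omega> \<in> space M. N n \<omega> = m})"
    unfolding sum_distrib_left[symmetric] using finJ NK_events(1)[OF n]
    by (subst finite_measure_finite_Union) (auto simp: disjoint_family_on_def)
  also have "\<dots> \<le> b * 1" using b by (intro mult_left_mono prob_le_1) auto
  finally show ?thesis by simp
qed

end

section \<open>Bounds for a fixed number of vertices and a fixed clique\<close>

lemma prob_degrees_compatible_le_exchangeable:
  fixes r p :: real and S :: "nat set"
  assumes r: "0 < r" "r < 1 / 2"
    and p: "p = measure lborel (ball (0 :: real ^ 'd) 1) * r ^ CARD('d)" "p \<le> 1 / 2"
    and n: "real n \<le> 2 * real m" "4 * (J + 1) \<le> n"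
    and S: "S \<subseteq> {1..m}" "1 \<le> card S" "J + card S \<le> m"
  shows "measure (PiM {1..m} (\<lambda>_. cube_points :: (real ^ 'd) measure))
           {x \<in> space (PiM {1..m} (\<lambda>_. cube_points)). degrees_compatible r m S x} \<le>
         1 / (real J + 1) + real J * (8 / (real n * p) +
           2 * (real J + real (card S) + 1) / sqrt (real n * p) + 10 ^ CARD('d) * p)"
proof -
  interpret G: proximity "cube_points :: (real ^ 'd) measure" "\<lambda>x y. torus_dist x y \<le> r" "torus_near r"
    p "10 ^ CARD('d)"
    using proximity_torus[of r, where 'd = 'd] r p by simp
  have finS: "finite S" using S(1) finite_subset by auto
  obtain v where v: "v \<in> S" using S(2) by (metis card.empty equals0I not_one_le_zero)
  have "J \<le> card ({1..m} - S)" using S finS by (simp add: card_Diff_subset)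
  then obtain W where W: "W \<subseteq> {1..m} - S" "card W = J" by (rule obtain_subset_with_card_n)
  have finW: "finite W" using W(1) finite_subset by auto
  define R where "R = {1..m} - {v} - W"
  have cR: "card R = m - 1 - J"
  proof -
    have "card ({1..m} - {v}) = m - 1" using v S by (subst card_Diff_singleton) auto
    moreover have "card R = card ({1..m} - {v}) - card W"
      unfolding R_def using W v finW by (intro card_Diff_subset) auto
    ultimately show ?thesis using W by simp
  qed
  have "n \<le> 2 * m" using n(1) by linarith
  then have "n \<le> 4 * (m - 1 - J)" using n(2) by arith
  then have R4: "real n / 4 \<le> real (card R)" unfolding cR by linarith
  have n0: "0 < real n" using n(2) by simp
  define u where "u = real (card R) * p"
  have np: "0 < real n * p" using n0 G.p_pos by simp
  have u: "real n * p / 4 \<le> u"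
    using mult_right_mono[OF R4, of p] G.p_pos by (simp add: u_def)
  have u0: "0 < u" using u np by linarith
  have R0: "R \<noteq> {}" using R4 n0 by auto
  have "measure (PiM {1..m} (\<lambda>_. cube_points :: (real ^ 'd) measure))
           {x \<in> space (PiM {1..m} (\<lambda>_. cube_points)). degrees_compatible r m S x} \<le>
      1 / (real (card W) + 1) + real (card W) *
        (2 / (real (card R) * p) + (real (card W + card S) + 1) / sqrt (real (card R) * p) + 10 ^ CARD('d) * p)"
  proof (rule G.prob_below_le_exchangeable[where v = v and k = "card S"])
    show "{x \<in> space (PiM {1..m} (\<lambda>_. cube_points)). degrees_compatible r m S x} \<subseteq>
      {x \<in> space (PiM {1..m} (\<lambda>_. cube_points)). \<forall>w\<in>W.
         nbr_count (\<lambda>x y. torus_dist x y \<le> r) x ({1..m} - {w}) w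
         < nbr_count (\<lambda>x y. torus_dist x y \<le> r) x ({1..m} - {v}) v + card S}"
      using W v by (auto simp: degrees_compatible_def)
  qed (use v W S R0 in \<open>auto simp: R_def\<close>)
  also have "\<dots> = 1 / (real J + 1) + real J * (2 / u + (real J + real (card S) + 1) / sqrt u + 10 ^ CARD('d) * p)"
    by (simp add: W u_def)
  also have "\<dots> \<le> 1 / (real J + 1) + real J * (8 / (real n * p) +
           2 * (real J + real (card S) + 1) / sqrt (real n * p) + 10 ^ CARD('d) * p)"
  proof (intro add_left_mono mult_left_mono add_right_mono add_mono)
    show "2 / u \<le> 8 / (real n * p)"
      using u u0 np by (simp add: field_simps)
    have "sqrt (real n * p) / 2 = sqrt (real n * p / 4)" by (simp add: real_sqrt_divide)
    also have "\<dots> \<le> sqrt u" using u by simp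
    finally have "(real J + real (card S) + 1) / sqrt u \<le> (real J + real (card S) + 1) / (sqrt (real n * p) / 2)"
      using np u0 by (intro divide_left_mono) auto
    then show "(real J + real (card S) + 1) / sqrt u \<le> 2 * (real J + real (card S) + 1) / sqrt (real n * p)"
      by (simp add: mult.commute)
  qed simp
  finally show ?thesis .
qed

text \<open>The numbers \<open>L\<close> and \<open>R\<close> are the sizes of the set of candidates and of the reservoir.\<close>

lemma prob_degrees_compatible_le_second_moment:
  fixes r p \<delta> :: real and S :: "nat set"
  assumes r: "0 < r" "r < 1 / 2"
    and p: "p = measure lborel (ball (0 :: real ^ 'd) 1) * r ^ CARD('d)" "p \<le> 1 / 2"
    and n: "1 \<le> n" "real m \<le> (1 + \<delta>) * real n" and \<delta>: "0 < \<delta>"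
    and S: "S \<subseteq> {1..m}" "1 \<le> card S" "R + L + card S \<le> m" and L: "1 \<le> L"
    and t: "2 * t \<le> R" "(1 + 2 * \<delta>) * (real n * p) + real (card S) \<le> real t"
    and q: "q = real (R choose t) * p ^ t * (1 - p) ^ (R - t)" "0 < q"
  shows "measure (PiM {1..m} (\<lambda>_. cube_points :: (real ^ 'd) measure))
           {x \<in> space (PiM {1..m} (\<lambda>_. cube_points)). degrees_compatible r m S x} \<le>
         (1 + \<delta>) / (\<delta>\<^sup>2 * (real n * p)) +
           (1 / (real L * q) + (1 / (1 - p) ^ (2 * t) - 1) + 10 ^ CARD('d) * p / q)"
proof -
  interpret G: proximity "cube_points :: (real ^ 'd) measure" "\<lambda>x y. torus_dist x y \<le> r" "torus_near r"
    p "10 ^ CARD('d)"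
    using proximity_torus[of r, where 'd = 'd] r p by simp
  have finS: "finite S" using S(1) finite_subset by auto
  obtain v where v: "v \<in> S" using S(2) by (metis card.empty equals0I not_one_le_zero)
  have cS: "card ({1..m} - S) = m - card S" using S(1) finS by (simp add: card_Diff_subset)
  then have "L \<le> card ({1..m} - S)" using S by simp
  then obtain A where A: "A \<subseteq> {1..m} - S" "card A = L" by (rule obtain_subset_with_card_n)
  have finA: "finite A" using A(1) finite_subset by auto
  have "card ({1..m} - S - A) = m - card S - L"
    using A finA cS by (simp add: card_Diff_subset)
  then have "R \<le> card ({1..m} - S - A)" using S by simp
  then obtain Q where Q: "Q \<subseteq> {1..m} - S - A" "card Q = R" by (rule obtain_subset_with_card_n)
  define u where "u = real n * p"
  have u: "0 < u" using n G.p_pos by (simp add: u_def)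
  have mp: "real m * p \<le> (1 + \<delta>) * u"
    using mult_right_mono[OF n(2), of p] G.p_pos by (simp add: u_def mult.assoc)
  have "measure (PiM {1..m} (\<lambda>_. cube_points :: (real ^ 'd) measure))
           {x \<in> space (PiM {1..m} (\<lambda>_. cube_points)). degrees_compatible r m S x} \<le>
      real (card {1..m}) * p / (\<delta> * u)\<^sup>2 +
        (1 / (real (card A) * q) + (1 / (1 - p) ^ (2 * t) - 1) + 10 ^ CARD('d) * p / q)"
  proof (rule G.prob_below_le_second_moment[where v = v and k = "card S" and R = Q])
    show "{x \<in> space (PiM {1..m} (\<lambda>_. cube_points)). degrees_compatible r m S x} \<subseteq>
      {x \<in> space (PiM {1..m} (\<lambda>_. cube_points)). \<forall>w\<in>A.
         nbr_count (\<lambda>x y. torus_dist x y \<le> r) x ({1..m} - {w}) w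
         < nbr_count (\<lambda>x y. torus_dist x y \<le> r) x ({1..m} - {v}) v + card S}"
      using A v by (auto simp: degrees_compatible_def)
    show "real (card {1..m}) * p + \<delta> * u + real (card S) \<le> real t"
      using mp t(2) by (simp add: u_def algebra_simps)
  qed (use v A Q S L t q \<delta> u in auto)
  also have "real (card {1..m}) * p / (\<delta> * u)\<^sup>2 \<le> (1 + \<delta>) * u / (\<delta> * u)\<^sup>2"
    using mp by (intro divide_right_mono) auto
  also have "(1 + \<delta>) * u / (\<delta> * u)\<^sup>2 = (1 + \<delta>) / (\<delta>\<^sup>2 * u)"
    using u by (simp add: power2_eq_square)
  finally show ?thesis using A by (simp add: u_def)
qed

section \<open>The two regimes\<close>

lemma tendsto_rounded:
  fixes f x :: "nat \<Rightarrow> real"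
  assumes f: "filterlim f at_top sequentially" and x: "\<forall>\<^sub>F n in sequentially. \<bar>x n - c * f n\<bar> \<le> 1"
  shows "(\<lambda>n. x n / f n) \<longlonglongrightarrow> c"
proof -
  have inv: "(\<lambda>n. 1 / f n) \<longlonglongrightarrow> 0"
    using f by (auto intro: tendsto_divide_0 filterlim_at_top_imp_at_infinity)
  have "(\<lambda>n. x n / f n - c) \<longlonglongrightarrow> 0"
  proof (rule Lim_null_comparison[OF _ inv])
    have "\<forall>\<^sub>F n in sequentially. 1 \<le> f n" using f unfolding filterlim_at_top by blast
    with x show "\<forall>\<^sub>F n in sequentially. norm (x n / f n - c) \<le> 1 / f n"
    proof eventually_elim
      case (elim n)
      then have "x n / f n - c = (x n - c * f n) / f n" by (simp add: diff_divide_distrib)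
      then show ?case using elim by (simp add: divide_right_mono)
    qed
  qed
  then show ?thesis by (simp add: LIM_zero_iff)
qed


text \<open>A bound that holds uniformly for all typical vertex numbers and all cliques carries over to the
  recovery probability.\<close>

lemma (in planted_rgg) eventually_recovery_less:
  fixes B :: "nat \<Rightarrow> real"
  assumes \<delta>: "0 < \<delta>" "\<delta> < 1"
    and k: "\<forall>\<^sub>F n in sequentially. 1 \<le> k n \<and> real (k n) \<le> (1 - \<delta>) * real n"
    and le: "\<forall>\<^sub>F n in sequentially. \<forall>m S. (1 - \<delta>) * real n \<le> real m \<longrightarrow> real m \<le> (1 + \<delta>) * real n \<longrightarrow>
      S \<subseteq> {1..m} \<longrightarrow> card S = k n \<longrightarrow>
      measure (PiM {1..m} (\<lambda>_. cube_points :: (real ^ 'd) measure))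
        {x \<in> space (PiM {1..m} (\<lambda>_. cube_points)). degrees_compatible (r n) m S x} \<le> B n"
    and B: "\<forall>\<^sub>F n in sequentially. 0 \<le> B n" "B \<longlonglongrightarrow> b" "b < e"
  shows "\<forall>\<^sub>F n in sequentially. prob {\<omega> \<in> space M. vd_recovers {1..N n \<omega>}
           (add_clique (rgg_edges (\<lambda>i. X i \<omega>) (N n \<omega>) (r n)) (K n \<omega>)) (K n \<omega>)} < e"
proof -
  have ex: "(\<lambda>n. exp (- real n * h)) \<longlonglongrightarrow> 0" if "0 < h" for h :: real
    using that by real_asymp
  have "(\<lambda>n. B n + exp (- real n * H (1 - \<delta>)) + exp (- real n * H (1 + \<delta>))) \<longlonglongrightarrow> b + 0 + 0"
    using \<delta> by (intro tendsto_add B ex H_pos) auto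
  then have "\<forall>\<^sub>F n in sequentially. B n + exp (- real n * H (1 - \<delta>)) + exp (- real n * H (1 + \<delta>)) < e"
    by (rule order_tendstoD) (use B in simp)
  with k le B(1) eventually_ge_at_top[of 1] show ?thesis
  proof eventually_elim
    case (elim n)
    have "prob {\<omega> \<in> space M. vd_recovers {1..N n \<omega>}
           (add_clique (rgg_edges (\<lambda>i. X i \<omega>) (N n \<omega>) (r n)) (K n \<omega>)) (K n \<omega>)} \<le>
        B n + exp (- real n * H (1 - \<delta>)) + exp (- real n * H (1 + \<delta>))"
      by (rule prob_recovery_le) (use elim \<delta> in auto)
    then show ?case using elim by linarith
  qed
qed


text \<open>At \<open>\<delta> = 0\<close> the expression in the conclusion is \<open>\<alpha> * H a\<close>, so a reservoir of
  \<open>(1 - 3 * \<delta>) * n\<close> vertices is as good as all of them if \<open>\<delta>\<close> is small.\<close>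

lemma exists_supercritical_margin:
  assumes a: "1 \<le> a" and \<alpha>: "0 < \<alpha>" "H a < 1 / \<alpha>" and g: "0 < g"
  obtains \<delta> where "0 < \<delta>" "\<delta> < 1 / 4" "\<delta> \<le> g"
    "\<alpha> * ((1 - 3 * \<delta>) - a + a * ln (a / (1 - 3 * \<delta>))) < 1"
proof -
  have "((\<lambda>\<delta>. \<alpha> * ((1 - 3 * \<delta>) - a + a * ln (a / (1 - 3 * \<delta>)))) \<longlongrightarrow>
      \<alpha> * ((1 - 3 * 0) - a + a * ln (a / (1 - 3 * 0)))) (at_right (0::real))"
    using a by (intro tendsto_intros) auto
  moreover have "\<alpha> * ((1 - 3 * 0) - a + a * ln (a / (1 - 3 * 0))) < 1"
    using \<alpha> by (simp add: H_def field_simps)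
  ultimately have "\<forall>\<^sub>F \<delta> in at_right (0::real). \<alpha> * ((1 - 3 * \<delta>) - a + a * ln (a / (1 - 3 * \<delta>))) < 1"
    by (rule order_tendstoD)
  moreover have "\<forall>\<^sub>F \<delta> in at_right (0::real). \<delta> \<in> {0<..<min (1 / 4) g}"
    by (rule eventually_at_right_real) (use g in simp)
  ultimately have "\<forall>\<^sub>F \<delta> in at_right (0::real). \<alpha> * ((1 - 3 * \<delta>) - a + a * ln (a / (1 - 3 * \<delta>))) < 1 \<and>
      \<delta> \<in> {0<..<min (1 / 4) g}"
    by (rule eventually_conj)
  then obtain \<delta> where "\<alpha> * ((1 - 3 * \<delta>) - a + a * ln (a / (1 - 3 * \<delta>))) < 1" "\<delta> \<in> {0<..<min (1 / 4) g}"
    using eventually_happens[of _ "at_right (0::real)"] by auto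
  then show ?thesis by (intro that[of \<delta>]) auto
qed


lemma (in planted_rgg) recovery_tendsto_0_exchangeable:
  fixes r \<mu> :: "nat \<Rightarrow> real"
  assumes radius: "\<And>n. n \<ge> 1 \<Longrightarrow> 0 < r n \<and> r n < 1 / 4"
    and clique_size: "\<And>n. n \<ge> 1 \<Longrightarrow> k n \<ge> 2"
    and \<mu>: "\<And>n. \<mu> n = real n * measure lborel (ball (0 :: real ^ 'd) 1) * r n ^ CARD('d)"
    and top: "filterlim \<mu> at_top sequentially"
    and o: "\<mu> \<in> o(\<lambda>n. real n)" "(\<lambda>n. real (k n)) \<in> o(\<lambda>n. sqrt (\<mu> n))"
  shows "(\<lambda>n. prob {\<omega> \<in> space M. vd_recovers {1..N n \<omega>}
           (add_clique (rgg_edges (\<lambda>i. X i \<omega>) (N n \<omega>) (r n)) (K n \<omega>)) (K n \<omega>)}) \<longlonglongrightarrow> 0"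
    (is "?P \<longlonglongrightarrow> 0")
proof (rule tendstoI)
  fix e :: real assume e: "0 < e"
  define p where "p = (\<lambda>n. measure lborel (ball (0 :: real ^ 'd) 1) * r n ^ CARD('d))"
  have \<mu>p: "\<mu> n = real n * p n" for n by (simp add: \<mu> p_def mult.assoc)
  \<comment> \<open>The number of vertices outside the clique that are compared with one vertex of the clique.\<close>
  obtain J :: nat where J: "1 / (real J + 1) < e"
    using reals_Archimedean[OF e] by (auto simp: inverse_eq_divide add.commute)
  have \<mu>n: "(\<lambda>n. \<mu> n / real n) \<longlonglongrightarrow> 0" by (rule smalloD_tendsto[OF o(1)])
  have k\<mu>: "(\<lambda>n. real (k n) / sqrt (\<mu> n)) \<longlonglongrightarrow> 0" by (rule smalloD_tendsto[OF o(2)])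
  have p0: "p \<longlonglongrightarrow> 0"
    by (rule Lim_transform_eventually[OF \<mu>n])
       (use eventually_ge_at_top[of 1] in eventually_elim, simp add: \<mu>p)
  have sq: "filterlim (\<lambda>n. sqrt (\<mu> n)) at_top sequentially"
    by (rule filterlim_compose[OF sqrt_at_top top])
  have inv: "(\<lambda>n. c / f n) \<longlonglongrightarrow> 0" if "filterlim f at_top sequentially" for c :: real and f :: "nat \<Rightarrow> real"
    using that by (auto intro: tendsto_divide_0 filterlim_at_top_imp_at_infinity)
  define B where "B = (\<lambda>n. 1 / (real J + 1) + real J * (8 / (real n * p n) +
           2 * (real J + real (k n) + 1) / sqrt (real n * p n) + 10 ^ CARD('d) * p n))"
  have "(\<lambda>n. 2 * (real J + 1) / sqrt (\<mu> n) + 2 * (real (k n) / sqrt (\<mu> n))) \<longlonglongrightarrow> 0 + 2 * 0"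
    by (intro tendsto_add tendsto_mult tendsto_const inv sq k\<mu>)
  then have "(\<lambda>n. 2 * (real J + real (k n) + 1) / sqrt (\<mu> n)) \<longlonglongrightarrow> 0"
    by (simp add: add_divide_distrib algebra_simps)
  then have "B \<longlonglongrightarrow> 1 / (real J + 1) + real J * (0 + 0 + 10 ^ CARD('d) * 0)"
    unfolding B_def \<mu>p[symmetric] by (intro tendsto_add tendsto_mult tendsto_const inv top p0)
  then have B: "B \<longlonglongrightarrow> 1 / (real J + 1)" by simp
  have ev: "\<forall>\<^sub>F n in sequentially. 4 * (J + 1) \<le> n \<and> 1 \<le> n \<and> p n \<le> 1 / 2 \<and> real (k n) \<le> real n / 4"
  proof -
    have "\<forall>\<^sub>F n in sequentially. real (k n) / sqrt (\<mu> n) < 1"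
      using k\<mu> by (rule order_tendstoD) simp
    moreover have "\<forall>\<^sub>F n in sequentially. \<mu> n / real n < 1 / 4"
      using \<mu>n by (rule order_tendstoD) simp
    moreover have "\<forall>\<^sub>F n in sequentially. 1 \<le> \<mu> n"
      using top unfolding filterlim_at_top by blast
    moreover have "\<forall>\<^sub>F n in sequentially. p n < 1 / 2"
      using p0 by (rule order_tendstoD) simp
    ultimately show ?thesis
      using eventually_ge_at_top[of "4 * (J + 1)"] eventually_ge_at_top[of 1]
    proof eventually_elim
      case (elim n)
      have "real (k n) \<le> sqrt (\<mu> n)" using elim by (simp add: divide_less_eq)
      also have "\<dots> \<le> \<mu> n"
        using elim mult_left_mono[of 1 "sqrt (\<mu> n)" "sqrt (\<mu> n)"] by simp
      also have "\<dots> \<le> real n / 4" using elim by (simp add: divide_less_eq)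
      finally show ?case using elim by simp
    qed
  qed
  have "\<forall>\<^sub>F n in sequentially. ?P n < e"
  proof (rule eventually_recovery_less[where \<delta> = "1 / 2" and B = B])
    show "\<forall>\<^sub>F n in sequentially. 1 \<le> k n \<and> real (k n) \<le> (1 - 1 / 2) * real n"
      using ev by eventually_elim (use clique_size in \<open>fastforce simp: algebra_simps\<close>)
    show "\<forall>\<^sub>F n in sequentially. \<forall>m S. (1 - 1 / 2) * real n \<le> real m \<longrightarrow> real m \<le> (1 + 1 / 2) * real n \<longrightarrow>
      S \<subseteq> {1..m} \<longrightarrow> card S = k n \<longrightarrow>
      measure (PiM {1..m} (\<lambda>_. cube_points :: (real ^ 'd) measure))
        {x \<in> space (PiM {1..m} (\<lambda>_. cube_points)). degrees_compatible (r n) m S x} \<le> B n"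
      using ev
    proof eventually_elim
      case (elim n)
      show ?case
      proof (intro allI impI)
        fix m S assume m: "(1 - 1 / 2) * real n \<le> real m" and S: "S \<subseteq> {1..m}" "card S = k n"
        have kn: "2 \<le> k n" using clique_size elim by simp
        have rn: "0 < r n" "r n < 1 / 2" using radius[of n] elim by auto
        have "real (J + k n) \<le> real m" using m elim by simp
        then have JS: "J + card S \<le> m" unfolding S by linarith
        have "measure (PiM {1..m} (\<lambda>_. cube_points :: (real ^ 'd) measure))
            {x \<in> space (PiM {1..m} (\<lambda>_. cube_points)). degrees_compatible (r n) m S x} \<le>
          1 / (real J + 1) + real J * (8 / (real n * p n) +
           2 * (real J + real (card S) + 1) / sqrt (real n * p n) + 10 ^ CARD('d) * p n)"
          by (rule prob_degrees_compatible_le_exchangeable)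
             (use rn elim m S kn JS in \<open>auto simp: p_def\<close>)
        then show "measure (PiM {1..m} (\<lambda>_. cube_points :: (real ^ 'd) measure))
            {x \<in> space (PiM {1..m} (\<lambda>_. cube_points)). degrees_compatible (r n) m S x} \<le> B n"
          unfolding B_def S(2) .
      qed
    qed
    show "\<forall>\<^sub>F n in sequentially. 0 \<le> B n"
      using eventually_ge_at_top[of 1]
    proof eventually_elim
      case (elim n)
      then have "0 \<le> p n" using radius[of n] by (simp add: p_def)
      then show ?case by (simp add: B_def)
    qed
  qed (use B J in auto)
  then show "\<forall>\<^sub>F n in sequentially. dist (?P n) 0 < e"
    by eventually_elim simp
qed

lemma (in planted_rgg) recovery_tendsto_0_second_moment:
  fixes r \<mu> :: "nat \<Rightarrow> real"
  assumes radius: "\<And>n. n \<ge> 1 \<Longrightarrow> 0 < r n \<and> r n < 1 / 4"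
    and clique_size: "\<And>n. n \<ge> 1 \<Longrightarrow> k n \<ge> 2"
    and \<mu>: "\<And>n. \<mu> n = real n * measure lborel (ball (0 :: real ^ 'd) 1) * r n ^ CARD('d)"
    and \<alpha>: "0 < \<alpha>" "(\<lambda>n. \<mu> n / ln (real n)) \<longlonglongrightarrow> \<alpha>"
    and \<epsilon>: "0 < \<epsilon>" "\<epsilon> < 1"
    and k: "\<forall>\<^sub>F n in sequentially. real (k n) \<le> (1 - \<epsilon>) * (\<mu> n * H_plus_inv (1 / \<alpha>) - \<mu> n)"
  shows "(\<lambda>n. prob {\<omega> \<in> space M. vd_recovers {1..N n \<omega>}
           (add_clique (rgg_edges (\<lambda>i. X i \<omega>) (N n \<omega>) (r n)) (K n \<omega>)) (K n \<omega>)}) \<longlonglongrightarrow> 0"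
    (is "?P \<longlonglongrightarrow> 0")
proof -
  define p where "p = (\<lambda>n. measure lborel (ball (0 :: real ^ 'd) 1) * r n ^ CARD('d))"
  have \<mu>p: "\<mu> n = real n * p n" for n by (simp add: \<mu> p_def mult.assoc)
  have p_pos: "0 < p n" if "1 \<le> n" for n
    using radius[OF that] content_ball[of 1 "0 :: real ^ 'd"] by (simp add: p_def)
  define c where "c = H_plus_inv (1 / \<alpha>)"
  have c: "1 < c" "H c = 1 / \<alpha>" using H_plus_inv_props[of "1 / \<alpha>"] \<alpha> by (auto simp: c_def)
  \<comment> \<open>The clique brings degrees up to about \<open>(1 + (1 - \<epsilon>) * (c - 1)) * \<mu> n\<close>; half of the margin
    is kept for \<open>a < c\<close>, the other half for the fluctuations.\<close>
  define a where "a = 1 + (1 - \<epsilon> / 2) * (c - 1)"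
  have "(1 - \<epsilon> / 2) * (c - 1) < 1 * (c - 1)" using \<epsilon> c by (intro mult_strict_right_mono) auto
  then have ac: "a < c" by (simp add: a_def)
  have a1: "1 < a" using \<epsilon> c by (simp add: a_def)
  have Ha: "H a < 1 / \<alpha>" using H_strict_mono[of a c] a1 ac c by simp
  obtain \<delta> where \<delta>: "0 < \<delta>" "\<delta> < 1 / 4" "\<delta> \<le> \<epsilon> / 4 * (c - 1)"
    "\<alpha> * ((1 - 3 * \<delta>) - a + a * ln (a / (1 - 3 * \<delta>))) < 1"
    using exists_supercritical_margin[of a \<alpha> "\<epsilon> / 4 * (c - 1)"] a1 \<alpha> Ha \<epsilon> c by auto
  obtain \<kappa> where \<kappa>: "\<alpha> * ((1 - 3 * \<delta>) - a + a * ln (a / (1 - 3 * \<delta>))) < \<kappa>" "\<kappa> < 1"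
    using dense[OF \<delta>(4)] by auto
  define t where "t = (\<lambda>n. nat \<lceil>a * \<mu> n\<rceil>)"
  \<comment> \<open>The sizes of the reservoir and of the set of candidates leave \<open>\<delta> * n\<close> of at least
    \<open>(1 - \<delta>) * n\<close> vertices for the clique.\<close>
  define R where "R = (\<lambda>n. nat \<lfloor>(1 - 3 * \<delta>) * real n\<rfloor>)"
  define L where "L = (\<lambda>n. nat \<lfloor>\<delta> * real n\<rfloor>)"
  define q where "q = (\<lambda>n. real (R n choose t n) * p n ^ t n * (1 - p n) ^ (R n - t n))"
  have \<mu>_pos: "0 < \<mu> n" if "1 \<le> n" for n using p_pos[OF that] that by (simp add: \<mu>p)
  have n_top: "filterlim (\<lambda>n. real n) at_top sequentially" by (rule filterlim_real_sequentially)
  have ln_top: "filterlim (\<lambda>n. ln (real n)) at_top sequentially" by real_asymp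
  have ev3: "\<forall>\<^sub>F n in sequentially. (3 :: nat) \<le> n" by (rule eventually_ge_at_top)
  have top: "filterlim \<mu> at_top sequentially"
  proof (rule filterlim_mono_eventually[OF _ order_refl order_refl])
    show "filterlim (\<lambda>n. \<mu> n / ln (real n) * ln (real n)) at_top sequentially"
      by (rule filterlim_tendsto_pos_mult_at_top[OF \<alpha>(2,1) ln_top])
    show "\<forall>\<^sub>F n in sequentially. \<mu> n / ln (real n) * ln (real n) = \<mu> n"
      using ev3 by eventually_elim simp
  qed
  have \<mu>_pow: "(\<lambda>n. \<mu> n / real n * real n powr s) \<longlonglongrightarrow> 0" if "s < 1" for s
  proof -
    have "(\<lambda>n. ln (real n) / real n * real n powr s) \<longlonglongrightarrow> 0" using that by real_asymp
    then have "(\<lambda>n. \<mu> n / ln (real n) * (ln (real n) / real n * real n powr s)) \<longlonglongrightarrow> 0"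
      using tendsto_mult[OF \<alpha>(2)] by fastforce
    then show ?thesis
      by (rule Lim_transform_eventually) (use ev3 in eventually_elim, simp)
  qed
  have \<mu>n: "(\<lambda>n. \<mu> n / real n) \<longlonglongrightarrow> 0"
    by (rule Lim_transform_eventually[OF \<mu>_pow[of 0]]) (use ev3 in \<open>simp, eventually_elim, simp\<close>)
  have p_lim: "p \<longlonglongrightarrow> 0"
    by (rule Lim_transform_eventually[OF \<mu>n]) (use ev3 in eventually_elim, simp add: \<mu>p)
  have t\<mu>: "(\<lambda>n. real (t n) / \<mu> n) \<longlonglongrightarrow> a"
  proof (rule tendsto_rounded[OF top])
    show "\<forall>\<^sub>F n in sequentially. \<bar>real (t n) - a * \<mu> n\<bar> \<le> 1"
      using ev3
    proof eventually_elim
      case (elim n)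
      have "0 < a * \<mu> n" using \<mu>_pos[of n] a1 elim by simp
      then have "real (t n) = of_int \<lceil>a * \<mu> n\<rceil>" by (simp add: t_def)
      then show ?case by linarith
    qed
  qed
  have Rn: "(\<lambda>n. real (R n) / real n) \<longlonglongrightarrow> 1 - 3 * \<delta>"
  proof (rule tendsto_rounded[OF n_top], rule always_eventually, rule allI)
    fix n
    have "0 \<le> (1 - 3 * \<delta>) * real n" using \<delta> by simp
    then have "real (R n) = of_int \<lfloor>(1 - 3 * \<delta>) * real n\<rfloor>" by (simp add: R_def)
    then show "\<bar>real (R n) - (1 - 3 * \<delta>) * real n\<bar> \<le> 1" by linarith
  qed
  have Ln: "(\<lambda>n. real (L n) / real n) \<longlonglongrightarrow> \<delta>"
  proof (rule tendsto_rounded[OF n_top], rule always_eventually, rule allI)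
    fix n
    have "0 \<le> \<delta> * real n" using \<delta> by simp
    then have "real (L n) = of_int \<lfloor>\<delta> * real n\<rfloor>" by (simp add: L_def)
    then show "\<bar>real (L n) - \<delta> * real n\<bar> \<le> 1" by linarith
  qed
  have tn: "(\<lambda>n. real (t n) / real n) \<longlonglongrightarrow> 0"
  proof -
    have "(\<lambda>n. real (t n) / \<mu> n * (\<mu> n / real n)) \<longlonglongrightarrow> 0"
      using tendsto_mult[OF t\<mu> \<mu>n] by simp
    then show ?thesis
      by (rule Lim_transform_eventually)
         (use ev3 in eventually_elim, use \<mu>_pos in \<open>fastforce simp: less_imp_neq[symmetric]\<close>)
  qed
  have tp: "(\<lambda>n. real (t n) * p n) \<longlonglongrightarrow> 0"
  proof -
    \<comment> \<open>The product of \<open>t n\<close> and \<open>p n\<close> is of the order of \<open>\<mu> n * \<mu> n / n\<close>.\<close>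
    have "(\<lambda>n. (\<mu> n / real n * real n powr (1 / 2)) * (\<mu> n / real n * real n powr (1 / 2))) \<longlonglongrightarrow> 0"
      using tendsto_mult[OF \<mu>_pow[of "1 / 2"] \<mu>_pow[of "1 / 2"]] by simp
    then have "(\<lambda>n. real (t n) / \<mu> n * ((\<mu> n / real n * real n powr (1 / 2)) * (\<mu> n / real n * real n powr (1 / 2)))) \<longlonglongrightarrow> 0"
      using tendsto_mult[OF t\<mu>] by fastforce
    then show ?thesis
    proof (rule Lim_transform_eventually)
      show "\<forall>\<^sub>F n in sequentially. real (t n) / \<mu> n * ((\<mu> n / real n * real n powr (1 / 2)) *
          (\<mu> n / real n * real n powr (1 / 2))) = real (t n) * p n"
        using ev3
      proof eventually_elim
        case (elim n)
        have "real n powr (1 / 2) * real n powr (1 / 2) = real n"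
          by (simp add: powr_add[symmetric])
        then have "(\<mu> n / real n * real n powr (1 / 2)) * (\<mu> n / real n * real n powr (1 / 2)) =
            (\<mu> n / real n) * (\<mu> n / real n) * real n"
          by (simp only: mult_ac)
        also have "\<dots> = \<mu> n * p n" using elim by (simp add: \<mu>p)
        finally show ?case using \<mu>_pos[of n] elim by simp
      qed
    qed
  qed
  \<comment> \<open>The bound of \<open>prob_degrees_compatible_le_second_moment\<close>, with \<open>q n\<close> replaced by its lower bound
    \<open>n powr - \<kappa>\<close>.\<close>
  define B where "B = (\<lambda>n. (1 + \<delta>) / \<delta>\<^sup>2 / \<mu> n + (2 / \<delta> * real n powr (\<kappa> - 1) +
      (1 / (1 - p n) ^ (2 * t n) - 1) + 10 ^ CARD('d) * (\<mu> n / real n * real n powr \<kappa>)))"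
  have pw: "(\<lambda>n. (1 - p n) ^ (2 * t n)) \<longlonglongrightarrow> 1"
  proof (rule tendsto_sandwich)
    have "(\<lambda>n. 1 - 2 * (real (t n) * p n)) \<longlonglongrightarrow> 1 - 2 * 0"
      by (intro tendsto_intros tp)
    then show "(\<lambda>n. 1 - 2 * (real (t n) * p n)) \<longlonglongrightarrow> 1" by simp
    have ev: "\<forall>\<^sub>F n in sequentially. p n < 1" using p_lim by (rule order_tendstoD) simp
    show "\<forall>\<^sub>F n in sequentially. 1 - 2 * (real (t n) * p n) \<le> (1 - p n) ^ (2 * t n)"
      using ev by eventually_elim (use Bernoulli_inequality[of "- p _" "2 * t _"] in \<open>simp add: mult_ac\<close>)
    show "\<forall>\<^sub>F n in sequentially. (1 - p n) ^ (2 * t n) \<le> 1"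
      using ev ev3 by eventually_elim (use p_pos in \<open>simp add: power_le_one less_imp_le\<close>)
  qed simp
  have "(\<lambda>n. 1 / (1 - p n) ^ (2 * t n) - 1) \<longlonglongrightarrow> 0"
    using tendsto_diff[OF tendsto_divide[OF tendsto_const pw] tendsto_const, of 1 1] by simp
  moreover have "(\<lambda>n. (1 + \<delta>) / \<delta>\<^sup>2 / \<mu> n) \<longlonglongrightarrow> 0"
    by (rule tendsto_divide_0[OF tendsto_const filterlim_at_top_imp_at_infinity[OF top]])
  moreover have "(\<lambda>n. real n powr (\<kappa> - 1)) \<longlonglongrightarrow> 0" using \<kappa>(2) by real_asymp
  ultimately have "B \<longlonglongrightarrow> 0 + (2 / \<delta> * 0 + 0 + 10 ^ CARD('d) * 0)"
    unfolding B_def by (intro tendsto_add tendsto_mult tendsto_const \<mu>_pow[OF \<kappa>(2)])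
  then have B: "B \<longlonglongrightarrow> 0" by simp
  have q_ge: "\<forall>\<^sub>F n in sequentially. real n powr (- \<kappa>) \<le> q n"
    unfolding q_def
    by (rule binomial_prob_rate[OF \<mu>p p_pos \<alpha>(2,1) Rn _ t\<mu> _ \<kappa>(1)]) (use \<delta> a1 in auto)
  have k_le: "\<forall>\<^sub>F n in sequentially. (1 + 2 * \<delta>) * \<mu> n + real (k n) \<le> real (t n)"
    using k ev3
  proof eventually_elim
    case (elim n)
    have "1 + 2 * \<delta> + (1 - \<epsilon>) * (c - 1) \<le> a"
    proof -
      have "(1 - \<epsilon> / 2) * (c - 1) = (1 - \<epsilon>) * (c - 1) + 2 * (\<epsilon> / 4 * (c - 1))"
        by (simp add: field_simps)
      then show ?thesis using \<delta>(3) unfolding a_def by linarith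
    qed
    then have "(1 + 2 * \<delta> + (1 - \<epsilon>) * (c - 1)) * \<mu> n \<le> a * \<mu> n"
      using \<mu>_pos[of n] elim by (intro mult_right_mono) auto
    moreover have "a * \<mu> n \<le> real (t n)" unfolding t_def by linarith
    moreover have "real (k n) \<le> (1 - \<epsilon>) * (c - 1) * \<mu> n"
      using elim(1) unfolding c_def by (simp add: algebra_simps)
    moreover have "(1 + 2 * \<delta> + (1 - \<epsilon>) * (c - 1)) * \<mu> n = (1 + 2 * \<delta>) * \<mu> n + (1 - \<epsilon>) * (c - 1) * \<mu> n"
      by (rule distrib_right)
    ultimately show ?case by linarith
  qed
  have ev: "\<forall>\<^sub>F n in sequentially. 3 \<le> n \<and> p n \<le> 1 / 2 \<and> 2 * t n \<le> R n \<and> \<delta> / 2 * real n \<le> real (L n) \<and>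
      1 \<le> L n \<and> real (t n) \<le> \<delta> * real n"
  proof -
    have "\<forall>\<^sub>F n in sequentially. p n < 1 / 2" using p_lim by (rule order_tendstoD) simp
    moreover have "\<forall>\<^sub>F n in sequentially. real (t n) / real n < \<delta> / 2"
      using tn by (rule order_tendstoD) (use \<delta> in simp)
    moreover have "\<forall>\<^sub>F n in sequentially. \<delta> < real (R n) / real n"
      using Rn by (rule order_tendstoD) (use \<delta> in simp)
    moreover have "\<forall>\<^sub>F n in sequentially. \<delta> / 2 < real (L n) / real n"
      using Ln by (rule order_tendstoD) (use \<delta> in simp)
    ultimately show ?thesis using ev3
    proof eventually_elim
      case (elim n)
      then have n0: "0 < real n" by simp
      have *: "real (t n) < \<delta> / 2 * real n" "\<delta> * real n < real (R n)" "\<delta> / 2 * real n < real (L n)"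
        using elim n0 by (simp_all add: pos_divide_less_eq pos_less_divide_eq)
      have "0 < \<delta> / 2 * real n" using \<delta> n0 by simp
      then have "0 < real (L n)" "real (t n) \<le> \<delta> * real n" using * by linarith+
      moreover have "2 * real (t n) \<le> real (R n)" using * by linarith
      ultimately show ?case using elim * by auto
    qed
  qed
  show ?thesis
  proof (rule tendstoI)
    fix e :: real assume e: "0 < e"
    have "\<forall>\<^sub>F n in sequentially. ?P n < e"
    proof (rule eventually_recovery_less[where \<delta> = \<delta> and B = B])
      show "\<forall>\<^sub>F n in sequentially. 1 \<le> k n \<and> real (k n) \<le> (1 - \<delta>) * real n"
        using ev k_le
      proof eventually_elim
        case (elim n)
        have "0 \<le> (1 + 2 * \<delta>) * \<mu> n" using elim \<mu>_pos[of n] \<delta> by simp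
        then have "real (k n) \<le> \<delta> * real n" using elim by linarith
        also have "\<dots> \<le> (1 - \<delta>) * real n" using \<delta> by (intro mult_right_mono) auto
        finally show ?case using clique_size[of n] elim by simp
      qed
      show "\<forall>\<^sub>F n in sequentially. \<forall>m S. (1 - \<delta>) * real n \<le> real m \<longrightarrow> real m \<le> (1 + \<delta>) * real n \<longrightarrow>
        S \<subseteq> {1..m} \<longrightarrow> card S = k n \<longrightarrow>
        measure (PiM {1..m} (\<lambda>_. cube_points :: (real ^ 'd) measure))
          {x \<in> space (PiM {1..m} (\<lambda>_. cube_points)). degrees_compatible (r n) m S x} \<le> B n"
        using ev k_le q_ge
      proof eventually_elim
        case (elim n)
        have n0: "0 < real n" "1 \<le> n" using elim by auto
        have "0 < real n powr (- \<kappa>)" using n0 by simp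
        then have q0: "0 < q n" using elim by linarith
        have "0 \<le> (1 + 2 * \<delta>) * \<mu> n" using elim \<mu>_pos[of n] \<delta> by simp
        then have k_n: "real (k n) \<le> \<delta> * real n" using elim by linarith
        have "0 \<le> (1 - 3 * \<delta>) * real n" "0 \<le> \<delta> * real n" using \<delta> by auto
        then have RL: "real (R n) \<le> (1 - 3 * \<delta>) * real n" "real (L n) \<le> \<delta> * real n"
          unfolding R_def L_def by linarith+
        have Lq: "1 / (real (L n) * q n) \<le> 2 / \<delta> * real n powr (\<kappa> - 1)"
        proof -
          have "(\<delta> / 2 * real n) * real n powr (- \<kappa>) \<le> real (L n) * q n"
            using elim \<delta> n0 by (intro mult_mono) auto
          then have "1 / (real (L n) * q n) \<le> 1 / ((\<delta> / 2 * real n) * real n powr (- \<kappa>))"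
            using \<delta> n0 elim q0 by (intro divide_left_mono mult_pos_pos) auto
          also have "\<dots> = 2 / \<delta> * real n powr (\<kappa> - 1)"
            using n0 by (simp add: powr_diff powr_minus field_simps)
          finally show ?thesis .
        qed
        have pq: "10 ^ CARD('d) * p n / q n \<le> 10 ^ CARD('d) * (\<mu> n / real n * real n powr \<kappa>)"
        proof -
          have "p n / q n \<le> p n / real n powr (- \<kappa>)"
            using p_pos[of n] n0 elim q0 by (intro divide_left_mono) auto
          also have "\<dots> = \<mu> n / real n * real n powr \<kappa>"
            using n0 by (simp add: \<mu>p powr_minus divide_inverse)
          finally show ?thesis by (simp add: mult_left_mono flip: times_divide_eq_right)
        qed
        show ?case
        proof (intro allI impI)
          fix m S assume m: "(1 - \<delta>) * real n \<le> real m" "real m \<le> (1 + \<delta>) * real n"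
            and S: "S \<subseteq> {1..m}" "card S = k n"
          have "real (R n + L n + k n) \<le> real m"
            using RL k_n m(1) by (simp add: algebra_simps)
          then have RLk: "R n + L n + card S \<le> m" unfolding S by linarith
          have rn: "0 < r n" "r n < 1 / 2" using radius[of n] n0 by auto
          have kn: "1 \<le> card S" using clique_size[of n] n0 S by simp
          have pn: "p n = measure lborel (ball (0 :: real ^ 'd) 1) * r n ^ CARD('d)" "p n \<le> 1 / 2"
            using elim by (simp_all add: p_def)
          have Lt: "1 \<le> L n" "2 * t n \<le> R n" using elim by auto
          have tk: "(1 + 2 * \<delta>) * (real n * p n) + real (card S) \<le> real (t n)"
            unfolding \<mu>p[symmetric] S(2) using elim by blast
          have qn: "q n = real (R n choose t n) * p n ^ t n * (1 - p n) ^ (R n - t n)"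
            by (simp only: q_def)
          have "measure (PiM {1..m} (\<lambda>_. cube_points :: (real ^ 'd) measure))
              {x \<in> space (PiM {1..m} (\<lambda>_. cube_points)). degrees_compatible (r n) m S x} \<le>
            (1 + \<delta>) / (\<delta>\<^sup>2 * (real n * p n)) +
             (1 / (real (L n) * q n) + (1 / (1 - p n) ^ (2 * t n) - 1) + 10 ^ CARD('d) * p n / q n)"
            by (rule prob_degrees_compatible_le_second_moment
                [OF rn pn n0(2) m(2) \<delta>(1) S(1) kn RLk Lt tk qn q0])
          also have "\<dots> \<le> B n"
            unfolding B_def \<mu>p[symmetric] using Lq pq by simp
          finally show "measure (PiM {1..m} (\<lambda>_. cube_points :: (real ^ 'd) measure))
              {x \<in> space (PiM {1..m} (\<lambda>_. cube_points)). degrees_compatible (r n) m S x} \<le> B n" .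
        qed
      qed
      show "\<forall>\<^sub>F n in sequentially. 0 \<le> B n"
        using ev
      proof eventually_elim
        case (elim n)
        have "(1 - p n) ^ (2 * t n) \<le> 1" "0 < (1 - p n) ^ (2 * t n)"
          using p_pos[of n] elim by (auto intro!: power_le_one)
        then have "1 \<le> 1 / (1 - p n) ^ (2 * t n)" by simp
        moreover have "0 < \<mu> n" using \<mu>_pos[of n] elim by simp
        ultimately show ?case using \<delta> by (simp add: B_def)
      qed
    qed (use B e \<delta> in auto)
    then show "\<forall>\<^sub>F n in sequentially. dist (?P n) 0 < e"
      by eventually_elim simp
  qed
qed

theorem theorem3:
  fixes M :: "'a measure" and X :: "nat \<Rightarrow> 'a \<Rightarrow> real ^ 'd"
    and N :: "nat \<Rightarrow> 'a \<Rightarrow> nat" and K :: "nat \<Rightarrow> 'a \<Rightarrow> nat set"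
    and k :: "nat \<Rightarrow> nat" and r \<mu> :: "nat \<Rightarrow> real"
  assumes model: "planted_rgg M X N K k"
    and radius: "\<And>n. n \<ge> 1 \<Longrightarrow> 0 < r n \<and> r n < 1 / 4"
    and clique_size: "\<And>n. n \<ge> 1 \<Longrightarrow> k n \<ge> 2"
    and expected_degree:
      "\<And>n. \<mu> n = real n * measure lborel (ball (0 :: real ^ 'd) 1) * r n ^ CARD('d)"
    and regime:
      "(\<exists>\<alpha>>0. (\<lambda>n. \<mu> n / ln (real n)) \<longlonglongrightarrow> \<alpha> \<and>
          (\<exists>\<epsilon>. 0 < \<epsilon> \<and> \<epsilon> < 1 \<and>
            (\<forall>\<^sub>F n in sequentially.
              real (k n) \<le> (1 - \<epsilon>) * (\<mu> n * H_plus_inv (1 / \<alpha>) - \<mu> n)))) \<or>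
       (filterlim (\<lambda>n. \<mu> n / ln (real n)) at_top sequentially \<and>
          \<mu> \<in> o(\<lambda>n. real n) \<and> (\<lambda>n. real (k n)) \<in> o(\<lambda>n. sqrt (\<mu> n)))"
  shows "(\<lambda>n. measure M {\<omega> \<in> space M.
             vd_recovers {1..N n \<omega>}
               (add_clique (rgg_edges (\<lambda>i. X i \<omega>) (N n \<omega>) (r n)) (K n \<omega>)) (K n \<omega>)})
         \<longlonglongrightarrow> 0"
proof -
  interpret planted_rgg M X N K k by (rule model)
  from regime show ?thesis
  proof (elim disjE exE conjE)
    fix \<alpha> \<epsilon> :: real
    assume "0 < \<alpha>" "(\<lambda>n. \<mu> n / ln (real n)) \<longlonglongrightarrow> \<alpha>" "0 < \<epsilon>" "\<epsilon> < 1"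
      "\<forall>\<^sub>F n in sequentially. real (k n) \<le> (1 - \<epsilon>) * (\<mu> n * H_plus_inv (1 / \<alpha>) - \<mu> n)"
    then show ?thesis
      by (intro recovery_tendsto_0_second_moment[OF radius clique_size expected_degree])
  next
    assume *: "filterlim (\<lambda>n. \<mu> n / ln (real n)) at_top sequentially"
      "\<mu> \<in> o(\<lambda>n. real n)" "(\<lambda>n. real (k n)) \<in> o(\<lambda>n. sqrt (\<mu> n))"
    have ln_top: "filterlim (\<lambda>n. ln (real n)) at_top sequentially" by real_asymp
    have "filterlim \<mu> at_top sequentially"
    proof (rule filterlim_mono_eventually[OF _ order_refl order_refl])
      show "filterlim (\<lambda>n. \<mu> n / ln (real n) * ln (real n)) at_top sequentially"
        by (rule filterlim_at_top_mult_at_top[OF *(1) ln_top])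
      show "\<forall>\<^sub>F n in sequentially. \<mu> n / ln (real n) * ln (real n) = \<mu> n"
        using eventually_ge_at_top[of 3] by eventually_elim simp
    qed
    then show ?thesis
      by (intro recovery_tendsto_0_exchangeable[OF radius clique_size expected_degree _ *(2,3)])
  qed
qed

end
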